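(* Let $n\ge3$ and let $k$ be a positive integer. For every integer $t\geq 0$ let $(X_{2t},W_{2t})$ be a cubature rule for $\mu$ of algebraic degree $2t$, and let $(h_s)_{s\in\mathbb{N}}$ be a sequence of univariate real polynomials which are nonnegative on $[-1,1]$. Put $d_s:=\deg(h_s)$, \[Q_s:=\{F\in R_{2k}:\ F(x)\ge0\ \text{for all }x\in X_{2(k+d_s)}\},\qquad A_s:=\hat{\Gamma}_{h_s}(Q_s).\] Then: (1) The sets $A_s$ are polyhedral cones satisfying $A_s\subseteq P_{2k}\subseteq R_{2k}$ for every $s$. (2) Assume $\hat{\Gamma}_{h_s}:R_{2k}\to R_{2k}$ is invertible. If $f\in R_{2k}$ satisfies \[\min_{x\in X_{2(k+d_s)}}f(x)>\frac{\tau_{2k}(h_s)}{\sqrt{\mu(S)}}\|f\|_2\] then $f\in A_s$. (3) If $\lim_{s\to\infty}\tau_{2k}(h_s)=0$ then every polynomial in $R_{2k}$ which is strictly positive on $S$ is contained in some $A_s$, and in particular \[P_{2k}=\overline{\bigcup_{s=0}^\infty A_s}.\]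
   Context: $S\subseteq\mathbb{R}^n$ is the unit sphere, $\mu$ is the $(n-1)$-dimensional area measure on $S$, $R_d\subseteq\mathbb{R}[x_1,\dots,x_n]$ is the space of homogeneous polynomials of degree $d$, $H_d\subseteq R_d$ is the subspace of harmonic ones, and $P_{2k}\subseteq R_{2k}$ is the cone of forms nonnegative on $S$. $\|f\|_2=(\int_S f^2d\mu)^{1/2}$. A cubature rule of algebraic degree $2t$ for $\mu$ is a pair $(X,W)$ with $X\subseteq S$ finite and $W:X\to\mathbb{R}_{>0}$ such that $\int_S f\,d\mu=\sum_{x\in X}W(x)f(x)$ for every $f\in R_{2t}$. For a univariate polynomial $h(t)=\sum_i a_it^i$, the averaging operator $\hat{\Gamma}_h:R_{2k}\to R_{2k}$ is $\hat{\Gamma}_h(f)(x)=\sum_{j}a_{2j}\|x\|^{2(k-j)}\int_S\langle x,y\rangle^{2j}f(y)\,d\mu(y)$ (only even-degree coefficients of $h$ enter; for $j>k$ this is division by $\|x\|^{2(j-k)}$, and the quotient is a polynomial). With $\alpha=\frac{n-2}{2}$, the Gegenbauer polynomials are given by $C_0^{(\alpha)}(t)=1$, $C_1^{(\alpha)}(t)=2\alpha t$, $C_j^{(\alpha)}(t)=\frac1j[2t(j+\alpha-1)C_{j-1}^{(\alpha)}(t)-(j+2\alpha-2)C_{j-2}^{(\alpha)}(t)]$ for $j\ge2$, and the normalized ones are $g_j(t)=\frac{\dim(H_j)}{\mu(S)C_j^{(\alpha)}(1)}C_j^{(\alpha)}(t)$. Writing $h=\sum_j\lambda_jg_j$ (with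 $\lambda_j=0$ for $j>\deg h$), the Frobenius threshold of $h$ in degree $2k$ is \[\tau_{2k}(h)=\sqrt{\sum_{j=0}^{k}\dim(H_{2j})\left(\frac1{\lambda_{2j}}-1\right)^2},\] with the convention $\tau_{2k}(h)=+\infty$ if $\lambda_{2j}=0$ for some $0\le j\le k$. *)

theory Defs
  imports "HOL-Analysis.Analysis" "HOL-Library.Function_Algebras"
begin

section \<open>Function spaces as real vector spaces\<close>

instantiation "fun" :: (type, real_vector) real_vector
begin

definition scaleR_fun :: "real \<Rightarrow> ('a \<Rightarrow> 'b) \<Rightarrow> 'a \<Rightarrow> 'b"
  where "scaleR_fun c f = (\<lambda>x. c *\<^sub>R f x)"

instance
  by standard (simp_all add: scaleR_fun_def fun_eq_iff algebra_simps)

end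

lemma scaleR_fun_apply [simp]: "(c *\<^sub>R f) x = c *\<^sub>R f x"
  by (simp add: scaleR_fun_def)


section \<open>Forms and harmonic forms\<close>

text \<open>Forms are identified with the functions they induce; since the real field is infinite, this
  identification is injective. The library's topology on function spaces is that of pointwise
  convergence; on the finite-dimensional space \<open>forms d\<close> it induces the Euclidean topology, the
  only Hausdorff vector space topology there.\<close>

definition monomial_fun :: "('n::finite \<Rightarrow> nat) \<Rightarrow> real ^ 'n \<Rightarrow> real"
  where "monomial_fun a = (\<lambda>x. \<Prod>i\<in>UNIV. (x $ i) ^ a i)"

definition forms :: "nat \<Rightarrow> (real ^ 'n::finite \<Rightarrow> real) set"
  where "forms d = span {monomial_fun a |a. (\<Sum>i\<in>UNIV. a i) = d}"

definition laplacian :: "(real ^ 'n::finite \<Rightarrow> real) \<Rightarrow> real ^ 'n \<Rightarrow> real"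
  where "laplacian f x = (\<Sum>i\<in>UNIV. (deriv ^^ 2) (\<lambda>t. f (x + t *\<^sub>R axis i 1)) 0)"

definition harmonic_forms :: "nat \<Rightarrow> (real ^ 'n::finite \<Rightarrow> real) set"
  where "harmonic_forms d = {f \<in> forms d. \<forall>x. laplacian f x = 0}"

definition nonneg_forms :: "nat \<Rightarrow> (real ^ 'n::finite \<Rightarrow> real) set"
  where "nonneg_forms d = {f \<in> forms d. \<forall>x\<in>sphere 0 1. 0 \<le> f x}"


section \<open>Area measure on the unit sphere\<close>

text \<open>The area of a Borel set \<open>E\<close> of the sphere is \<open>n\<close> times the volume of the cone
  \<open>{r y | 0 < r \<le> 1, y \<in> E}\<close> over it (the measure of the polar coordinates formula).\<close>

definition sphere_measure :: "(real ^ 'n::finite) measure"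
  where "sphere_measure = scale_measure (of_nat CARD('n))
    (distr (restrict_space lborel (cball 0 1 - {0})) (restrict_space borel (sphere 0 1)) sgn)"

lemma emeasure_sphere_measure:
  fixes E :: "(real ^ 'n::finite) set"
  assumes "E \<in> sets borel" "E \<subseteq> sphere 0 1"
  shows "emeasure sphere_measure E =
    of_nat CARD('n) * emeasure lborel ((\<lambda>(r, y). r *\<^sub>R y) ` ({0<..1} \<times> E))"
proof -
  let ?B = "cball 0 1 - {0} :: (real ^ 'n) set"
  have sgnm: "sgn \<in> measurable (restrict_space lborel ?B) (restrict_space borel (sphere (0::real^'n) 1))"
    by (rule measurable_restrict_space3) (auto simp: norm_sgn)
  have E: "E \<in> sets (restrict_space borel (sphere 0 1))"
    using assms by (simp add: sets_restrict_space_iff)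
  have eq: "sgn -` E \<inter> ?B = (\<lambda>(r, y). r *\<^sub>R y) ` ({0<..1} \<times> E)"
  proof (intro equalityI subsetI)
    fix x assume x: "x \<in> sgn -` E \<inter> ?B"
    then have "x = norm x *\<^sub>R sgn x" by (simp add: sgn_div_norm)
    then show "x \<in> (\<lambda>(r, y). r *\<^sub>R y) ` ({0<..1} \<times> E)"
      using x by (intro image_eqI[of _ _ "(norm x, sgn x)"]) auto
  next
    fix x assume "x \<in> (\<lambda>(r, y). r *\<^sub>R y) ` ({0<..1} \<times> E)"
    then obtain r y where "x = r *\<^sub>R y" "0 < r" "r \<le> 1" "y \<in> E" by auto
    moreover have "norm y = 1" using \<open>y \<in> E\<close> assms(2) by auto
    ultimately show "x \<in> sgn -` E \<inter> ?B"
      by (auto simp: sgn_div_norm)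
  qed
  have "emeasure (distr (restrict_space lborel ?B) (restrict_space borel (sphere 0 1)) sgn) E
      = emeasure (restrict_space lborel ?B) (sgn -` E \<inter> ?B)"
    by (subst emeasure_distr[OF sgnm E]) (simp add: space_restrict_space)
  also have "\<dots> = emeasure lborel (sgn -` E \<inter> ?B)"
    by (rule emeasure_restrict_space) auto
  finally show ?thesis
    by (simp add: sphere_measure_def eq)
qed

definition sphere_L2_norm :: "(real ^ 'n::finite \<Rightarrow> real) \<Rightarrow> real"
  where "sphere_L2_norm f = sqrt (LINT x|sphere_measure. (f x)\<^sup>2)"

definition cubature_rule :: "nat \<Rightarrow> (real ^ 'n::finite) set \<Rightarrow> (real ^ 'n \<Rightarrow> real) \<Rightarrow> bool"
  where "cubature_rule d X W \<longleftrightarrow>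
    finite X \<and> X \<subseteq> sphere 0 1 \<and> (\<forall>x\<in>X. 0 < W x) \<and>
    (\<forall>f\<in>forms d. (LINT x|sphere_measure. f x) = (\<Sum>x\<in>X. W x * f x))"


section \<open>Averaging operators\<close>

text \<open>\<open>averaging_op k h\<close> acts on forms of degree \<open>2k\<close>. For \<open>k \<ge> 1\<close> the formula also
  gives the right value at \<open>x = 0\<close>: every summand is \<open>0\<close> there, which is the value of a form of
  positive degree.\<close>

definition averaging_op ::
    "nat \<Rightarrow> real poly \<Rightarrow> (real ^ 'n::finite \<Rightarrow> real) \<Rightarrow> real ^ 'n \<Rightarrow> real"
  where "averaging_op k h f x =
    (\<Sum>j\<le>degree h. coeff h (2 * j) * norm x powi (2 * (int k - int j)) *
      (LINT y|sphere_measure. (x \<bullet> y) ^ (2 * j) * f y))"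


section \<open>Gegenbauer polynomials and the Frobenius threshold\<close>

fun gegenbauer :: "real \<Rightarrow> nat \<Rightarrow> real poly"
  where
    "gegenbauer \<alpha> 0 = 1"
  | "gegenbauer \<alpha> (Suc 0) = [:0, 2 * \<alpha>:]"
  | "gegenbauer \<alpha> (Suc (Suc m)) = (let j = real (Suc (Suc m)) in
      smult (1 / j)
        ([:0, 2 * (j + \<alpha> - 1):] * gegenbauer \<alpha> (Suc m)
          - smult (j + 2 * \<alpha> - 2) (gegenbauer \<alpha> m)))"

text \<open>The argument of type \<open>'n itself\<close> supplies the dimension \<open>n = CARD('n)\<close>.\<close>

definition normalized_gegenbauer :: "'n::finite itself \<Rightarrow> nat \<Rightarrow> real poly"
  where "normalized_gegenbauer _ j =
    (let C = gegenbauer ((real CARD('n) - 2) / 2) j in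
      smult (real (dim (harmonic_forms j :: (real ^ 'n \<Rightarrow> real) set)) /
        (measure (sphere_measure :: (real ^ 'n) measure) (sphere 0 1) * poly C 1)) C)"

text \<open>For \<open>n \<ge> 3\<close> the \<open>j\<close>-th normalized Gegenbauer polynomial has degree exactly \<open>j\<close>, so the
  coefficient sequence exists and is unique.\<close>

definition gegenbauer_coeff :: "'n::finite itself \<Rightarrow> real poly \<Rightarrow> nat \<Rightarrow> real"
  where "gegenbauer_coeff n h =
    (THE l. h = (\<Sum>j\<le>degree h. smult (l j) (normalized_gegenbauer n j)) \<and>
      (\<forall>j>degree h. l j = 0))"

definition frobenius_threshold :: "'n::finite itself \<Rightarrow> nat \<Rightarrow> real poly \<Rightarrow> ereal"
  where "frobenius_threshold n k h =
    (if \<exists>j\<le>k. gegenbauer_coeff n h (2 * j) = 0 then \<infinity>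
     else ereal (sqrt (\<Sum>j\<le>k.
       real (dim (harmonic_forms (2 * j) :: (real ^ 'n \<Rightarrow> real) set)) *
         (1 / gegenbauer_coeff n h (2 * j) - 1)\<^sup>2)))"


section \<open>Polyhedral cones\<close>

text \<open>Intersections of finitely many linear half-spaces of the subspace \<open>V\<close>. Functionals are taken
  on the ambient space, from which every functional on \<open>V\<close> is a restriction.\<close>

definition polyhedral_cone_in :: "'v::real_vector set \<Rightarrow> 'v set \<Rightarrow> bool"
  where "polyhedral_cone_in V A \<longleftrightarrow>
    (\<exists>L :: ('v \<Rightarrow> real) set. finite L \<and> (\<forall>l\<in>L. linear l) \<and> A = {v \<in> V. \<forall>l\<in>L. 0 \<le> l v})"

end

theory Submission
  imports Defs
begin

text \<open>Rotation invariance of the area measure, differentiated at the identity, gives the integration by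
  parts formula \<open>\<integral> D\<^sub>v f = (d + n - 1) \<integral> \<langle>v, x\<rangle> f\<close> for forms \<open>f\<close> of degree \<open>d\<close>. By induction on the degree,
  harmonic forms are orthogonal to all forms of lower degree, and integration against \<open>\<langle>x, y\<rangle>\<^sup>j\<close> acts on
  \<open>H\<^sub>j\<close> as a scalar. The Gegenbauer recurrence makes the zonal functions harmonic, so the kernel
  \<open>g\<^sub>j(\<langle>x, y\<rangle>)\<close> is the reproducing kernel of \<open>H\<^sub>j\<close>, and the averaging operator multiplies the component
  of degree \<open>2i\<close> of a form by \<open>\<lambda>\<^sub>2\<^sub>i\<close>. Cubature exactness turns the operator into a sum over the nodes with
  nonnegative weights. Evaluation at a point has squared norm \<open>dim H\<^sub>j / \<mu>(S)\<close> on \<open>H\<^sub>j\<close>, so by Cauchy-Schwarz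
  the preimage of \<open>f\<close> differs from \<open>f\<close> on the sphere by at most \<open>\<tau> / sqrt (\<mu>(S))\<close> times the \<open>L\<^sup>2\<close> norm
  of \<open>f\<close>.\<close>

section \<open>Orthogonal invariance of Lebesgue measure\<close>

text \<open>The area measure is given through volumes of cones, so the analysis rests on the
  invariance of Lebesgue measure under rotations instead of surface calculus. Integration by parts
  trades a coordinate factor for a derivative; a derivative lowers the degree and keeps harmonic
  forms harmonic, which is what lets the inductions on the degree close. They yield the eigenvalues
  only as unnamed scalars; the trace over an orthonormal basis fixes them afterwards and shows on
  the way that no \<open>harmonic_forms j\<close> is zero.

  The operator divides by powers of the norm, so it is not visible from its definition that its
  values are forms; this comes out of the eigenvector expansion. It sees only the even part of h,
  which is nonnegative on [-1,1] along with h. Polyhedrality is claimed even where an eigenvalue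
  vanishes, so images of cones have to be taken under maps with a kernel.\<close>

text \<open>The library has \<open>measure_orthogonal_image\<close> only for index types in class \<open>wellorder\<close>. A copy of
  the index type with a chosen well-order transfers it to all finite index types.\<close>

typedef 'a well_ordered = "UNIV :: 'a set"
  by simp

instance well_ordered :: (finite) finite
proof
  have "(UNIV :: 'a::finite well_ordered set) = range Abs_well_ordered"
    by (metis Abs_well_ordered_cases surjI UNIV_eq_I rangeI)
  then show "finite (UNIV :: 'a::finite well_ordered set)"
    by (metis finite_imageI finite_class.finite_UNIV)
qed

definition well_ordered_index :: "'a::finite well_ordered \<Rightarrow> nat"
  where "well_ordered_index = (SOME f. inj f)"

lemma inj_well_ordered_index: "inj (well_ordered_index :: 'a::finite well_ordered \<Rightarrow> nat)"
proof -
  obtain f :: "'a well_ordered \<Rightarrow> nat" where "inj f"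
    using finite_imp_inj_to_nat_seg[OF finite_class.finite_UNIV] by metis
  then show ?thesis
    unfolding well_ordered_index_def by (rule someI[of "\<lambda>f. inj f"])
qed

instantiation well_ordered :: (finite) wellorder
begin

definition less_eq_well_ordered :: "'a well_ordered \<Rightarrow> 'a well_ordered \<Rightarrow> bool"
  where "x \<le> y \<longleftrightarrow> well_ordered_index x \<le> well_ordered_index y"

definition less_well_ordered :: "'a well_ordered \<Rightarrow> 'a well_ordered \<Rightarrow> bool"
  where "x < y \<longleftrightarrow> well_ordered_index x < well_ordered_index y"

instance
proof
  fix P and a :: "'a::finite well_ordered"
  assume step: "\<And>x :: 'a::finite well_ordered. (\<And>y. y < x \<Longrightarrow> P y) \<Longrightarrow> P x"
  show "P a"
    by (induction "well_ordered_index a" arbitrary: a rule: less_induct)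
       (rule step, simp add: less_well_ordered_def)
next
  fix x y :: "'a::finite well_ordered"
  assume "x \<le> y" "y \<le> x"
  then show "x = y"
    by (intro injD[OF inj_well_ordered_index]) (simp add: less_eq_well_ordered_def)
qed (auto simp: less_eq_well_ordered_def less_well_ordered_def)

end

lemma bij_Rep_well_ordered: "bij Rep_well_ordered"
  by (rule bijI') (auto simp: Rep_well_ordered_inject intro: Abs_well_ordered_inverse[symmetric])

definition reindex_wo :: "real ^ 'n::finite \<Rightarrow> real ^ 'n well_ordered"
  where "reindex_wo x = (\<chi> j. x $ Rep_well_ordered j)"

definition unindex_wo :: "real ^ 'n::finite well_ordered \<Rightarrow> real ^ 'n"
  where "unindex_wo x = (\<chi> i. x $ Abs_well_ordered i)"

lemma unindex_reindex [simp]: "unindex_wo (reindex_wo x) = x"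
  and reindex_unindex [simp]: "reindex_wo (unindex_wo y) = y"
  by (simp_all add: vec_eq_iff unindex_wo_def reindex_wo_def Abs_well_ordered_inverse
      Rep_well_ordered_inverse)

lemma linear_reindex: "linear reindex_wo" and linear_unindex: "linear unindex_wo"
  by (auto intro!: linearI simp: vec_eq_iff reindex_wo_def unindex_wo_def)

lemma norm_reindex [simp]: "norm (reindex_wo x) = norm x"
  using sum.reindex_bij_betw[OF bij_Rep_well_ordered, of "\<lambda>i. (x $ i)\<^sup>2"]
  by (simp add: norm_vec_def L2_set_def reindex_wo_def)

lemma norm_unindex [simp]: "norm (unindex_wo y) = norm y"
  by (metis norm_reindex reindex_unindex)

lemma borel_reindex: "reindex_wo \<in> borel_measurable borel"
  and borel_unindex: "unindex_wo \<in> borel_measurable borel"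
  using linear_reindex linear_unindex
  by (auto intro!: borel_measurable_continuous_onI linear_continuous_on simp: linear_linear)

lemma prod_Basis_cart: "(\<Prod>b\<in>Basis. (x :: real ^ 'n::finite) \<bullet> b) = (\<Prod>i\<in>UNIV. x $ i)"
proof -
  have "(Basis :: (real ^ 'n) set) = range (\<lambda>i. axis i 1)"
    by (auto simp: Basis_vec_def)
  moreover have "inj (\<lambda>i. axis i (1::real) :: real ^ 'n)"
    by (auto simp: inj_on_def axis_eq_axis)
  ultimately show ?thesis
    using prod.reindex[of "\<lambda>i. axis i (1::real)" UNIV "\<lambda>b. x \<bullet> b"] by (simp add: inner_axis)
qed

text \<open>Lebesgue measure is determined by its values on boxes, and relabelling coordinates turns
  a box into a box with the same side lengths in another order.\<close>

lemma lborel_reindex: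
  "(lborel :: (real ^ 'n::finite well_ordered) measure) = distr lborel borel reindex_wo"
proof (rule lborel_eqI)
  fix l u :: "real ^ 'n well_ordered"
  assume le: "\<And>b. b \<in> Basis \<Longrightarrow> l \<bullet> b \<le> u \<bullet> b"
  then have le': "l $ j \<le> u $ j" for j
    using le[of "axis j 1"] by (simp add: inner_axis axis_in_Basis_iff)
  have "reindex_wo -` box l u = box (unindex_wo l) (unindex_wo u)"
    by (auto simp: mem_box_cart reindex_wo_def unindex_wo_def)
       (metis Abs_well_ordered_inverse Rep_well_ordered_inverse UNIV_I)+
  then have "emeasure (distr lborel borel reindex_wo) (box l u) =
      emeasure lborel (box (unindex_wo l) (unindex_wo u))"
    using borel_reindex by (subst emeasure_distr) auto
  also have "\<dots> = (\<Prod>b\<in>Basis. (unindex_wo u - unindex_wo l) \<bullet> b)"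
  proof (rule emeasure_lborel_box)
    fix b :: "real ^ 'n" assume "b \<in> Basis"
    then show "unindex_wo l \<bullet> b \<le> unindex_wo u \<bullet> b"
      using le' by (auto simp: Basis_vec_def inner_axis unindex_wo_def)
  qed
  also have "(\<Prod>b\<in>Basis. (unindex_wo u - unindex_wo l) \<bullet> b) = (\<Prod>b\<in>Basis. (u - l) \<bullet> b)"
    unfolding prod_Basis_cart
    using prod.reindex_bij_betw[OF bij_Rep_well_ordered, of "\<lambda>i. (unindex_wo u - unindex_wo l) $ i"]
    by (simp add: unindex_wo_def Rep_well_ordered_inverse)
  finally show "emeasure (distr lborel borel reindex_wo) (box l u) = (\<Prod>b\<in>Basis. (u - l) \<bullet> b)" .
qed simp

lemma emeasure_lborel_orthogonal_image:
  fixes T :: "real ^ 'n::finite \<Rightarrow> real ^ 'n"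
  assumes T: "orthogonal_transformation T" and S: "S \<in> sets borel" "S \<in> lmeasurable"
    and TS: "T ` S \<in> sets borel"
  shows "emeasure lborel (T ` S) = emeasure lborel S"
proof -
  have reindex: "reindex_wo ` A \<in> sets borel \<and> emeasure lborel (reindex_wo ` A) = emeasure lborel A"
    if "A \<in> sets borel" for A :: "(real ^ 'n) set"
  proof -
    have "reindex_wo ` A = unindex_wo -` A \<inter> space borel"
      by (auto intro!: image_eqI[of _ reindex_wo "unindex_wo _"])
    then have "reindex_wo ` A \<in> sets borel"
      using measurable_sets[OF borel_unindex that] by simp
    moreover have "reindex_wo -` reindex_wo ` A = A"
      by (auto dest: arg_cong[of _ _ unindex_wo])
    ultimately show ?thesis
      by (subst lborel_reindex) (simp add: emeasure_distr borel_reindex)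
  qed
  \<comment> \<open>Conjugation by the relabelling carries T to an orthogonal map over the
    well-ordered index type, where \<open>measure_orthogonal_image\<close> applies. Finiteness of
    the volume lets \<open>emeasure\<close> be recovered from \<open>measure\<close>.\<close>
  let ?T = "\<lambda>y. reindex_wo (T (unindex_wo y))"
  have T': "orthogonal_transformation ?T"
    unfolding orthogonal_transformation
    using linear_compose[OF linear_unindex linear_compose[OF orthogonal_transformation_linear[OF T] linear_reindex]]
    by (simp add: o_def orthogonal_transformation_norm[OF T])
  have eq: "?T ` reindex_wo ` S = reindex_wo ` T ` S"
    by (simp add: image_image)
  have fin: "emeasure lborel S < \<infinity>"
    using S by (simp add: fmeasurable_def)
  have lm: "reindex_wo ` S \<in> lmeasurable"
    using reindex[OF S(1)] fin by (simp add: fmeasurable_def)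
  have "emeasure lborel (T ` S) = emeasure lebesgue (?T ` reindex_wo ` S)"
    using reindex[OF TS] by (simp add: eq)
  also have "\<dots> = emeasure lebesgue (reindex_wo ` S)"
    using measure_orthogonal_image[OF T' lm] measurable_orthogonal_image[OF T' lm] lm
    by (simp add: emeasure_eq_measure2)
  also have "\<dots> = emeasure lborel S"
    using reindex[OF S(1)] by simp
  finally show ?thesis .
qed

section \<open>Calculus of forms\<close>

lemma sum_fun_apply: "sum F I x = (\<Sum>i\<in>I. F i x)"
  for F :: "'a \<Rightarrow> 'b \<Rightarrow> 'c::comm_monoid_add"
  by (induction I rule: infinite_finite_induct) auto

lemmas fun_apply = plus_fun_apply minus_apply zero_fun_apply times_fun_apply scaleR_fun_apply
  sum_fun_apply

text \<open>As simplification rules, these eta-expand sums and multiples of functions, after which the rules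
  about \<open>forms\<close> no longer apply.\<close>

declare plus_fun_apply [simp del] minus_apply [simp del] zero_fun_apply [simp del]
  times_fun_apply [simp del] scaleR_fun_apply [simp del]

text \<open>With the direction first, \<open>dir_deriv v\<close> is an operator on functions, and
  the direction may also depend on the point, as in Euler's identity \<open>dir_deriv x f x\<close>.
  The one-dimensional \<open>deriv\<close> matches the definition of
  \<open>laplacian\<close>.\<close>

definition dir_deriv :: "real ^ 'n::finite \<Rightarrow> (real ^ 'n \<Rightarrow> real) \<Rightarrow> real ^ 'n \<Rightarrow> real"
  where "dir_deriv v f x = deriv (\<lambda>t. f (x + t *\<^sub>R v)) 0"

lemma dir_deriv_eq:
  assumes "(f has_derivative f') (at x)"
  shows "dir_deriv v f x = f' v"
proof -
  have "((\<lambda>t. f (x + t *\<^sub>R v)) has_derivative (\<lambda>t. f' (t *\<^sub>R v))) (at 0)"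
    by (rule has_derivative_compose[of "\<lambda>t. x + t *\<^sub>R v" _ "0::real" UNIV f f', simplified])
       (auto intro!: derivative_eq_intros assms)
  moreover have "f' (t *\<^sub>R v) = f' v * t" for t
    using has_derivative_linear[OF assms] by (simp add: linear_scale)
  ultimately show ?thesis
    by (auto simp: dir_deriv_def has_field_derivative_def intro!: DERIV_imp_deriv)
qed

lemma has_derivative_dir_deriv:
  assumes "f differentiable (at x)"
  shows "(f has_derivative (\<lambda>v. dir_deriv v f x)) (at x)"
proof -
  obtain f' where f': "(f has_derivative f') (at x)"
    using assms by (auto simp: differentiable_def)
  then have "f' = (\<lambda>v. dir_deriv v f x)"
    by (auto simp: dir_deriv_eq)
  with f' show ?thesis by simp
qed

lemma forms_0: "0 \<in> forms d"
  and forms_add: "f \<in> forms d \<Longrightarrow> g \<in> forms d \<Longrightarrow> f + g \<in> forms d"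
  and forms_diff: "f \<in> forms d \<Longrightarrow> g \<in> forms d \<Longrightarrow> f - g \<in> forms d"
  and forms_scale: "f \<in> forms d \<Longrightarrow> c *\<^sub>R f \<in> forms d"
  and forms_sum: "(\<And>i. i \<in> I \<Longrightarrow> F i \<in> forms d) \<Longrightarrow> sum F I \<in> forms d"
  and subspace_forms: "subspace (forms d)"
  by (auto simp: forms_def span_zero span_add span_diff span_scale span_sum)

lemma monomial_fun_upd:
  "(\<lambda>x. x $ i * monomial_fun a x) = monomial_fun (a(i := Suc (a i)))"
  by (auto simp: fun_eq_iff monomial_fun_def prod.remove[of UNIV i])

lemma sum_upd_Suc:
  fixes a :: "'n::finite \<Rightarrow> nat"
  shows "(\<Sum>j\<in>UNIV. (a(i := Suc (a i))) j) = Suc (\<Sum>j\<in>UNIV. a j)"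
  by (simp add: sum.remove[of UNIV i])

lemma forms_coord:
  assumes "f \<in> forms d"
  shows "(\<lambda>x. x $ i * f x) \<in> forms (Suc d)"
  using assms unfolding forms_def
proof (induction rule: span_induct_alt)
  case base
  have "(\<lambda>x. x $ i * (0 :: real ^ 'a \<Rightarrow> real) x) = 0"
    by (auto simp: fun_apply)
  then show ?case by (simp only: span_zero)
next
  case (step c m f)
  then obtain a where a: "m = monomial_fun a" "(\<Sum>j\<in>UNIV. a j) = d" by auto
  have *: "(\<lambda>x. x $ i * m x) \<in> span {monomial_fun a |a. (\<Sum>j\<in>UNIV. a j) = Suc d}"
    unfolding a monomial_fun_upd
    by (rule span_base) (use a sum_upd_Suc[of a i] in blast)
  have "(\<lambda>x. x $ i * (c *\<^sub>R m + f) x) = c *\<^sub>R (\<lambda>x. x $ i * m x) + (\<lambda>x. x $ i * f x)"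
    by (auto simp: fun_apply algebra_simps)
  then show ?case
    using span_add[OF span_scale[OF *, of c] step(2)] by simp
qed

lemma forms_const: "(\<lambda>x. c) \<in> forms 0"
proof -
  have "(\<lambda>x. c) = c *\<^sub>R monomial_fun (\<lambda>i. 0)"
    by (auto simp: monomial_fun_def fun_apply)
  then show ?thesis
    by (metis (mono_tags, lifting) forms_def forms_scale mem_Collect_eq span_base sum.neutral)
qed

text \<open>A monomial of positive degree splits off a coordinate, so constants, multiplication by a
  coordinate and linear combinations generate all forms. Rules that are linear in f thus reduce to
  the product rule for one coordinate. The zero function has its own case because it belongs to
  every degree.\<close>

lemma forms_induct [consumes 1, case_names zero const coord lin]:
  fixes P :: "nat \<Rightarrow> (real ^ 'n::finite \<Rightarrow> real) \<Rightarrow> bool"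
  assumes f: "f \<in> forms d"
    and zero: "\<And>d. P d 0"
    and const: "\<And>c. P 0 (\<lambda>x. c)"
    and coord: "\<And>d i f. f \<in> forms d \<Longrightarrow> P d f \<Longrightarrow> P (Suc d) (\<lambda>x. x $ i * f x)"
    and lin: "\<And>d c f g. f \<in> forms d \<Longrightarrow> g \<in> forms d \<Longrightarrow> P d f \<Longrightarrow> P d g \<Longrightarrow> P d (c *\<^sub>R f + g)"
  shows "P d f"
proof -
  have mono: "P d (monomial_fun a)" if "(\<Sum>j\<in>UNIV. a j) = d" for a :: "'n \<Rightarrow> nat" and d
    using that
  proof (induction d arbitrary: a)
    case 0
    then have "a = (\<lambda>i. 0)" by auto
    then have "monomial_fun a = (\<lambda>x. 1)"
      by (simp add: monomial_fun_def)
    then show ?case using const[of 1] by simp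
  next
    case (Suc d)
    then obtain i where i: "a i \<noteq> 0"
      by (metis sum.neutral Zero_not_Suc)
    define b where "b = a(i := a i - 1)"
    have ab: "a = b(i := Suc (b i))"
      using i by (auto simp: b_def)
    have b: "(\<Sum>j\<in>UNIV. b j) = d"
      using Suc.prems sum_upd_Suc[of b i] ab by simp
    then have "monomial_fun b \<in> forms d"
      unfolding forms_def by (auto intro!: span_base)
    then show ?case
      using coord[OF _ Suc.IH[OF b], of i] monomial_fun_upd[of i b] ab by metis
  qed
  have "f \<in> forms d \<and> P d f"
    using f unfolding forms_def
  proof (induction rule: span_induct_alt)
    case base
    show ?case by (intro conjI zero span_zero)
  next
    case (step c m f)
    then obtain a where a: "m = monomial_fun a" "(\<Sum>j\<in>UNIV. a j) = d" by auto
    then have "m \<in> forms d" "P d m"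
      using mono[of a d] by (auto simp: forms_def intro!: span_base)
    then show ?case
      using step lin[of m d f c] forms_add[OF forms_scale] by (auto simp: forms_def)
  qed
  then show ?thesis by simp
qed

lemma forms_mult:
  assumes "f \<in> forms a" "g \<in> forms b"
  shows "f * g \<in> forms (a + b)"
  using assms(1)
proof (induction rule: forms_induct)
  case (zero d)
  have "0 * g = 0" by (auto simp: fun_apply)
  then show ?case by (simp only: forms_0)
next
  case (const c)
  have "(\<lambda>x. c) * g = c *\<^sub>R g" by (auto simp: fun_apply)
  then show ?case using forms_scale[OF assms(2), of c] by (simp only: add_0)
next
  case (coord d i f)
  have "(\<lambda>x. x $ i * f x) * g = (\<lambda>x. x $ i * (f * g) x)"
    by (auto simp: fun_apply mult.assoc)
  then show ?case using forms_coord[OF coord(2), of i] by simp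
next
  case (lin d c f g')
  have "(c *\<^sub>R f + g') * g = c *\<^sub>R (f * g) + g' * g"
    by (auto simp: fun_apply algebra_simps)
  then show ?case using lin by (simp add: forms_add forms_scale)
qed

lemma forms_inner: "(\<lambda>x. x \<bullet> y) \<in> forms 1"
proof -
  have "(\<lambda>x. x \<bullet> y) = (\<Sum>i\<in>UNIV. (y $ i) *\<^sub>R (\<lambda>x. x $ i * (1::real)))"
    by (auto simp: inner_vec_def fun_eq_iff fun_apply algebra_simps)
  then show ?thesis
    using forms_sum[OF forms_scale[OF forms_coord[OF forms_const[of 1]]]] by simp
qed

lemma forms_power: "f \<in> forms a \<Longrightarrow> (\<lambda>x. f x ^ m) \<in> forms (m * a)"
proof (induction m)
  case 0
  then show ?case by (simp add: forms_const)
next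
  case (Suc m)
  have "(\<lambda>x. f x ^ Suc m) = f * (\<lambda>x. f x ^ m)"
    by (auto simp: fun_apply)
  then show ?case using forms_mult[OF Suc.prems Suc.IH] Suc.prems by simp
qed

lemma forms_inner_power: "(\<lambda>y. (x \<bullet> y) ^ m) \<in> forms m"
  using forms_power[OF forms_inner, of x m] by (simp add: inner_commute)

lemma forms_norm2: "(\<lambda>x. (norm x)\<^sup>2) \<in> forms 2"
proof -
  have "(\<lambda>x::real^'n. (norm x)\<^sup>2) = (\<Sum>i\<in>UNIV. (\<lambda>x. x $ i * (x $ i * 1)))"
    by (auto simp: power2_norm_eq_inner inner_vec_def fun_eq_iff fun_apply)
  also have "\<dots> \<in> forms (Suc (Suc 0))"
    by (intro forms_sum forms_coord forms_const)
  finally show ?thesis by (simp only: numeral_2_eq_2)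
qed

lemma forms_norm_power: "(\<lambda>x. norm x ^ (2 * m)) \<in> forms (2 * m)"
  using forms_power[OF forms_norm2, of m] by (simp only: mult.commute[of m] power_mult)

lemma forms_homogeneous: "f \<in> forms d \<Longrightarrow> f (c *\<^sub>R x) = c ^ d * f x"
  by (induction rule: forms_induct) (auto simp: fun_apply algebra_simps)

lemma forms_differentiable: "f \<in> forms d \<Longrightarrow> f differentiable (at x)"
proof (induction rule: forms_induct)
  case (zero d)
  then show ?case by (simp add: zero_fun_def)
next
  case (lin d c f g)
  then have "(\<lambda>x. c * f x + g x) differentiable at x"
    by (intro derivative_intros) auto
  then show ?case by (simp add: plus_fun_def fun_apply)
next
  case (coord d i f)
  have "(\<lambda>x::real^'a. x $ i) differentiable at x"
    by (intro linear_imp_differentiable bounded_linear.linear bounded_linear_vec_nth)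
  with coord show ?case
    by (intro derivative_intros) auto
qed auto

lemma forms_has_derivative:
  "f \<in> forms d \<Longrightarrow> (f has_derivative (\<lambda>v. dir_deriv v f x)) (at x)"
  by (intro has_derivative_dir_deriv forms_differentiable)

lemma forms_continuous: "f \<in> forms d \<Longrightarrow> continuous_on S f"
  using forms_differentiable differentiable_imp_continuous_within
  by (metis continuous_at_imp_continuous_on)

lemma linear_dir_deriv: "f \<in> forms d \<Longrightarrow> linear (\<lambda>v. dir_deriv v f x)"
  by (rule has_derivative_linear[OF forms_has_derivative])

lemma dir_deriv_const: "dir_deriv v (\<lambda>x. c) = 0"
  by (auto simp: dir_deriv_def fun_apply)

lemma dir_deriv_0: "dir_deriv v 0 = 0"
  by (auto simp: dir_deriv_def fun_apply)

lemma dir_deriv_mult: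
  assumes "f \<in> forms a" "g \<in> forms b"
  shows "dir_deriv v (f * g) = f * dir_deriv v g + dir_deriv v f * g"
proof
  fix x
  have "(f * g has_derivative (\<lambda>v. f x * dir_deriv v g x + dir_deriv v f x * g x)) (at x)"
    unfolding times_fun_def
    by (rule has_derivative_mult[OF forms_has_derivative[OF assms(1)] forms_has_derivative[OF assms(2)]])
  then show "dir_deriv v (f * g) x = (f * dir_deriv v g + dir_deriv v f * g) x"
    by (simp add: dir_deriv_eq fun_apply)
qed

lemma dir_deriv_lin:
  assumes "f \<in> forms a" "g \<in> forms b"
  shows "dir_deriv v (c *\<^sub>R f + g) = c *\<^sub>R dir_deriv v f + dir_deriv v g"
proof
  fix x
  have "((\<lambda>x. c *\<^sub>R f x + g x) has_derivative (\<lambda>v. c *\<^sub>R dir_deriv v f x + dir_deriv v g x)) (at x)"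
    by (intro derivative_intros has_derivative_add has_derivative_scaleR_right
       forms_has_derivative[OF assms(1)] forms_has_derivative[OF assms(2)])
  then show "dir_deriv v (c *\<^sub>R f + g) x = (c *\<^sub>R dir_deriv v f + dir_deriv v g) x"
    using dir_deriv_eq[of "c *\<^sub>R f + g"] by (simp add: plus_fun_def scaleR_fun_def)
qed

lemma dir_deriv_add:
  "f \<in> forms a \<Longrightarrow> g \<in> forms b \<Longrightarrow> dir_deriv v (f + g) = dir_deriv v f + dir_deriv v g"
  using dir_deriv_lin[of f a g b v 1] by simp

lemma dir_deriv_scale: "f \<in> forms a \<Longrightarrow> dir_deriv v (c *\<^sub>R f) = c *\<^sub>R dir_deriv v f"
  using dir_deriv_lin[OF _ forms_0, of f a v c] by (simp add: dir_deriv_0)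

lemma dir_deriv_sum:
  "(\<And>i. i \<in> I \<Longrightarrow> F i \<in> forms d) \<Longrightarrow> dir_deriv v (sum F I) = (\<Sum>i\<in>I. dir_deriv v (F i))"
  by (induction I rule: infinite_finite_induct)
     (auto simp: dir_deriv_0 dir_deriv_add[of _ d _ d] forms_sum)

lemma dir_deriv_coord_fun: "dir_deriv v (\<lambda>x. x $ i) = (\<lambda>x. v $ i)"
  by (rule ext, rule dir_deriv_eq)
     (intro bounded_linear.has_derivative[OF bounded_linear_vec_nth] has_derivative_ident)

lemma dir_deriv_coord:
  assumes "f \<in> forms d"
  shows "dir_deriv v (\<lambda>x. x $ i * f x) = (\<lambda>x. x $ i * dir_deriv v f x) + (v $ i) *\<^sub>R f"
proof -
  have c: "(\<lambda>x. x $ i) \<in> forms (Suc 0)"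
    using forms_coord[OF forms_const[of 1]] by simp
  have "(\<lambda>x. x $ i * f x) = (\<lambda>x. x $ i) * f" by (auto simp: fun_apply)
  then show ?thesis
    using dir_deriv_mult[OF c assms, of v] by (auto simp: dir_deriv_coord_fun fun_apply)
qed

lemma dir_deriv_forms_0: "f \<in> forms 0 \<Longrightarrow> dir_deriv v f = 0"
proof (induction "0::nat" f rule: forms_induct)
qed (auto simp: dir_deriv_0 dir_deriv_const dir_deriv_lin[of _ 0 _ 0])

lemma forms_0_const: "f \<in> forms 0 \<Longrightarrow> f x = f 0"
  using forms_homogeneous[of f 0 0 x] by simp

lemma dir_deriv_forms: "f \<in> forms d \<Longrightarrow> dir_deriv v f \<in> forms (d - Suc 0)"
proof (induction rule: forms_induct)
  case (coord d i f)
  show ?case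
  proof (cases d)
    \<comment> \<open>Here d - 1 is truncated to 0, and multiplication by a coordinate would give
      degree 1 instead of 0; the derivative of the constant f is 0, so that term drops out.\<close>
    case 0
    have "(\<lambda>x::real^'a. x $ i * (0 :: _ \<Rightarrow> real) x) = 0"
      by (auto simp: fun_apply)
    then show ?thesis
      using coord 0 by (simp add: dir_deriv_coord dir_deriv_forms_0 forms_scale)
  next
    case (Suc e)
    then show ?thesis
      using coord forms_coord[OF coord(2), of i] by (simp add: dir_deriv_coord forms_add forms_scale)
  qed
qed (auto simp: dir_deriv_0 dir_deriv_const forms_0 dir_deriv_lin forms_add forms_scale)

text \<open>Symmetry of second derivatives is checked on the generators of the forms, where it is
  the product rule applied twice.\<close>

lemma dir_deriv_commute:
  "f \<in> forms d \<Longrightarrow> dir_deriv v (dir_deriv w f) = dir_deriv w (dir_deriv v f)"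
proof (induction rule: forms_induct)
  case (coord d i f)
  have D: "\<And>v. dir_deriv v f \<in> forms (d - Suc 0)"
    using coord by (simp add: dir_deriv_forms)
  show ?case
    using coord(2)
    by (auto simp: dir_deriv_coord[OF coord(1)] dir_deriv_coord[OF D]
         dir_deriv_scale[OF coord(1)] dir_deriv_add[OF forms_coord[OF D] forms_scale[OF coord(1)]])
next
  case (lin d c f g)
  then show ?case
    by (simp add: dir_deriv_lin[OF lin(1,2)] dir_deriv_lin[OF lin(1,2)[THEN dir_deriv_forms]])
qed (auto simp: dir_deriv_0 dir_deriv_const)

lemma euler_forms: "f \<in> forms d \<Longrightarrow> dir_deriv x f x = d * f x"
proof (induction rule: forms_induct)
  case (lin d c f g)
  then show ?case
    by (simp add: dir_deriv_lin[OF lin(1,2)]) (simp add: fun_apply algebra_simps)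
next
  case (coord d i f)
  then show ?case
    by (simp add: dir_deriv_coord) (simp add: fun_apply algebra_simps)
qed (auto simp: dir_deriv_0 dir_deriv_const fun_apply)

lemma dir_deriv_basis_sum:
  assumes "f \<in> forms d"
  shows "(\<Sum>i\<in>UNIV. v $ i * dir_deriv (axis i 1) f x) = dir_deriv v f x"
proof -
  have "dir_deriv v f x = dir_deriv (\<Sum>i\<in>UNIV. (v $ i) *\<^sub>R axis i 1) f x"
    using basis_expansion[of v] by (simp add: scalar_mult_eq_scaleR)
  also have "\<dots> = (\<Sum>i\<in>UNIV. v $ i * dir_deriv (axis i 1) f x)"
    by (simp add: linear_sum[OF linear_dir_deriv[OF assms]] linear_scale[OF linear_dir_deriv[OF assms]])
  finally show ?thesis by simp
qed

section \<open>The Laplacian and harmonic forms\<close>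

lemma laplacian_eq: "laplacian f = (\<Sum>i\<in>UNIV. dir_deriv (axis i 1) (dir_deriv (axis i 1) f))"
proof
  fix x
  \<comment> \<open>The derivative at s along a line through x is the derivative at 0 along the line
    through the shifted point, so iterating \<open>deriv\<close> amounts to iterating
    \<open>dir_deriv\<close>.\<close>
  have "deriv (\<lambda>t. f (x + t *\<^sub>R v)) = (\<lambda>s. dir_deriv v f (x + s *\<^sub>R v))" for v
    by (rule ext, subst deriv_shift_0) (simp add: dir_deriv_def o_def scaleR_add_left add.assoc)
  then have "(deriv ^^ 2) (\<lambda>t. f (x + t *\<^sub>R v)) 0 = dir_deriv v (dir_deriv v f) x" for v
    by (simp add: dir_deriv_def[of v "dir_deriv v f"] numeral_2_eq_2)
  then show "laplacian f x = (\<Sum>i\<in>UNIV. dir_deriv (axis i 1) (dir_deriv (axis i 1) f)) x"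
    by (simp add: laplacian_def fun_apply)
qed

lemma laplacian_forms: "f \<in> forms d \<Longrightarrow> laplacian f \<in> forms (d - 2)"
  unfolding laplacian_eq
  using dir_deriv_forms[OF dir_deriv_forms] by (intro forms_sum) (simp add: numeral_2_eq_2)

lemma laplacian_lin:
  assumes "f \<in> forms a" "g \<in> forms b"
  shows "laplacian (c *\<^sub>R f + g) = c *\<^sub>R laplacian f + laplacian g"
  by (simp add: laplacian_eq dir_deriv_lin[OF assms] dir_deriv_lin[OF assms[THEN dir_deriv_forms]]
       sum.distrib scaleR_sum_right)

lemma laplacian_dir_deriv:
  assumes "f \<in> forms d"
  shows "laplacian (dir_deriv v f) = dir_deriv v (laplacian f)"
proof -
  have D: "dir_deriv w f \<in> forms (d - Suc 0)" for w
    using assms by (rule dir_deriv_forms)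
  show ?thesis
    by (simp add: laplacian_eq dir_deriv_sum[OF D[THEN dir_deriv_forms]]
        dir_deriv_commute[OF D, of v] dir_deriv_commute[OF assms, of v])
qed

lemma laplacian_mult:
  assumes "f \<in> forms a" "g \<in> forms b"
  shows "laplacian (f * g) = f * laplacian g +
    2 *\<^sub>R (\<Sum>i\<in>UNIV. dir_deriv (axis i 1) f * dir_deriv (axis i 1) g) + laplacian f * g"
proof -
  note D = assms[THEN dir_deriv_forms]
  have "dir_deriv v (dir_deriv v (f * g)) =
    f * dir_deriv v (dir_deriv v g) + 2 *\<^sub>R (dir_deriv v f * dir_deriv v g) +
    dir_deriv v (dir_deriv v f) * g" for v
    by (simp add: dir_deriv_mult[OF assms] dir_deriv_mult[OF assms(1) D(2)]
      dir_deriv_mult[OF D(1) assms(2)] scaleR_2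
      dir_deriv_add[OF forms_mult[OF assms(1) D(2)] forms_mult[OF D(1) assms(2)]])
  then show ?thesis
    by (simp add: laplacian_eq sum.distrib sum_distrib_left sum_distrib_right scaleR_sum_right
)
qed

lemma dir_deriv_inner: "dir_deriv v (\<lambda>x. x \<bullet> y) = (\<lambda>x. v \<bullet> y)"
  by (rule ext, rule dir_deriv_eq) (auto intro!: derivative_eq_intros)

lemma dir_deriv_norm2: "dir_deriv v (\<lambda>x. (norm x)\<^sup>2) = 2 *\<^sub>R (\<lambda>x. x \<bullet> v)"
  by (rule ext, rule dir_deriv_eq)
     (auto intro!: derivative_eq_intros simp: power2_norm_eq_inner inner_commute fun_apply)

lemma laplacian_inner_mult:
  assumes "f \<in> forms d"
  shows "laplacian ((\<lambda>x. x \<bullet> y) * f) = (\<lambda>x. x \<bullet> y) * laplacian f + 2 *\<^sub>R dir_deriv y f"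
proof -
  have "laplacian (\<lambda>x. x \<bullet> y) = 0"
    by (simp add: laplacian_eq dir_deriv_inner dir_deriv_const)
  moreover have "(\<Sum>i\<in>UNIV. dir_deriv (axis i 1) (\<lambda>x. x \<bullet> y) * dir_deriv (axis i 1) f) = dir_deriv y f"
    using dir_deriv_basis_sum[OF assms, of y]
    by (auto simp: fun_eq_iff fun_apply dir_deriv_inner inner_axis')
  ultimately show ?thesis
    by (simp add: laplacian_mult[OF forms_inner assms])
qed

text \<open>\<open>2 * CARD('n)\<close> is the Laplacian of the squared norm. Its gradient is 2x, so
  the mixed term of the product rule is 4 times the radial derivative of f, which is d f by Euler's
  identity.\<close>

lemma laplacian_norm2_mult:
  fixes f :: "real ^ 'n::finite \<Rightarrow> real"
  assumes "f \<in> forms d"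
  shows "laplacian ((\<lambda>x. (norm x)\<^sup>2) * f) =
    (\<lambda>x. (norm x)\<^sup>2) * laplacian f + (2 * CARD('n) + 4 * d) *\<^sub>R f"
proof -
  have "laplacian (\<lambda>x::real^'n. (norm x)\<^sup>2) = (\<lambda>x. real (2 * CARD('n)))"
    by (auto simp: fun_eq_iff laplacian_eq fun_apply dir_deriv_norm2 dir_deriv_scale[OF forms_inner]
       dir_deriv_inner inner_axis_axis)
  moreover have "(\<Sum>i\<in>UNIV. dir_deriv (axis i 1) (\<lambda>x. (norm x)\<^sup>2) * dir_deriv (axis i 1) f)
      = (2 * d) *\<^sub>R f"
  proof
    fix x
    have "(\<Sum>i\<in>UNIV. dir_deriv (axis i 1) (\<lambda>x. (norm x)\<^sup>2) * dir_deriv (axis i 1) f) x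
      = 2 * (\<Sum>i\<in>UNIV. x $ i * dir_deriv (axis i 1) f x)"
      by (simp add: fun_apply dir_deriv_norm2 inner_axis sum_distrib_left mult.assoc)
    also have "\<dots> = ((2 * d) *\<^sub>R f) x"
      by (simp add: dir_deriv_basis_sum[OF assms] euler_forms[OF assms] fun_apply)
    finally show "(\<Sum>i\<in>UNIV. dir_deriv (axis i 1) (\<lambda>x. (norm x)\<^sup>2) * dir_deriv (axis i 1) f) x
       = ((2 * d) *\<^sub>R f) x" .
  qed
  ultimately show ?thesis
    by (simp only: laplacian_mult[OF forms_norm2 assms]) (rule ext, simp add: fun_apply algebra_simps)
qed

lemma harmonic_forms_iff: "f \<in> harmonic_forms d \<longleftrightarrow> f \<in> forms d \<and> laplacian f = 0"
  by (auto simp: harmonic_forms_def fun_eq_iff fun_apply)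

lemma subspace_harmonic: "subspace (harmonic_forms d)"
proof (rule subspaceI)
  have "laplacian (0 :: real ^ 'a \<Rightarrow> real) = 0"
    by (simp add: laplacian_eq dir_deriv_0)
  then show "(0 :: real ^ 'a \<Rightarrow> real) \<in> harmonic_forms d"
    by (simp add: harmonic_forms_iff forms_0)
  then show "c *\<^sub>R f \<in> harmonic_forms d" if "f \<in> harmonic_forms d" for c and f :: "real ^ 'a \<Rightarrow> real"
    using that laplacian_lin[of f d 0 d c] by (simp add: harmonic_forms_iff forms_scale)
  show "f + g \<in> harmonic_forms d" if "f \<in> harmonic_forms d" "g \<in> harmonic_forms d" for f g :: "real ^ 'a \<Rightarrow> real"
    using that laplacian_lin[of f d g d 1] by (simp add: harmonic_forms_iff forms_add)
qed

lemma dir_deriv_harmonic: "f \<in> harmonic_forms d \<Longrightarrow> dir_deriv v f \<in> harmonic_forms (d - Suc 0)"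
  by (simp add: harmonic_forms_iff dir_deriv_forms laplacian_dir_deriv[of f d] dir_deriv_0)

text \<open>Finite dimension in the form in which \<open>independent_span_bound\<close> uses it:
  every exponent in a monomial of degree d is at most d, which leaves finitely many
  monomials.\<close>

lemma finite_span_forms:
  obtains B :: "(real ^ 'n::finite \<Rightarrow> real) set" where "finite B" "forms d = span B" "B \<subseteq> forms d"
proof
  let ?B = "{monomial_fun a |a. (\<Sum>i\<in>UNIV. a i) = d} :: (real ^ 'n \<Rightarrow> real) set"
  have "{a :: 'n \<Rightarrow> nat. (\<Sum>i\<in>UNIV. a i) = d} \<subseteq> {a. \<forall>i. a i \<in> {..d} }"
  proof -
    have "a i \<le> (\<Sum>j\<in>UNIV. a j)" for a :: "'n \<Rightarrow> nat" and i
      by (rule member_le_sum) auto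
    then show ?thesis by auto
  qed
  moreover have "finite {a :: 'n \<Rightarrow> nat. \<forall>i. a i \<in> {..d} }"
    using finite_PiE[of "UNIV :: 'n set" "\<lambda>_. {..d}"] by (simp add: PiE_def Pi_def)
  ultimately have "finite {a :: 'n \<Rightarrow> nat. (\<Sum>i\<in>UNIV. a i) = d}"
    using finite_subset by blast
  then show "finite ?B" by simp
  show "forms d = span ?B" by (simp add: forms_def)
  show "?B \<subseteq> forms d" by (auto simp: forms_def intro: span_base)
qed

lemma forms_eq_0:
  assumes "f \<in> forms d" "\<And>x. x \<in> sphere 0 1 \<Longrightarrow> f x = 0"
  shows "f = 0"
proof -
  have *: "f x = 0" if "x \<noteq> 0" for x
    using forms_homogeneous[OF assms(1), of "norm x" "sgn x"] assms(2)[of "sgn x"] that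
    by (simp add: norm_sgn sgn_div_norm)
  \<comment> \<open>The origin is reached by scaling a unit vector with 0. This also covers degree
    0, where \<open>0 ^ d\<close> is 1 but f e is already 0.\<close>
  obtain e :: "real ^ 'a" where e: "norm e = 1"
    using norm_axis_1 by blast
  then have "e \<noteq> 0" by auto
  have "f 0 = f (0 *\<^sub>R e)" by simp
  also have "\<dots> = 0 ^ d * f e" by (rule forms_homogeneous[OF assms(1)])
  also have "\<dots> = 0" using *[OF \<open>e \<noteq> 0\<close>] by simp
  finally show ?thesis using * by (metis zero_fun_apply ext)
qed

section \<open>Integration over the sphere\<close>

abbreviation sphere_int :: "(real ^ 'n::finite \<Rightarrow> real) \<Rightarrow> real"
  where "sphere_int f \<equiv> (LINT x|sphere_measure. f x)"

lemma sets_sphere_measure: "sets sphere_measure = sets (restrict_space borel (sphere 0 1))"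
  by (simp add: sphere_measure_def)

lemma space_sphere_measure: "space sphere_measure = sphere 0 1"
  by (simp add: sphere_measure_def space_restrict_space space_scale_measure)

lemma in_sets_sphere_measure_iff:
  "E \<in> sets sphere_measure \<longleftrightarrow> E \<in> sets borel \<and> E \<subseteq> sphere 0 1"
  by (auto simp: sets_sphere_measure sets_restrict_space_iff)

definition sphere_cone :: "(real ^ 'n::finite) set \<Rightarrow> (real ^ 'n) set"
  where "sphere_cone E = (\<lambda>(r, y). r *\<^sub>R y) ` ({0<..1} \<times> E)"

lemma sphere_cone_eq:
  assumes "E \<subseteq> sphere 0 1"
  shows "sphere_cone E = {x. x \<noteq> 0 \<and> norm x \<le> 1 \<and> sgn x \<in> E}"
proof (intro equalityI subsetI)
  fix x assume x: "x \<in> {x. x \<noteq> 0 \<and> norm x \<le> 1 \<and> sgn x \<in> E}"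
  then have "x = norm x *\<^sub>R sgn x" by (simp add: sgn_div_norm)
  then show "x \<in> sphere_cone E"
    unfolding sphere_cone_def using x by (intro image_eqI[of _ _ "(norm x, sgn x)"]) auto
next
  fix x assume "x \<in> sphere_cone E"
  then obtain r y where "x = r *\<^sub>R y" "0 < r" "r \<le> 1" "y \<in> E" by (auto simp: sphere_cone_def)
  moreover have "norm y = 1" using \<open>y \<in> E\<close> assms by auto
  ultimately show "x \<in> {x. x \<noteq> 0 \<and> norm x \<le> 1 \<and> sgn x \<in> E}"
    by (auto simp: sgn_div_norm)
qed

lemma borel_sphere_cone:
  assumes "E \<in> sets borel" "E \<subseteq> sphere 0 1"
  shows "sphere_cone E \<in> sets borel"
proof -
  have "sphere_cone E = (sgn -` E \<inter> space borel) \<inter> (cball 0 1 - {0})"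
    by (auto simp: sphere_cone_eq[OF assms(2)])
  also have "\<dots> \<in> sets borel"
    by (intro sets.Int measurable_sets[OF borel_measurable_sgn assms(1)]) auto
  finally show ?thesis .
qed

lemma lmeasurable_sphere_cone:
  assumes "E \<in> sets borel" "E \<subseteq> sphere 0 1"
  shows "sphere_cone E \<in> lmeasurable"
proof (rule bounded_set_imp_lmeasurable)
  have "sphere_cone E \<subseteq> cball 0 1"
    by (auto simp: sphere_cone_eq[OF assms(2)])
  then show "bounded (sphere_cone E)"
    using bounded_subset by blast
  show "sphere_cone E \<in> sets lebesgue"
    using borel_sphere_cone[OF assms] by (simp add: sets_completionI_sets)
qed

lemma emeasure_sphere_measure_cone:
  fixes E :: "(real ^ 'n::finite) set"
  assumes "E \<in> sets borel" "E \<subseteq> sphere 0 1"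
  shows "emeasure sphere_measure E = ennreal (CARD('n) * measure lebesgue (sphere_cone E))"
proof -
  have "emeasure sphere_measure E = of_nat CARD('n) * emeasure lebesgue (sphere_cone E)"
    using borel_sphere_cone[OF assms]
    by (simp add: emeasure_sphere_measure[OF assms] sphere_cone_def)
  also have "\<dots> = ennreal (CARD('n)) * ennreal (measure lebesgue (sphere_cone E))"
    using emeasure_eq_measure2[of "sphere_cone E" lebesgue] lmeasurable_sphere_cone[OF assms]
    by (simp add: fmeasurableD2 emeasure_eq_ennreal_measure ennreal_of_nat_eq_real_of_nat)
  finally show ?thesis
    by (simp add: ennreal_mult'')
qed

lemma finite_measure_sphere: "finite_measure sphere_measure"
  by (rule finite_measureI) (simp add: space_sphere_measure emeasure_sphere_measure_cone)

text \<open>A linear isometry maps the cone over E onto the cone over its image, so the invariance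
  of Lebesgue measure passes to the sphere.\<close>

lemma emeasure_sphere_measure_orthogonal:
  fixes T :: "real ^ 'n::finite \<Rightarrow> real ^ 'n"
  assumes T: "orthogonal_transformation T" and E: "E \<in> sets borel" "E \<subseteq> sphere 0 1"
  shows "emeasure sphere_measure (T ` E) = emeasure sphere_measure E"
proof -
  note lin = orthogonal_transformation_linear[OF T]
  have "T ` E = inv T -` E \<inter> space borel"
    using orthogonal_transformation_bij[OF T] by (simp add: bij_vimage_eq_inv_image bij_imp_bij_inv inv_inv_eq)
  moreover have "inv T \<in> borel_measurable borel"
    using orthogonal_transformation_linear[OF orthogonal_transformation_inv[OF T]]
    by (intro borel_measurable_continuous_onI linear_continuous_on) (simp add: linear_linear)
  ultimately have "T ` E \<in> sets borel"
    using E(1) measurable_sets[of "inv T" borel borel E] by simp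
  moreover have "T ` E \<subseteq> sphere 0 1"
    using E(2) by (auto simp: orthogonal_transformation_norm[OF T])
  moreover have "sphere_cone (T ` E) = T ` sphere_cone E"
    by (force simp: sphere_cone_def linear_scale[OF lin])
  ultimately show ?thesis
    using emeasure_lborel_orthogonal_image[OF T borel_sphere_cone[OF E] lmeasurable_sphere_cone[OF E]]
      borel_sphere_cone[of "T ` E"] E
    by (simp add: emeasure_sphere_measure flip: sphere_cone_def)
qed

lemma measurable_sphere_measure_orthogonal:
  fixes T :: "real ^ 'n::finite \<Rightarrow> real ^ 'n"
  assumes T: "orthogonal_transformation T"
  shows "T \<in> measurable sphere_measure sphere_measure"
proof -
  have "T \<in> borel_measurable borel"
    using orthogonal_transformation_linear[OF T]
    by (intro borel_measurable_continuous_onI linear_continuous_on) (simp add: linear_linear)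
  then have "T \<in> measurable (restrict_space borel (sphere 0 1)) (restrict_space borel (sphere 0 1))"
    by (rule measurable_restrict_space3) (auto simp: orthogonal_transformation_norm[OF T])
  then show ?thesis
    by (simp cong: measurable_cong_sets add: sets_sphere_measure)
qed

lemma distr_sphere_measure_orthogonal:
  fixes T :: "real ^ 'n::finite \<Rightarrow> real ^ 'n"
  assumes T: "orthogonal_transformation T"
  shows "distr sphere_measure sphere_measure T = sphere_measure"
proof (rule measure_eqI)
  fix E assume "E \<in> sets (distr sphere_measure sphere_measure T)"
  then have E: "E \<in> sets borel" "E \<subseteq> sphere 0 1"
    by (auto simp: in_sets_sphere_measure_iff)
  note T' = orthogonal_transformation_inv[OF T]
  have "emeasure (distr sphere_measure sphere_measure T) E
      = emeasure sphere_measure (T -` E \<inter> sphere 0 1)"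
    using E by (subst emeasure_distr[OF measurable_sphere_measure_orthogonal[OF T]])
      (auto simp: in_sets_sphere_measure_iff space_sphere_measure)
  also have "T -` E \<inter> sphere 0 1 = T -` E"
    using E(2) by (auto simp: orthogonal_transformation_norm[OF T] subset_iff)
  also have "\<dots> = inv T ` E"
    using orthogonal_transformation_bij[OF T] by (simp add: bij_vimage_eq_inv_image)
  also have "emeasure sphere_measure \<dots> = emeasure sphere_measure E"
    by (rule emeasure_sphere_measure_orthogonal[OF T' E])
  finally show "emeasure (distr sphere_measure sphere_measure T) E = emeasure sphere_measure E" .
qed simp

lemma continuous_measurable_sphere:
  fixes f :: "real ^ 'n::finite \<Rightarrow> real"
  assumes "continuous_on (sphere 0 1) f"
  shows "f \<in> borel_measurable sphere_measure"
  using borel_measurable_continuous_on_restrict[OF assms]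
  by (simp cong: measurable_cong_sets add: sets_sphere_measure)

lemma continuous_integrable_sphere:
  fixes f :: "real ^ 'n::finite \<Rightarrow> real"
  assumes "continuous_on (sphere 0 1) f"
  shows "integrable sphere_measure f"
proof -
  have "bounded (f ` sphere 0 1)"
    by (intro compact_imp_bounded compact_continuous_image assms) simp
  then obtain B where "\<And>x. x \<in> sphere 0 1 \<Longrightarrow> norm (f x) \<le> B"
    unfolding bounded_iff by (metis imageI)
  then show ?thesis
    by (intro finite_measure.integrable_const_bound[OF finite_measure_sphere, of _ B]
      continuous_measurable_sphere assms AE_I2) (auto simp: space_sphere_measure)
qed

lemma forms_integrable: "f \<in> forms d \<Longrightarrow> integrable sphere_measure f"
  by (intro continuous_integrable_sphere forms_continuous)

lemma sphere_int_cong: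
  "(\<And>x. x \<in> sphere 0 1 \<Longrightarrow> f x = g x) \<Longrightarrow> sphere_int f = sphere_int g"
  by (rule Bochner_Integration.integral_cong) (auto simp: space_sphere_measure)

lemma sphere_int_orthogonal:
  fixes f :: "real ^ 'n::finite \<Rightarrow> real" and T :: "real ^ 'n \<Rightarrow> real ^ 'n"
  assumes T: "orthogonal_transformation T" and f: "continuous_on (sphere 0 1) f"
  shows "sphere_int (\<lambda>x. f (T x)) = sphere_int f"
  using integral_distr[OF measurable_sphere_measure_orthogonal[OF T] continuous_measurable_sphere[OF f]]
  by (simp add: distr_sphere_measure_orthogonal[OF T])

text \<open>If f were positive at x, the cone over a null set containing all points with f \<noteq>
  0 would contain a nonempty open set, namely the y in the punctured ball with f positive at
  \<open>sgn y\<close>; but that cone has volume 0. This makes the L2 product definite on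
  forms.\<close>

lemma sphere_int_nonneg_eq_0:
  fixes f :: "real ^ 'n::finite \<Rightarrow> real"
  assumes f: "continuous_on (sphere 0 1) f" and nn: "\<And>x. x \<in> sphere 0 1 \<Longrightarrow> 0 \<le> f x"
    and int: "sphere_int f = 0" and x: "x \<in> sphere 0 1"
  shows "f x = 0"
proof (rule ccontr)
  assume "f x \<noteq> 0"
  then have pos: "f x > 0" using nn[OF x] by simp
  have "AE y in sphere_measure. f y = 0"
  proof -
    have "AE y in sphere_measure. 0 \<le> f y"
      using nn by (intro AE_I2) (simp add: space_sphere_measure)
    then show ?thesis
      using integral_nonneg_eq_0_iff_AE[OF continuous_integrable_sphere[OF f]] int by simp
  qed
  then obtain N where N: "{y \<in> sphere 0 1. f y \<noteq> 0} \<subseteq> N" "emeasure sphere_measure N = 0"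
      "N \<in> sets sphere_measure"
    by (auto elim!: AE_E simp: space_sphere_measure)
  then have Nb: "N \<in> sets borel" "N \<subseteq> sphere 0 1"
    by (auto simp: in_sets_sphere_measure_iff)
  have "measure lebesgue (sphere_cone N) = 0"
    using N(2) by (simp add: emeasure_sphere_measure_cone[OF Nb])
  then have neg: "negligible (sphere_cone N)"
    using lmeasurable_sphere_cone[OF Nb] negligible_iff_measure by blast
  let ?O = "ball 0 1 - {0} :: (real ^ 'n) set"
  let ?V = "?O \<inter> (\<lambda>y. f (sgn y)) -` {0<..}"
  have "continuous_on ?O (\<lambda>y. f (sgn y))"
    by (intro continuous_on_compose2[OF f] continuous_intros) (auto simp: norm_sgn split: if_splits)
  then have "open ?V"
    by (intro continuous_open_preimage) auto
  \<comment> \<open>x itself lies on the boundary of the ball, hence the midpoint between x and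
    0.\<close>
  moreover have "(1/2) *\<^sub>R x \<in> ?V"
    using pos x by (auto simp: sgn_div_norm)
  moreover have "?V \<subseteq> sphere_cone N"
    using N(1) by (auto simp: sphere_cone_eq[OF Nb(2)] norm_sgn subset_iff)
  ultimately show False
    using open_not_negligible[of ?V] negligible_subset[OF neg] by blast
qed

lemma measure_sphere_pos: "0 < measure (sphere_measure :: (real ^ 'n::finite) measure) (sphere 0 1)"
proof (rule ccontr)
  assume "\<not> ?thesis"
  then have "measure (sphere_measure :: (real ^ 'n) measure) (sphere 0 1) = 0"
    using measure_nonneg[of "sphere_measure :: (real ^ 'n) measure" "sphere 0 1"] by linarith
  then have "sphere_int (\<lambda>x :: real ^ 'n. 1) = 0"
    by (simp add: space_sphere_measure)
  moreover obtain e :: "real ^ 'n" where "norm e = 1" using norm_axis_1 by blast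
  ultimately show False
    using sphere_int_nonneg_eq_0[of "\<lambda>x. 1" e] by simp
qed

lemma sphere_int_const: "sphere_int (\<lambda>x :: real ^ 'n::finite. c) =
    c * measure (sphere_measure :: (real ^ 'n) measure) (sphere 0 1)"
  by (simp add: space_sphere_measure)

section \<open>Infinitesimal rotations and integration by parts\<close>

definition plane_rotation :: "'n \<Rightarrow> 'n \<Rightarrow> real \<Rightarrow> real ^ 'n::finite \<Rightarrow> real ^ 'n"
  where "plane_rotation i k \<theta> x = x + (cos \<theta> - 1) *\<^sub>R (x $ i *\<^sub>R axis i 1 + x $ k *\<^sub>R axis k 1)
    + sin \<theta> *\<^sub>R (x $ i *\<^sub>R axis k 1 - x $ k *\<^sub>R axis i 1)"

lemma orthogonal_plane_rotation:
  assumes "i \<noteq> k"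
  shows "orthogonal_transformation (plane_rotation i k \<theta>)"
  unfolding orthogonal_transformation
proof (intro conjI allI)
  show "linear (plane_rotation i k \<theta>)"
    by (rule linearI) (simp_all add: plane_rotation_def algebra_simps)
  fix x :: "real ^ 'a"
  \<comment> \<open>u is the projection of x to the plane of the coordinates i and k, and w is u
    turned by a right angle; both have squared norm s.\<close>
  define u where "u = x $ i *\<^sub>R axis i 1 + x $ k *\<^sub>R axis k (1::real)"
  define w where "w = x $ i *\<^sub>R axis k 1 - x $ k *\<^sub>R axis i (1::real)"
  define s where "s = (x $ i)\<^sup>2 + (x $ k)\<^sup>2"
  have [simp]: "axis i (1::real) $ k = 0" "axis k (1::real) $ i = 0"
    using assms by (auto simp: axis_def)
  have ip: "x \<bullet> u = s" "u \<bullet> x = s" "u \<bullet> u = s" "w \<bullet> w = s" "x \<bullet> w = 0" "w \<bullet> x = 0" "u \<bullet> w = 0" "w \<bullet> u = 0"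
    by (simp_all add: u_def w_def s_def inner_axis inner_axis' inner_simps power2_eq_square inner_axis_axis)
  have "plane_rotation i k \<theta> x \<bullet> plane_rotation i k \<theta> x =
     x \<bullet> x + s * ((cos \<theta> - 1)\<^sup>2 + (sin \<theta>)\<^sup>2 + 2 * (cos \<theta> - 1))"
  proof -
    have "s * (cos \<theta> * cos \<theta>) + s * (sin \<theta> * sin \<theta>) = s"
      using sin_cos_squared_add2[of \<theta>] by (simp add: power2_eq_square flip: distrib_left)
    then show ?thesis
      unfolding plane_rotation_def u_def[symmetric] w_def[symmetric]
      by (simp add: inner_add_left inner_add_right ip power2_eq_square algebra_simps)
  qed
  also have "\<dots> = x \<bullet> x"
  proof -
    have "(cos \<theta> - 1)\<^sup>2 + (sin \<theta>)\<^sup>2 + 2 * (cos \<theta> - 1) = 0"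
      using sin_cos_squared_add[of \<theta>] by (simp add: power2_eq_square algebra_simps)
    then show ?thesis by (simp only: mult_zero_right add_0_right)
  qed
  finally show "norm (plane_rotation i k \<theta> x) = norm x"
    by (simp add: norm_eq_sqrt_inner)
qed

text \<open>Serves to dominate the difference quotients along a rotation. The mean value bound is
  taken over the ball because the ball is convex.\<close>

lemma forms_lipschitz:
  fixes f :: "real ^ 'n::finite \<Rightarrow> real"
  assumes f: "f \<in> forms d"
  obtains L where "\<And>x y. x \<in> cball 0 1 \<Longrightarrow> y \<in> cball 0 1 \<Longrightarrow> \<bar>f x - f y\<bar> \<le> L * norm (x - y)"
proof -
  define M where "M x = (\<Sum>i\<in>UNIV. \<bar>dir_deriv (axis i 1) f x\<bar>)" for x
  have "continuous_on (cball 0 1) M"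
    unfolding M_def by (intro continuous_intros forms_continuous[OF dir_deriv_forms[OF f]])
  then have "bounded (M ` cball 0 1)"
    by (intro compact_imp_bounded compact_continuous_image) auto
  then obtain B where B: "\<And>x. x \<in> cball 0 1 \<Longrightarrow> norm (M x) \<le> B"
    unfolding bounded_iff by (metis imageI)
  have "onorm (\<lambda>v. dir_deriv v f x) \<le> B" if "x \<in> cball 0 1" for x
  proof (rule onorm_le)
    fix v
    have "\<bar>dir_deriv v f x\<bar> \<le> (\<Sum>i\<in>UNIV. \<bar>v $ i\<bar> * \<bar>dir_deriv (axis i 1) f x\<bar>)"
      unfolding dir_deriv_basis_sum[OF f, symmetric, of v]
      by (rule order_trans[OF sum_abs]) (simp add: abs_mult)
    also have "\<dots> \<le> (\<Sum>i\<in>UNIV. norm v * \<bar>dir_deriv (axis i 1) f x\<bar>)"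
      by (intro sum_mono mult_right_mono component_le_norm_cart) auto
    also have "\<dots> = M x * norm v"
      by (simp add: M_def sum_distrib_left mult.commute)
    also have "\<dots> \<le> B * norm v"
      using B[OF that] by (intro mult_right_mono) auto
    finally show "norm (dir_deriv v f x) \<le> B * norm v" by simp
  qed
  then have "norm (f x - f y) \<le> B * norm (x - y)" if "x \<in> cball 0 1" "y \<in> cball 0 1" for x y
    using that
    by (intro differentiable_bound[of "cball 0 1" f "\<lambda>x v. dir_deriv v f x"])
       (auto intro: has_derivative_at_withinI forms_has_derivative[OF f])
  then show ?thesis
    using that[of B] by simp
qed

text \<open>The integral of f composed with a rotation does not depend on the angle, so every
  difference quotient integrates to 0, and dominated convergence passes to angle 0. The direction is
  the velocity of the rotation: at angle 0 the coefficient \<open>cos \<theta> - 1\<close> in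
  \<open>plane_rotation\<close> has derivative 0 and \<open>sin \<theta>\<close> has derivative
  1.\<close>

lemma sphere_int_rotation_deriv:
  fixes f :: "real ^ 'n::finite \<Rightarrow> real"
  assumes f: "f \<in> forms d"
  shows "sphere_int (\<lambda>x. dir_deriv (x $ i *\<^sub>R axis k 1 - x $ k *\<^sub>R axis i 1) f x) = 0"
proof (cases "i = k")
  case True
  then show ?thesis
    using linear_0[OF linear_dir_deriv[OF f]] by simp
next
  case False
  obtain L0 where L0: "\<And>x y. x \<in> cball 0 1 \<Longrightarrow> y \<in> cball 0 1 \<Longrightarrow> \<bar>f x - f y\<bar> \<le> L0 * norm (x - y)"
    using forms_lipschitz[OF f] by blast
  \<comment> \<open>The sign of \<open>L0\<close> is not part of its specification, while the
    estimate below needs a nonnegative factor.\<close>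
  define L where "L = max L0 0"
  have L: "\<bar>f x - f y\<bar> \<le> L * norm (x - y)" if "x \<in> cball 0 1" "y \<in> cball 0 1" for x y
    using L0[OF that] mult_right_mono[of L0 L "norm (x - y)"] by (auto simp: L_def)
  define \<theta> where "\<theta> m = inverse (real (Suc m))" for m
  define w where "w x = x $ i *\<^sub>R axis k 1 - x $ k *\<^sub>R axis i (1::real)" for x :: "real ^ 'n"
  define u where "u x = x $ i *\<^sub>R axis i 1 + x $ k *\<^sub>R axis k (1::real)" for x :: "real ^ 'n"
  define s where "s m x = (f (plane_rotation i k (\<theta> m) x) - f x) / \<theta> m" for m x
  have cont: "continuous_on (sphere 0 1) (\<lambda>x. f (plane_rotation i k t x))" for t
    unfolding plane_rotation_def
    by (rule continuous_on_compose2[OF forms_continuous[OF f, of UNIV]]) (auto intro!: continuous_intros)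
  have int_s: "sphere_int (s m) = 0" for m
    using sphere_int_orthogonal[OF orthogonal_plane_rotation[OF False] forms_continuous[OF f]]
      continuous_integrable_sphere[OF cont] forms_integrable[OF f]
    by (simp add: s_def)
  have lim: "(\<lambda>m. s m x) \<longlonglongrightarrow> dir_deriv (w x) f x" for x
  proof -
    have rot: "plane_rotation i k t x = x + (cos t - 1) *\<^sub>R u x + sin t *\<^sub>R w x" for t
      by (simp add: plane_rotation_def u_def w_def)
    have "((\<lambda>t. plane_rotation i k t x) has_derivative (\<lambda>h. h *\<^sub>R w x)) (at 0)"
      unfolding rot by (auto intro!: derivative_eq_intros)
    from has_derivative_compose[OF this, of f "\<lambda>v. dir_deriv v f x"]
    have "((\<lambda>t. f (plane_rotation i k t x)) has_derivative (\<lambda>h. dir_deriv (h *\<^sub>R w x) f x)) (at 0)"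
      using forms_has_derivative[OF f, of x] by (simp add: rot)
    then have "((\<lambda>t. f (plane_rotation i k t x)) has_field_derivative dir_deriv (w x) f x) (at 0)"
      by (simp add: has_field_derivative_def linear_scale[OF linear_dir_deriv[OF f]]
          mult.commute[of _ "dir_deriv (w x) f x"])
    then have "((\<lambda>t. (f (plane_rotation i k t x) - f x) / t) \<longlongrightarrow> dir_deriv (w x) f x) (at 0)"
      by (simp add: DERIV_def rot)
    moreover have "filterlim \<theta> (at 0) sequentially"
      unfolding filterlim_at
      using LIMSEQ_inverse_real_of_nat by (auto simp: \<theta>_def[abs_def] simp del: of_nat_Suc)
    ultimately show ?thesis
      unfolding s_def by (rule filterlim_compose)
  qed
  \<comment> \<open>Both |cos \<theta> - 1| and |sin \<theta>| are at most \<theta>, and u x and w x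
    have norm at most 2, so a point moves by at most 4 \<theta>; the factor \<theta> cancels in the
    quotient.\<close>
  have bound: "norm (s m x) \<le> 4 * L" if "x \<in> sphere 0 1" for m x
  proof -
    have n1: "norm (v :: real ^ 'n) \<le> 2" if "v = u x \<or> v = w x" for v
    proof -
      have c: "\<bar>x $ i\<bar> \<le> 1" "\<bar>x $ k\<bar> \<le> 1"
        using component_le_norm_cart[of x] \<open>x \<in> sphere 0 1\<close> by auto
      have "norm v \<le> \<bar>x $ i\<bar> + \<bar>x $ k\<bar>"
        using that norm_triangle_ineq[of "x $ i *\<^sub>R axis i (1::real)" "x $ k *\<^sub>R axis k 1"]
          norm_triangle_ineq4[of "x $ i *\<^sub>R axis k (1::real)" "x $ k *\<^sub>R axis i 1"]
        by (auto simp: u_def w_def)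
      then show ?thesis using c by linarith
    qed
    have \<theta>: "\<theta> m > 0" by (simp add: \<theta>_def)
    have "\<bar>cos (\<theta> m) - 1\<bar> \<le> \<theta> m"
    proof -
      have "\<bar>cos (\<theta> m) - 1\<bar> = 2 * (\<bar>sin (\<theta> m / 2)\<bar> * \<bar>sin (\<theta> m / 2)\<bar>)"
        using cos_double_sin[of "\<theta> m / 2"] by (simp add: power2_eq_square)
      also have "\<bar>sin (\<theta> m / 2)\<bar> * \<bar>sin (\<theta> m / 2)\<bar> \<le> \<bar>\<theta> m / 2\<bar> * 1"
        by (intro mult_mono abs_sin_x_le_abs_x abs_sin_le_one) auto
      finally show ?thesis using \<theta> by simp
    qed
    moreover have "\<bar>sin (\<theta> m)\<bar> \<le> \<theta> m"
      using abs_sin_x_le_abs_x[of "\<theta> m"] \<theta> by simp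
    ultimately have "\<bar>cos (\<theta> m) - 1\<bar> * norm (u x) + \<bar>sin (\<theta> m)\<bar> * norm (w x) \<le> \<theta> m * 2 + \<theta> m * 2"
      using \<theta> n1 by (intro add_mono mult_mono) auto
    then have R: "norm (plane_rotation i k (\<theta> m) x - x) \<le> 4 * \<theta> m"
      using norm_triangle_ineq[of "(cos (\<theta> m) - 1) *\<^sub>R u x" "sin (\<theta> m) *\<^sub>R w x"]
      by (simp add: plane_rotation_def u_def w_def)
    have "\<bar>f (plane_rotation i k (\<theta> m) x) - f x\<bar> \<le> L * norm (plane_rotation i k (\<theta> m) x - x)"
      using that orthogonal_transformation_norm[OF orthogonal_plane_rotation[OF False]]
      by (intro L) auto
    also have "\<dots> \<le> L * (4 * \<theta> m)"
      by (intro mult_left_mono R) (simp add: L_def)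
    finally show ?thesis
      using \<theta> by (simp add: s_def divide_le_eq)
  qed
  have "(\<lambda>m. sphere_int (s m)) \<longlonglongrightarrow> sphere_int (\<lambda>x. dir_deriv (w x) f x)"
  proof (rule integral_dominated_convergence[where w = "\<lambda>x. 4 * L"])
    have s_meas: "s m \<in> borel_measurable sphere_measure" for m
      unfolding s_def
      by (intro continuous_measurable_sphere continuous_intros cont forms_continuous[OF f])
         (simp add: \<theta>_def)
    then show "s m \<in> borel_measurable sphere_measure" for m .
    show "(\<lambda>x. dir_deriv (w x) f x) \<in> borel_measurable sphere_measure"
      using lim s_meas by (rule borel_measurable_LIMSEQ_real)
    show "integrable sphere_measure (\<lambda>x. 4 * L)"
      by (intro continuous_integrable_sphere continuous_intros)
  qed (use lim bound in \<open>auto simp: space_sphere_measure\<close>)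
  then show ?thesis
    using int_s LIMSEQ_unique[OF _ tendsto_const] by (simp add: w_def)
qed

text \<open>Sum the vanishing rotation integrals of x_k f over all k. The coefficient collects d
  from Euler's identity, n from differentiating each x_k along its own axis, and -1 from the
  diagonal term k = i; the squared norm in front of the derivative of f is 1 on the sphere.\<close>

lemma sphere_int_deriv_axis:
  fixes f :: "real ^ 'n::finite \<Rightarrow> real"
  assumes f: "f \<in> forms d"
  shows "sphere_int (dir_deriv (axis i 1) f) = (real d + real CARD('n) - 1) * sphere_int (\<lambda>x. x $ i * f x)"
proof -
  define q where "q k = (\<lambda>x. x $ k * f x)" for k
  have q: "q k \<in> forms (Suc d)" for k
    unfolding q_def by (rule forms_coord[OF f])
  note D = dir_deriv_forms[OF f]
  have *: "(\<Sum>k\<in>UNIV. dir_deriv (x $ i *\<^sub>R axis k 1 - x $ k *\<^sub>R axis i 1) (q k) x)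
     = (real d + real CARD('n) - 1) * (x $ i * f x) - dir_deriv (axis i 1) f x"
    if x: "x \<in> sphere 0 1" for x
  proof -
    have xx: "(\<Sum>k\<in>UNIV. x $ k * x $ k) = 1"
      using x by (simp add: norm_eq_1 inner_vec_def)
    have "dir_deriv (x $ i *\<^sub>R axis k 1 - x $ k *\<^sub>R axis i 1) (q k) x =
       x $ i * (x $ k * dir_deriv (axis k 1) f x) + x $ i * f x
        - (x $ k * x $ k) * dir_deriv (axis i 1) f x - (if k = i then x $ i * f x else 0)" for k
    proof -
      have axis_nth_eq: "axis k (1::real) $ k = 1" "axis i (1::real) $ k = (if k = i then 1 else 0)"
        by (simp_all add: axis_def)
      have "dir_deriv v (q k) x = x $ k * dir_deriv v f x + v $ k * f x" for v
        by (simp add: q_def dir_deriv_coord[OF f] fun_apply)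
      then show ?thesis
        using axis_nth_eq
        by (simp add: linear_diff[OF linear_dir_deriv[OF q]] linear_scale[OF linear_dir_deriv[OF q]]
             linear_diff[OF linear_dir_deriv[OF f]] linear_scale[OF linear_dir_deriv[OF f]])
           (simp add: algebra_simps)
    qed
    then have "(\<Sum>k\<in>UNIV. dir_deriv (x $ i *\<^sub>R axis k 1 - x $ k *\<^sub>R axis i 1) (q k) x)
      = x $ i * (\<Sum>k\<in>UNIV. x $ k * dir_deriv (axis k 1) f x) + real CARD('n) * (x $ i * f x)
       - (\<Sum>k\<in>UNIV. x $ k * x $ k) * dir_deriv (axis i 1) f x - x $ i * f x"
      by (simp add: sum.distrib sum_subtractf sum_distrib_left sum_distrib_right)
    then show ?thesis
      by (simp add: xx dir_deriv_basis_sum[OF f] euler_forms[OF f] algebra_simps)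
  qed
  have int: "integrable sphere_measure (\<lambda>x. dir_deriv (x $ i *\<^sub>R axis k 1 - x $ k *\<^sub>R axis i 1) (q k) x)" for k
  proof -
    have "(\<lambda>x. dir_deriv (x $ i *\<^sub>R axis k 1 - x $ k *\<^sub>R axis i 1) (q k) x)
      = (\<lambda>x. x $ i * dir_deriv (axis k 1) (q k) x - x $ k * dir_deriv (axis i 1) (q k) x)"
      by (simp add: linear_diff[OF linear_dir_deriv[OF q]] linear_scale[OF linear_dir_deriv[OF q]])
    then show ?thesis
      using forms_integrable[OF forms_coord[OF dir_deriv_forms[OF q]]] by simp
  qed
  have "0 = (\<Sum>k\<in>UNIV. sphere_int (\<lambda>x. dir_deriv (x $ i *\<^sub>R axis k 1 - x $ k *\<^sub>R axis i 1) (q k) x))"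
    by (simp add: sphere_int_rotation_deriv[OF q])
  also have "\<dots> = sphere_int (\<lambda>x. \<Sum>k\<in>UNIV. dir_deriv (x $ i *\<^sub>R axis k 1 - x $ k *\<^sub>R axis i 1) (q k) x)"
    using int by simp
  also have "\<dots> = sphere_int (\<lambda>x. (real d + real CARD('n) - 1) * (x $ i * f x) - dir_deriv (axis i 1) f x)"
    by (rule sphere_int_cong) (rule *)
  also have "\<dots> = (real d + real CARD('n) - 1) * sphere_int (\<lambda>x. x $ i * f x) - sphere_int (dir_deriv (axis i 1) f)"
    using forms_integrable[OF forms_coord[OF f]] forms_integrable[OF D] by simp
  finally show ?thesis by simp
qed

lemma sphere_int_deriv:
  fixes f :: "real ^ 'n::finite \<Rightarrow> real"
  assumes f: "f \<in> forms d"
  shows "sphere_int (dir_deriv v f) = (real d + real CARD('n) - 1) * sphere_int (\<lambda>x. (v \<bullet> x) * f x)"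
proof -
  have "sphere_int (dir_deriv v f) = sphere_int (\<lambda>x. \<Sum>i\<in>UNIV. v $ i * dir_deriv (axis i 1) f x)"
    by (simp add: dir_deriv_basis_sum[OF f])
  also have "\<dots> = (\<Sum>i\<in>UNIV. v $ i * sphere_int (dir_deriv (axis i 1) f))"
    using forms_integrable[OF dir_deriv_forms[OF f]] by simp
  also have "\<dots> = (\<Sum>i\<in>UNIV. v $ i * ((real d + real CARD('n) - 1) * sphere_int (\<lambda>x. x $ i * f x)))"
    by (simp add: sphere_int_deriv_axis[OF f])
  also have "\<dots> = (real d + real CARD('n) - 1) * sphere_int (\<lambda>x. \<Sum>i\<in>UNIV. v $ i * (x $ i * f x))"
    using forms_integrable[OF forms_coord[OF f]]
    by (subst Bochner_Integration.integral_sum) (auto simp: sum_distrib_left intro!: sum.cong)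
  also have "(\<lambda>x. \<Sum>i\<in>UNIV. v $ i * (x $ i * f x)) = (\<lambda>x. (v \<bullet> x) * f x)"
    by (simp add: inner_vec_def sum_distrib_right mult.assoc)
  finally show ?thesis .
qed

section \<open>Zonal harmonics\<close>

lemma sphere_int_scale: "sphere_int (\<lambda>x. c * f x) = c * sphere_int f" for c :: real
  by simp

text \<open>Euler's identity writes j f as the sum of the x_i times the partial derivatives.
  Integration by parts, read backwards, turns each summand into a second derivative, and together
  these give the Laplacian. The factor a is positive because n is at least 2.\<close>

lemma harmonic_int_eq_0:
  fixes f :: "real ^ 'n::finite \<Rightarrow> real"
  assumes n: "2 \<le> CARD('n)" and f: "f \<in> harmonic_forms j" and j: "0 < j"
  shows "sphere_int f = 0"
proof -
  have ff: "f \<in> forms j" "laplacian f = 0"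
    using f by (auto simp: harmonic_forms_iff)
  note D = dir_deriv_forms[OF ff(1)]
  define a where "a = real (j - Suc 0) + real CARD('n) - 1"
  have "a > 0" using n j by (simp add: a_def)
  have "real j * sphere_int f = sphere_int (\<lambda>x. \<Sum>i\<in>UNIV. x $ i * dir_deriv (axis i 1) f x)"
    by (simp add: dir_deriv_basis_sum[OF ff(1)] euler_forms[OF ff(1)])
  also have "\<dots> = (\<Sum>i\<in>UNIV. sphere_int (\<lambda>x. x $ i * dir_deriv (axis i 1) f x))"
    using forms_integrable[OF forms_coord[OF D]] by simp
  finally have "a * (real j * sphere_int f) =
      (\<Sum>i\<in>UNIV. sphere_int (dir_deriv (axis i 1) (dir_deriv (axis i 1) f)))"
    by (simp add: sphere_int_deriv_axis[OF D] a_def sum_distrib_left)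
  also have "\<dots> = sphere_int (laplacian f)"
    using forms_integrable[OF dir_deriv_forms[OF D]] by (simp add: laplacian_eq fun_apply)
  finally show ?thesis
    using \<open>a > 0\<close> j by (simp add: ff(2) fun_apply)
qed

text \<open>Write p as a coordinate x_m times q. Integration by parts trades x_m for a derivative of
  q f. If it falls on f, there remains q against a harmonic form of degree j - 1; if it falls on q,
  a form of still lower degree against f. Both pairs are covered by the outer induction.\<close>

lemma harmonic_orthogonal_lower:
  fixes f p :: "real ^ 'n::finite \<Rightarrow> real"
  assumes n: "2 \<le> CARD('n)" and "f \<in> harmonic_forms j" "p \<in> forms i" "i < j"
  shows "sphere_int (\<lambda>x. p x * f x) = 0"
  using assms(2-)
proof (induction i arbitrary: j f p rule: less_induct)
  case (less i)
  have f: "f \<in> forms j"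
    using less.prems by (simp add: harmonic_forms_iff)
  \<comment> \<open>The inner induction varies the degree, so it is run for a general d with d = i
    as a premise.\<close>
  have "d = i \<Longrightarrow> sphere_int (\<lambda>x. p x * f x) = 0" if "p \<in> forms d" for d
    using that
  proof (induction rule: forms_induct)
    case (zero d)
    then show ?case by (simp add: fun_apply)
  next
    case (const c)
    then show ?case
      using harmonic_int_eq_0[OF n less.prems(1)] less.prems(3) by simp
  next
    case (coord d m q)
    have "d < i" "d < j - Suc 0" "d - Suc 0 < i" "d - Suc 0 < j"
      using coord less.prems by auto
    then have "sphere_int (\<lambda>x. q x * dir_deriv (axis m 1) f x) = 0"
        "sphere_int (\<lambda>x. dir_deriv (axis m 1) q x * f x) = 0"
      using less.IH[OF _ dir_deriv_harmonic[OF less.prems(1)] coord(1)]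
        less.IH[OF _ less.prems(1) dir_deriv_forms[OF coord(1)]] by auto
    moreover have "sphere_int (dir_deriv (axis m 1) (q * f)) =
        sphere_int (\<lambda>x. q x * dir_deriv (axis m 1) f x) + sphere_int (\<lambda>x. dir_deriv (axis m 1) q x * f x)"
      using forms_integrable[OF forms_mult[OF coord(1) dir_deriv_forms[OF f]], unfolded times_fun_def]
        forms_integrable[OF forms_mult[OF dir_deriv_forms[OF coord(1)] f], unfolded times_fun_def]
      by (simp add: dir_deriv_mult[OF coord(1) f] fun_apply)
    ultimately have "(real (d + j) + real CARD('n) - 1) * sphere_int (\<lambda>x. x $ m * (q * f) x) = 0"
      by (simp add: sphere_int_deriv_axis[OF forms_mult[OF coord(1) f]])
    moreover have "real (d + j) + real CARD('n) - 1 > 0"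
      using n by simp
    ultimately show ?case
      by (simp add: fun_apply mult.assoc)
  next
    case (lin d c p q)
    then show ?case
      using forms_integrable[OF forms_mult[OF lin(1) f]] forms_integrable[OF forms_mult[OF lin(2) f]]
      by (simp add: fun_apply times_fun_def distrib_right mult.assoc)
  qed
  then show ?case using less.prems by blast
qed

text \<open>The top-degree case of the Funk-Hecke formula. Integrating by parts in the direction x
  takes one factor off the power. The derivative of the power has too low a degree to pair with f;
  the derivative of f is harmonic of degree one less, so the induction hypothesis applies, and
  Euler's identity at x returns f x.\<close>

lemma harmonic_inner_power:
  assumes n: "2 \<le> CARD('n::finite)"
  shows "\<exists>c. \<forall>f \<in> harmonic_forms j. \<forall>x :: real ^ 'n. sphere_int (\<lambda>y. (x \<bullet> y) ^ j * f y) = c * f x"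
proof (induction j)
  case 0
  have "sphere_int f = measure (sphere_measure :: (real ^ 'n) measure) (sphere 0 1) * f x"
    if "f \<in> harmonic_forms 0" for f and x :: "real ^ 'n"
  proof -
    have "sphere_int f = sphere_int (\<lambda>y :: real ^ 'n. f x)"
      using that forms_0_const[of f] by (intro sphere_int_cong) (metis harmonic_forms_iff)
    then show ?thesis
      by (simp only: sphere_int_const mult.commute)
  qed
  then show ?case by (intro exI) auto
next
  case (Suc j)
  then obtain c where c: "\<And>f x. f \<in> harmonic_forms j \<Longrightarrow>
      sphere_int (\<lambda>y. ((x::real ^ 'n) \<bullet> y) ^ j * f y) = c * f x"
    by blast
  show ?case
  proof (intro exI ballI allI)
    fix f :: "real ^ 'n \<Rightarrow> real" and x :: "real ^ 'n"
    assume H: "f \<in> harmonic_forms (Suc j)"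
    then have f: "f \<in> forms (Suc j)" by (simp add: harmonic_forms_iff)
    let ?p = "\<lambda>y. (x \<bullet> y) ^ j"
    have p: "?p \<in> forms j" by (rule forms_inner_power)
    have S: "sphere_int (dir_deriv x (?p * f)) =
        (real (j + Suc j) + real CARD('n) - 1) * sphere_int (\<lambda>y. (x \<bullet> y) ^ Suc j * f y)"
      by (subst sphere_int_deriv[OF forms_mult[OF p f]]) (simp add: fun_apply mult.assoc)
    have "sphere_int (dir_deriv x (?p * f)) =
        sphere_int (\<lambda>y. ?p y * dir_deriv x f y) + sphere_int (\<lambda>y. dir_deriv x ?p y * f y)"
      using forms_integrable[OF forms_mult[OF p dir_deriv_forms[OF f]], unfolded times_fun_def]
        forms_integrable[OF forms_mult[OF dir_deriv_forms[OF p] f], unfolded times_fun_def]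
      by (simp add: dir_deriv_mult[OF p f] fun_apply)
    also have "sphere_int (\<lambda>y. dir_deriv x ?p y * f y) = 0"
      by (rule harmonic_orthogonal_lower[OF n H dir_deriv_forms[OF p]]) auto
    also have "sphere_int (\<lambda>y. ?p y * dir_deriv x f y) = c * dir_deriv x f x"
      using c dir_deriv_harmonic[OF H, of x] by simp
    also have "\<dots> = c * Suc j * f x"
      by (simp add: euler_forms[OF f])
    finally have "(real (j + Suc j) + real CARD('n) - 1) * sphere_int (\<lambda>y. (x \<bullet> y) ^ Suc j * f y)
       = c * Suc j * f x"
      unfolding S by (simp only: add_0_right mult.assoc)
    moreover have "real (j + Suc j) + real CARD('n) - 1 > 0"
      using n by simp
    ultimately show "sphere_int (\<lambda>y. (x \<bullet> y) ^ Suc j * f y)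
      = c * Suc j / (real (j + Suc j) + real CARD('n) - 1) * f x"
      by (simp add: field_simps)
  qed
qed

text \<open>The Gegenbauer recurrence made homogeneous in x: t becomes the inner product with y, and
  the term two degrees lower is multiplied by the squared norm. The calculus of forms then applies
  to what is a Gegenbauer polynomial on the sphere.\<close>

fun zonal :: "real \<Rightarrow> real ^ 'n::finite \<Rightarrow> nat \<Rightarrow> real ^ 'n \<Rightarrow> real"
  where
    "zonal \<alpha> y 0 = (\<lambda>x. 1)"
  | "zonal \<alpha> y (Suc 0) = (2 * \<alpha>) *\<^sub>R (\<lambda>x. x \<bullet> y)"
  | "zonal \<alpha> y (Suc (Suc m)) = (1 / real (Suc (Suc m))) *\<^sub>R
      ((2 * (real m + 1 + \<alpha>)) *\<^sub>R ((\<lambda>x. x \<bullet> y) * zonal \<alpha> y (Suc m))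
       - (real m + 2 * \<alpha>) *\<^sub>R ((\<lambda>x. (norm x)\<^sup>2) * zonal \<alpha> y m))"

lemma forms_inner_mult: "f \<in> forms d \<Longrightarrow> (\<lambda>x. x \<bullet> y) * f \<in> forms (Suc d)"
  using forms_mult[OF forms_inner] by fastforce

lemma forms_norm2_mult: "f \<in> forms d \<Longrightarrow> (\<lambda>x. (norm x)\<^sup>2) * f \<in> forms (Suc (Suc d))"
  using forms_mult[OF forms_norm2] by fastforce

lemma zonal_forms: "zonal \<alpha> y j \<in> forms j"
proof (induction \<alpha> y j rule: zonal.induct)
  case (2 \<alpha> y)
  show ?case using forms_scale[OF forms_inner] by simp
next
  case (3 \<alpha> y m)
  then show ?case
    by (simp only: zonal.simps) (intro forms_scale forms_diff forms_inner_mult forms_norm2_mult)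
qed (simp add: forms_const)

text \<open>The difference is turned into a sum with a negative multiple, the shape on which
  \<open>laplacian_lin\<close> and \<open>dir_deriv_add\<close> act.\<close>

lemma zonal_rec: "zonal \<alpha> y (Suc (Suc m)) = (1 / real (Suc (Suc m))) *\<^sub>R
      ((2 * (real m + 1 + \<alpha>)) *\<^sub>R ((\<lambda>x. x \<bullet> y) * zonal \<alpha> y (Suc m))
       + (- (real m + 2 * \<alpha>)) *\<^sub>R ((\<lambda>x. (norm x)\<^sup>2) * zonal \<alpha> y m))"
  by (simp only: zonal.simps scaleR_minus_left add_uminus_conv_diff)

lemma poly_gegenbauer_rec:
  "poly (gegenbauer \<alpha> (Suc (Suc m))) t = 1 / real (Suc (Suc m)) *
    (2 * (real m + 1 + \<alpha>) * (t * poly (gegenbauer \<alpha> (Suc m)) t) -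
     (real m + 2 * \<alpha>) * poly (gegenbauer \<alpha> m) t)"
proof -
  have "real (Suc (Suc m)) + \<alpha> - 1 = real m + 1 + \<alpha>"
    "real (Suc (Suc m)) + 2 * \<alpha> - 2 = real m + 2 * \<alpha>" by simp_all
  then show ?thesis
    by (simp only: gegenbauer.simps Let_def poly_smult poly_diff poly_mult poly_pCons poly_0) simp
qed

lemma zonal_sphere:
  "x \<in> sphere 0 1 \<Longrightarrow> zonal \<alpha> y j x = poly (gegenbauer \<alpha> j) (x \<bullet> y)"
proof (induction \<alpha> y j rule: zonal.induct)
  case (3 \<alpha> y m)
  then show ?case
    unfolding zonal_rec poly_gegenbauer_rec by (simp add: fun_apply algebra_simps del: of_nat_Suc)
qed (simp_all add: fun_apply)

text \<open>Needed for harmonicity: the derivative along the pole y is the mixed term in the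
  Laplacian of the inner product times a zonal function. The recurrence reaches two steps back,
  hence the strong induction.\<close>

lemma dir_deriv_zonal:
  assumes "norm y = 1"
  shows "dir_deriv y (zonal \<alpha> y (Suc m)) = (real m + 2 * \<alpha>) *\<^sub>R zonal \<alpha> y m"
proof (induction m rule: less_induct)
  case (less m)
  have yy: "y \<bullet> y = 1" using assms by (simp add: norm_eq_1)
  have inner1: "dir_deriv y ((\<lambda>x. x \<bullet> y) * f) = (\<lambda>x. x \<bullet> y) * dir_deriv y f + f" if "f \<in> forms d" for f d
    by (simp add: dir_deriv_mult[OF forms_inner that] dir_deriv_inner yy) (auto simp: fun_apply)
  have norm1: "dir_deriv y ((\<lambda>x. (norm x)\<^sup>2) * f) =
      (\<lambda>x. (norm x)\<^sup>2) * dir_deriv y f + 2 *\<^sub>R ((\<lambda>x. x \<bullet> y) * f)" if "f \<in> forms d" for f d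
    by (simp add: dir_deriv_mult[OF forms_norm2 that] dir_deriv_norm2) (auto simp: fun_apply)
  have step: "dir_deriv y (zonal \<alpha> y (Suc (Suc k))) = (1 / real (Suc (Suc k))) *\<^sub>R
      ((2 * (real k + 1 + \<alpha>)) *\<^sub>R ((\<lambda>x. x \<bullet> y) * dir_deriv y (zonal \<alpha> y (Suc k)) + zonal \<alpha> y (Suc k))
       - (real k + 2 * \<alpha>) *\<^sub>R ((\<lambda>x. (norm x)\<^sup>2) * dir_deriv y (zonal \<alpha> y k) + 2 *\<^sub>R ((\<lambda>x. x \<bullet> y) * zonal \<alpha> y k)))"
    for k
  proof -
    note F1 = forms_inner_mult[OF zonal_forms[of \<alpha> y "Suc k"], of y]
    note F2 = forms_norm2_mult[OF zonal_forms[of \<alpha> y k]]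
    have "dir_deriv y (zonal \<alpha> y (Suc (Suc k))) = (1 / real (Suc (Suc k))) *\<^sub>R
      dir_deriv y ((2 * (real k + 1 + \<alpha>)) *\<^sub>R ((\<lambda>x. x \<bullet> y) * zonal \<alpha> y (Suc k))
       + (- (real k + 2 * \<alpha>)) *\<^sub>R ((\<lambda>x. (norm x)\<^sup>2) * zonal \<alpha> y k))"
      unfolding zonal_rec by (rule dir_deriv_scale[OF forms_add[OF forms_scale[OF F1] forms_scale[OF F2]]])
    then show ?thesis
      by (simp only: dir_deriv_add[OF forms_scale[OF F1] forms_scale[OF F2]] dir_deriv_scale[OF F1]
          dir_deriv_scale[OF F2] inner1[OF zonal_forms] norm1[OF zonal_forms])
         (simp only: scaleR_minus_left add_uminus_conv_diff)
  qed
  consider "m = 0" | "m = Suc 0" | k where "m = Suc (Suc k)"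
    by (metis not0_implies_Suc)
  then show ?case
  proof cases
    case 1
    then show ?thesis
      by (simp add: dir_deriv_scale[OF forms_inner] dir_deriv_inner yy)
  next
    case 2
    show ?thesis
      unfolding 2 step
      by (rule ext)
        (simp add: dir_deriv_scale[OF forms_inner] dir_deriv_inner dir_deriv_const yy fun_apply algebra_simps)
  next
    case (3 k)
    have IH1: "dir_deriv y (zonal \<alpha> y (Suc (Suc k))) = (real (Suc k) + 2 * \<alpha>) *\<^sub>R zonal \<alpha> y (Suc k)"
      and IH2: "dir_deriv y (zonal \<alpha> y (Suc k)) = (real k + 2 * \<alpha>) *\<^sub>R zonal \<alpha> y k"
      using less.IH[of "Suc k"] less.IH[of k] 3 by auto
    show ?thesis
    proof
      fix x
      define t where "t = x \<bullet> y"
      define r where "r = (norm x)\<^sup>2"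
      define A where "A = zonal \<alpha> y (Suc k) x"
      define B where "B = zonal \<alpha> y k x"
      define C where "C = zonal \<alpha> y (Suc (Suc k)) x"
      define K where "K = real k"
      have rec: "(K + 2) * C = 2 * (K + 1 + \<alpha>) * (t * A) - (K + 2 * \<alpha>) * (r * B)"
      proof -
        have "real (Suc (Suc k)) * C = 2 * (K + 1 + \<alpha>) * (t * A) - (K + 2 * \<alpha>) * (r * B)"
          unfolding C_def zonal_rec
          by (simp add: fun_apply t_def r_def A_def B_def K_def algebra_simps del: of_nat_Suc)
        then show ?thesis by (simp add: K_def add.commute)
      qed
      have "(K + 3) * dir_deriv y (zonal \<alpha> y (Suc m)) x =
         2 * (K + 2 + \<alpha>) * (t * ((K + 1 + 2 * \<alpha>) * A) + C)
         - (K + 1 + 2 * \<alpha>) * (r * ((K + 2 * \<alpha>) * B) + 2 * (t * A))"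
      proof -
        have e: "real (Suc (Suc (Suc k))) = K + 3" "real (Suc k) = K + 1" "real k = K" "K + 3 \<noteq> 0"
          by (simp_all add: K_def add.commute add_nonneg_eq_0_iff)
        show ?thesis
          unfolding 3 step[of "Suc k"] IH1 IH2 e
          using e(4) by (simp add: fun_apply add.assoc del: zonal.simps flip: t_def r_def A_def B_def C_def)
      qed
      \<comment> \<open>The terms with the factor \<open>K + 1 + 2 * \<alpha>\<close> collect to the
        right side of \<open>rec\<close>; the scalars in front of C then combine to a multiple of
        \<open>K + 3\<close>.\<close>
      also have "\<dots> = (K + 1 + 2 * \<alpha>) * ((K + 2) * C) + 2 * (K + 2 + \<alpha>) * C"
        unfolding rec by (simp add: algebra_simps)
      also have "\<dots> = (K + 3) * ((K + 2 + 2 * \<alpha>) * C)"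
        by (simp add: algebra_simps)
      finally have "dir_deriv y (zonal \<alpha> y (Suc m)) x = (K + 2 + 2 * \<alpha>) * C"
        by (simp add: K_def)
      then show "dir_deriv y (zonal \<alpha> y (Suc m)) x = ((real m + 2 * \<alpha>) *\<^sub>R zonal \<alpha> y m) x"
        by (simp add: C_def K_def 3 fun_apply del: zonal.simps)
    qed
  qed
qed

text \<open>By \<open>dir_deriv_zonal\<close>, the Laplacian of the recurrence leaves a multiple of
  \<open>zonal \<alpha> y m\<close> containing the factor
  \<open>4 * (m + 1 + \<alpha>) - (2 * n + 4 * m)\<close>. It vanishes because n = 2 \<alpha> + 2;
  this is what ties \<alpha> to the dimension.\<close>

lemma zonal_harmonic:
  fixes y :: "real ^ 'n::finite"
  assumes "norm y = 1" and \<alpha>: "2 * \<alpha> = real CARD('n) - 2"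
  shows "zonal \<alpha> y j \<in> harmonic_forms j"
proof -
  have "laplacian (zonal \<alpha> y j) = 0"
    using assms
  proof (induction \<alpha> y j rule: zonal.induct)
    case (1 \<alpha> y)
    then show ?case by (simp add: laplacian_eq dir_deriv_const dir_deriv_0)
  next
    case (2 \<alpha> y)
    then show ?case
      by (simp add: laplacian_eq dir_deriv_scale[OF forms_inner] dir_deriv_inner
         dir_deriv_scale[OF forms_const] dir_deriv_const)
  next
    case (3 \<alpha> y m)
    note F1 = forms_inner_mult[OF zonal_forms[of \<alpha> y "Suc m"], of y]
    note F2 = forms_norm2_mult[OF zonal_forms[of \<alpha> y m]]
    have IH: "laplacian (zonal \<alpha> y (Suc m)) = 0" "laplacian (zonal \<alpha> y m) = 0"
      using 3 by auto
    have scale: "laplacian (c *\<^sub>R f) = c *\<^sub>R laplacian f" if "f \<in> forms d" for c d and f :: "real ^ 'n \<Rightarrow> real"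
      using laplacian_lin[OF that forms_0, of c] by (simp add: laplacian_eq dir_deriv_0)
    have "laplacian (zonal \<alpha> y (Suc (Suc m))) = (1 / real (Suc (Suc m))) *\<^sub>R
      ((2 * (real m + 1 + \<alpha>)) *\<^sub>R laplacian ((\<lambda>x. x \<bullet> y) * zonal \<alpha> y (Suc m))
       + (- (real m + 2 * \<alpha>)) *\<^sub>R laplacian ((\<lambda>x. (norm x)\<^sup>2) * zonal \<alpha> y m))"
      by (simp only: zonal_rec scale[OF forms_add[OF forms_scale[OF F1] forms_scale[OF F2]]]
        laplacian_lin[OF F1 forms_scale[OF F2]] scale[OF F2])
    also have "\<dots> = 0"
    proof
      fix x
      have "real CARD('n) = 2 * \<alpha> + 2" using 3 by simp
      then show "((1 / real (Suc (Suc m))) *\<^sub>R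
      ((2 * (real m + 1 + \<alpha>)) *\<^sub>R laplacian ((\<lambda>x. x \<bullet> y) * zonal \<alpha> y (Suc m))
       + (- (real m + 2 * \<alpha>)) *\<^sub>R laplacian ((\<lambda>x. (norm x)\<^sup>2) * zonal \<alpha> y m))) x = 0 x"
        by (simp add: laplacian_inner_mult[OF zonal_forms] laplacian_norm2_mult[OF zonal_forms] IH
            dir_deriv_zonal[OF 3(3)] fun_apply del: zonal.simps) (simp add: algebra_simps)
    qed
    finally show ?case .
  qed
  then show ?thesis by (simp add: harmonic_forms_iff zonal_forms)
qed

text \<open>At 1 the three-term recurrence collapses to two terms with factors that are positive for
  \<alpha> > 0. This yields the positivity that the subtraction in the recurrence hides.\<close>

lemma gegenbauer_rec_at_1:
  "real (Suc j) * poly (gegenbauer \<alpha> (Suc j)) 1 = (real j + 2 * \<alpha>) * poly (gegenbauer \<alpha> j) 1"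
proof (induction j)
  case (Suc j)
  have "real (Suc (Suc j)) * poly (gegenbauer \<alpha> (Suc (Suc j))) 1 =
     2 * (real j + 1 + \<alpha>) * poly (gegenbauer \<alpha> (Suc j)) 1 - (real j + 2 * \<alpha>) * poly (gegenbauer \<alpha> j) 1"
    unfolding poly_gegenbauer_rec by (simp add: mult.assoc del: of_nat_Suc)
  also have "\<dots> = (real (Suc j) + 2 * \<alpha>) * poly (gegenbauer \<alpha> (Suc j)) 1"
    unfolding Suc.IH[symmetric] by (simp add: algebra_simps)
  finally show ?case .
qed simp

lemma gegenbauer_at_1_pos:
  assumes "0 < \<alpha>"
  shows "0 < poly (gegenbauer \<alpha> j) 1"
proof (induction j)
  case (Suc j)
  then have "0 < real (Suc j) * poly (gegenbauer \<alpha> (Suc j)) 1"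
    unfolding gegenbauer_rec_at_1 using assms by (intro mult_pos_pos) auto
  then show ?case by (simp add: zero_less_mult_iff)
qed simp

text \<open>Positivity of the coefficient of degree j is carried along with the degree bound: the
  subtracted polynomial in the recurrence has lower degree and does not reach it.\<close>

lemma degree_gegenbauer:
  assumes "0 < \<alpha>"
  shows "degree (gegenbauer \<alpha> j) = j"
proof -
  have "degree (gegenbauer \<alpha> j) \<le> j \<and> 0 < coeff (gegenbauer \<alpha> j) j"
    using assms
  proof (induction \<alpha> j rule: gegenbauer.induct)
    case (3 \<alpha> m)
    let ?C = "gegenbauer \<alpha>"
    have IH: "degree (?C (Suc m)) \<le> Suc m" "0 < coeff (?C (Suc m)) (Suc m)" "degree (?C m) \<le> m"
      using 3 by auto
    have "coeff (?C m) (Suc (Suc m)) = 0"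
      using IH(3) by (intro coeff_eq_0) auto
    then have "coeff (?C (Suc (Suc m))) (Suc (Suc m)) =
       1 / real (Suc (Suc m)) * (2 * (real m + 1 + \<alpha>) * coeff (?C (Suc m)) (Suc m))"
      by (simp add: Let_def algebra_simps)
    also have "\<dots> > 0"
      using IH 3(3) by (intro mult_pos_pos) auto
    finally have "0 < coeff (?C (Suc (Suc m))) (Suc (Suc m))" .
    moreover have "degree (?C (Suc (Suc m))) \<le> Suc (Suc m)"
    proof (rule degree_le, intro allI impI)
      fix i assume i: "Suc (Suc m) < i"
      then obtain l where "i = Suc l" "Suc m < l" by (cases i) auto
      then show "coeff (?C (Suc (Suc m))) i = 0"
        using IH by (simp add: Let_def coeff_eq_0)
    qed
    ultimately show ?case by simp
  qed simp_all
  then show ?thesis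
    by (metis le_antisym le_degree less_irrefl)
qed

section \<open>Reproducing kernels and the harmonic decomposition\<close>

text \<open>A map such as \<open>averaging_op k h\<close> is known to be linear on forms only, while
  the linear algebra of the library speaks of linear maps on the whole space.\<close>

lemma linear_extension_on:
  fixes M :: "'a::real_vector \<Rightarrow> 'b::real_vector"
  assumes V: "subspace V"
    and M: "\<And>c u v. u \<in> V \<Longrightarrow> v \<in> V \<Longrightarrow> M (c *\<^sub>R u + v) = c *\<^sub>R M u + M v"
  obtains M' where "linear M'" "\<And>v. v \<in> V \<Longrightarrow> M' v = M v"
proof -
  obtain C where C: "C \<subseteq> V" "independent C" "V \<subseteq> span C"
    by (rule maximal_independent_subset)
  obtain M' where M': "linear M'" "\<And>v. v \<in> C \<Longrightarrow> M' v = M v"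
    using linear_independent_extend[OF C(2), of M] by metis
  have M0: "M 0 = 0"
    using M[of 0 0 1] subspace_0[OF V] by simp
  have "v \<in> V \<and> M' v = M v" if "v \<in> span C" for v
    using that
  proof (induction rule: span_induct_alt)
    case base
    then show ?case using M0 linear_0[OF M'(1)] subspace_0[OF V] by simp
  next
    case (step c x y)
    then show ?case
      using C(1) M' M[of x y c] V
      by (auto simp: linear_add[OF M'(1)] linear_scale[OF M'(1)] subspace_add subspace_scale)
  qed
  then show ?thesis
    using that M'(1) C(3) by blast
qed

text \<open>The image of a basis of V is independent and of the same size, so a vector of V outside
  its span would give an independent set that is too large.\<close>

lemma injective_endo_surjective:
  fixes M :: "'a::real_vector \<Rightarrow> 'a"
  assumes V: "subspace V" and B: "finite B" "V \<subseteq> span B"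
    and M: "\<And>c u v. u \<in> V \<Longrightarrow> v \<in> V \<Longrightarrow> M (c *\<^sub>R u + v) = c *\<^sub>R M u + M v"
    and inV: "\<And>v. v \<in> V \<Longrightarrow> M v \<in> V"
    and ker: "\<And>v. v \<in> V \<Longrightarrow> M v = 0 \<Longrightarrow> v = 0"
    and w: "w \<in> V"
  obtains v where "v \<in> V" "M v = w"
proof -
  obtain M' where M': "linear M'" "\<And>v. v \<in> V \<Longrightarrow> M' v = M v"
    using linear_extension_on[OF V M] by blast
  obtain C where C: "C \<subseteq> V" "independent C" "V \<subseteq> span C"
    by (rule maximal_independent_subset)
  have finC: "finite C"
    using independent_span_bound[OF B(1) C(2)] C(1) B(2) by blast
  have spanC: "span C = V"
    using C V by (simp add: span_minimal subset_antisym)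
  have inj: "inj_on M' (span C)"
    unfolding linear_inj_on_iff_eq_0[OF M'(1) subspace_span]
    using M'(2) ker by (simp add: spanC)
  have ind: "independent (M' ` C)"
    by (rule linear_independent_injective_image[OF M'(1) C(2) inj])
  have card: "card (M' ` C) = card C"
    using inj by (intro card_image) (meson inj_on_subset span_superset)
  have sub: "M' ` C \<subseteq> V"
    using C(1) M'(2) inV by auto
  have "w \<in> span (M' ` C)"
  proof (rule ccontr)
    assume "w \<notin> span (M' ` C)"
    moreover from this have "w \<notin> M' ` C"
      using subsetD[OF span_superset] by metis
    ultimately have "independent (insert w (M' ` C))" "card (insert w (M' ` C)) = Suc (card C)"
      using ind card finC by (simp_all add: independent_insert)
    then show False
      using independent_span_bound[OF finC, of "insert w (M' ` C)"] w sub spanC by auto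
  qed
  then obtain v where "v \<in> V" "M' v = w"
    unfolding linear_span_image[OF M'(1)] spanC by blast
  then show ?thesis
    using that M'(2) by metis
qed

section \<open>The L2 inner product on forms\<close>

definition sphere_ip :: "(real ^ 'n::finite \<Rightarrow> real) \<Rightarrow> (real ^ 'n \<Rightarrow> real) \<Rightarrow> real"
  where "sphere_ip f g = sphere_int (\<lambda>x. f x * g x)"

lemma sphere_ip_commute: "sphere_ip f g = sphere_ip g f"
  by (simp add: sphere_ip_def mult.commute)

lemma sphere_ip_integrable:
  "f \<in> forms a \<Longrightarrow> g \<in> forms b \<Longrightarrow> integrable sphere_measure (\<lambda>x. f x * g x)"
  using forms_integrable[OF forms_mult] by (simp add: times_fun_def)

lemma sphere_ip_lin:
  assumes "f \<in> forms a" "g \<in> forms b" "h \<in> forms d"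
  shows "sphere_ip (c *\<^sub>R f + g) h = c * sphere_ip f h + sphere_ip g h"
  using sphere_ip_integrable[OF assms(1,3)] sphere_ip_integrable[OF assms(2,3)]
  by (simp add: sphere_ip_def fun_apply distrib_right mult.assoc)

lemma sphere_ip_scale: "f \<in> forms a \<Longrightarrow> h \<in> forms d \<Longrightarrow> sphere_ip (c *\<^sub>R f) h = c * sphere_ip f h"
  using sphere_ip_lin[of f a 0 a h d c] by (simp add: forms_0) (simp add: sphere_ip_def fun_apply)

lemma sphere_ip_diff:
  assumes "f \<in> forms a" "g \<in> forms b" "h \<in> forms d"
  shows "sphere_ip (f - g) h = sphere_ip f h - sphere_ip g h"
  using sphere_ip_integrable[OF assms(1,3)] sphere_ip_integrable[OF assms(2,3)]
  by (simp add: sphere_ip_def fun_apply left_diff_distrib)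

lemma sphere_ip_sum:
  assumes "\<And>i. i \<in> I \<Longrightarrow> F i \<in> forms a" "h \<in> forms d"
  shows "sphere_ip (\<Sum>i\<in>I. F i) h = (\<Sum>i\<in>I. sphere_ip (F i) h)"
  using sphere_ip_integrable[OF assms]
  by (simp add: sphere_ip_def fun_apply sum_distrib_right)

lemma sphere_ip_self_nonneg: "0 \<le> sphere_ip f f"
  by (simp add: sphere_ip_def)

lemma sphere_ip_self_eq_0:
  assumes "f \<in> forms d" "sphere_ip f f = 0"
  shows "f = 0"
proof (rule forms_eq_0[OF assms(1)])
  fix x :: "real ^ 'a" assume "x \<in> sphere 0 1"
  moreover have "continuous_on (sphere 0 1) (\<lambda>x. f x * f x)"
    by (intro continuous_intros forms_continuous[OF assms(1)])
  ultimately show "f x = 0"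
    using sphere_int_nonneg_eq_0[of "\<lambda>x. f x * f x" x] assms(2) by (simp add: sphere_ip_def)
qed

text \<open>An orthonormal set of maximal size does the work of Gram-Schmidt: sizes are bounded by
  that of a spanning set, and if f differed from its expansion, the normalized remainder would
  enlarge the set.\<close>

lemma orthonormal_basis:
  fixes V :: "(real ^ 'n::finite \<Rightarrow> real) set"
  assumes V: "subspace V" "V \<subseteq> forms d"
  obtains B where "finite B" "B \<subseteq> V" "card B = dim V"
    "\<And>e. e \<in> B \<Longrightarrow> sphere_ip e e = 1"
    "\<And>f. f \<in> V \<Longrightarrow> f = (\<Sum>e\<in>B. sphere_ip f e *\<^sub>R e)"
proof -
  obtain S :: "(real ^ 'n \<Rightarrow> real) set" where S: "finite S" "forms d = span S" "S \<subseteq> forms d"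
    by (rule finite_span_forms)
  define orth where "orth B \<longleftrightarrow> finite B \<and> B \<subseteq> V \<and> (\<forall>e\<in>B. sphere_ip e e = 1) \<and>
    (\<forall>e\<in>B. \<forall>e'\<in>B. e \<noteq> e' \<longrightarrow> sphere_ip e e' = 0)" for B
  have ip_sum: "sphere_ip (\<Sum>v\<in>B. u v *\<^sub>R v) e = u e" if "orth B" "e \<in> B" for B u e
  proof -
    have "v \<in> forms d" if "v \<in> B" for v
      using that \<open>orth B\<close> V(2) by (auto simp: orth_def)
    then have "sphere_ip (\<Sum>v\<in>B. u v *\<^sub>R v) e = (\<Sum>v\<in>B. u v * sphere_ip v e)"
      using \<open>e \<in> B\<close> by (simp add: sphere_ip_sum[of _ _ d _ d] forms_scale sphere_ip_scale[of _ d _ d])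
    also have "\<dots> = (\<Sum>v\<in>B. if v = e then u e else 0)"
      using that by (intro sum.cong) (auto simp: orth_def)
    also have "\<dots> = u e"
      using that by (simp add: orth_def)
    finally show ?thesis .
  qed
  have ind: "independent B" if "orth B" for B
  proof (rule independent_if_scalars_zero)
    show "finite B" using that by (simp add: orth_def)
    fix u v assume "(\<Sum>v\<in>B. u v *\<^sub>R v) = 0" "v \<in> B"
    then show "u v = 0"
      using ip_sum[OF that, of v u] by (simp add: sphere_ip_def fun_apply)
  qed
  have bound: "card B \<le> card S" if "orth B" for B
    using independent_span_bound[OF S(1) ind[OF that]] that V(2) S(2) by (auto simp: orth_def)
  have "orth {}" by (simp add: orth_def)
  then obtain B where B: "orth B" and max: "\<And>B'. orth B' \<Longrightarrow> card B' \<le> card B"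
    using ex_has_greatest_nat[of orth "{}" card "Suc (card S)"] bound by (metis le_imp_less_Suc)
  have expand: "f = (\<Sum>e\<in>B. sphere_ip f e *\<^sub>R e)" if f: "f \<in> V" for f
  proof (rule ccontr)
    assume neq: "f \<noteq> (\<Sum>e\<in>B. sphere_ip f e *\<^sub>R e)"
    define p where "p = (\<Sum>e\<in>B. sphere_ip f e *\<^sub>R e)"
    define g where "g = f - p"
    have BV: "e \<in> V" if "e \<in> B" for e
      using that B by (auto simp: orth_def)
    have pV: "p \<in> V" unfolding p_def
      by (intro subspace_sum subspace_scale V BV)
    then have gV: "g \<in> V" unfolding g_def using f V subspace_diff by blast
    then have gf: "g \<in> forms d" using V by auto
    have ge: "sphere_ip g e = 0" if "e \<in> B" for e
      using sphere_ip_diff[of f d p d e d] ip_sum[OF B that, of "sphere_ip f"] f pV BV[OF that] V(2)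
      by (auto simp: g_def p_def)
    have "g \<noteq> 0" using neq by (simp add: g_def p_def)
    then have "sphere_ip g g \<noteq> 0"
      using sphere_ip_self_eq_0[OF gf] by metis
    then have gg: "sphere_ip g g > 0"
      using sphere_ip_self_nonneg[of g] by linarith
    define e' where "e' = (1 / sqrt (sphere_ip g g)) *\<^sub>R g"
    have e'V: "e' \<in> V" unfolding e'_def by (intro subspace_scale V gV)
    have e'e: "sphere_ip e' e = 0" if "e \<in> B" for e
      using ge[OF that] sphere_ip_scale[OF gf, of e d] BV[OF that] V(2) by (auto simp: e'_def)
    have "sphere_ip e' e' = (1 / sqrt (sphere_ip g g))\<^sup>2 * sphere_ip g g"
      by (simp add: e'_def sphere_ip_def fun_apply power2_eq_square mult.assoc mult.left_commute)
    then have e'1: "sphere_ip e' e' = 1"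
      using gg by (simp add: power_divide)
    then have "e' \<notin> B" using e'e[of e'] by force
    moreover have "orth (insert e' B)"
    proof -
      have ee': "sphere_ip e e' = 0" if "e \<in> B" for e
        using e'e[OF that] by (simp add: sphere_ip_commute)
      have oB: "finite B" "B \<subseteq> V" "\<And>e. e \<in> B \<Longrightarrow> sphere_ip e e = 1"
        "\<And>e1 e2. e1 \<in> B \<Longrightarrow> e2 \<in> B \<Longrightarrow> e1 \<noteq> e2 \<Longrightarrow> sphere_ip e1 e2 = 0"
        using B by (simp_all add: orth_def)
      show ?thesis
        unfolding orth_def
      proof (intro conjI ballI impI)
        show "finite (insert e' B)" "insert e' B \<subseteq> V"
          using oB e'V by simp_all
        show "sphere_ip e e = 1" if "e \<in> insert e' B" for e
          using that oB(3) e'1 by (elim insertE) simp_all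
        show "sphere_ip e1 e2 = 0" if "e1 \<in> insert e' B" "e2 \<in> insert e' B" "e1 \<noteq> e2" for e1 e2
          using that by (elim insertE) (simp_all add: oB(4) e'e ee')
      qed
    qed
    ultimately show False
      using max[of "insert e' B"] B by (simp add: orth_def)
  qed
  have "V \<subseteq> span B"
  proof
    fix f assume "f \<in> V"
    then have "f = (\<Sum>e\<in>B. sphere_ip f e *\<^sub>R e)" by (rule expand)
    also have "\<dots> \<in> span B" by (intro span_sum span_scale span_base)
    finally show "f \<in> span B" .
  qed
  then have "card B = dim V"
    using B ind[OF B] by (intro basis_card_eq_dim) (auto simp: orth_def)
  then show ?thesis
    using that[of B] B expand by (auto simp: orth_def)
qed

lemma harmonic_subset_forms: "harmonic_forms d \<subseteq> forms d"
  by (auto simp: harmonic_forms_iff)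

lemma sphere_int_poly_inner:
  assumes "g \<in> forms d"
  shows "sphere_int (\<lambda>y. poly p (x \<bullet> y) * g y) =
    (\<Sum>i\<le>degree p. coeff p i * sphere_int (\<lambda>y. (x \<bullet> y) ^ i * g y))"
  using sphere_ip_integrable[OF forms_inner_power assms]
  by (simp add: poly_altdef sum_distrib_right mult.assoc)

text \<open>For j < i every power in the kernel has too low a degree to pair with f; for i = j only
  the top power survives. For i < j the roles are exchanged: as a function of y the kernel is a
  zonal harmonic of degree j, and f is the form of lower degree.\<close>

lemma gegenbauer_kernel_scalar:
  assumes n: "3 \<le> CARD('n::finite)"
  obtains \<kappa> where "\<And>i f x. f \<in> harmonic_forms i \<Longrightarrow> x \<in> sphere 0 1 \<Longrightarrow>
    sphere_int (\<lambda>y :: real ^ 'n. poly (gegenbauer ((real CARD('n) - 2) / 2) j) (x \<bullet> y) * f y) =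
      (if i = j then \<kappa> * f x else 0)"
proof -
  define \<alpha> where "\<alpha> = (real CARD('n) - 2) / 2"
  have \<alpha>: "0 < \<alpha>" "2 * \<alpha> = real CARD('n) - 2"
    using n by (auto simp: \<alpha>_def)
  have n2: "2 \<le> CARD('n)" using n by simp
  obtain c where c: "\<And>f x. f \<in> harmonic_forms j \<Longrightarrow>
      sphere_int (\<lambda>y. ((x :: real ^ 'n) \<bullet> y) ^ j * f y) = c * f x"
    using harmonic_inner_power[OF n2] by blast
  let ?C = "gegenbauer \<alpha> j"
  have low: "sphere_int (\<lambda>y. (x \<bullet> y) ^ k * f y) = 0"
    if "f \<in> harmonic_forms i" "k < i" for f i k and x :: "real ^ 'n"
    using harmonic_orthogonal_lower[OF n2 that(1) forms_inner_power that(2)] .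
  have "sphere_int (\<lambda>y. poly ?C (x \<bullet> y) * f y) = (if i = j then coeff ?C j * c * f x else 0)"
    if f: "f \<in> harmonic_forms i" and x: "x \<in> sphere 0 1" for i f and x :: "real ^ 'n"
  proof -
    have ff: "f \<in> forms i" using f by (simp add: harmonic_forms_iff)
    have eq: "sphere_int (\<lambda>y. poly ?C (x \<bullet> y) * f y) =
        (\<Sum>k\<le>j. coeff ?C k * sphere_int (\<lambda>y. (x \<bullet> y) ^ k * f y))"
      using sphere_int_poly_inner[OF ff, of ?C x] by (simp add: degree_gegenbauer[OF \<alpha>(1)])
    consider "j < i" | "i = j" | "i < j" by linarith
    then show ?thesis
    proof cases
      case 1
      then show ?thesis unfolding eq using low[OF f] by simp
    next
      case 2
      have "(\<Sum>k\<le>j. coeff ?C k * sphere_int (\<lambda>y. (x \<bullet> y) ^ k * f y)) = 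
          (\<Sum>k\<in>{j}. coeff ?C k * sphere_int (\<lambda>y. (x \<bullet> y) ^ k * f y))"
        using low[OF f] 2 by (intro sum.mono_neutral_right) auto
      then show ?thesis unfolding eq using c f 2 by simp
    next
      case 3
      have "sphere_int (\<lambda>y. poly ?C (x \<bullet> y) * f y) = sphere_int (\<lambda>y. f y * zonal \<alpha> x j y)"
        using x by (intro sphere_int_cong) (simp add: zonal_sphere inner_commute)
      also have "\<dots> = 0"
        using x by (intro harmonic_orthogonal_lower[OF n2 zonal_harmonic[OF _ \<alpha>(2)] ff 3]) simp
      finally show ?thesis using 3 by simp
    qed
  qed
  then show ?thesis
    using that[of "coeff ?C j * c"] by (simp only: \<alpha>_def)
qed

lemma sphere_nonempty: obtains e :: "real ^ 'n::finite" where "e \<in> sphere 0 1"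
  using norm_axis_1 by (metis mem_sphere_0)

text \<open>The constant in front of the Gegenbauer polynomial is found by comparing traces: the kernel is
  constant on the diagonal.\<close>

lemma normalized_gegenbauer_props:
  fixes x :: "real ^ 'n::finite"
  assumes n: "3 \<le> CARD('n)"
  shows normalized_gegenbauer_reproducing:
      "f \<in> harmonic_forms i \<Longrightarrow> x \<in> sphere 0 1 \<Longrightarrow>
        sphere_int (\<lambda>y. poly (normalized_gegenbauer TYPE('n) j) (x \<bullet> y) * f y) =
          (if i = j then f x else 0)"
    and normalized_gegenbauer_at_1: "poly (normalized_gegenbauer TYPE('n) j) 1 =
        real (dim (harmonic_forms j :: (real ^ 'n \<Rightarrow> real) set)) /
          measure (sphere_measure :: (real ^ 'n) measure) (sphere 0 1)"
    and degree_normalized_gegenbauer: "degree (normalized_gegenbauer TYPE('n) j) = j"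
    and normalized_gegenbauer_nonzero: "normalized_gegenbauer TYPE('n) j \<noteq> 0"
proof -
  define \<alpha> where "\<alpha> = (real CARD('n) - 2) / 2"
  have \<alpha>: "0 < \<alpha>" "2 * \<alpha> = real CARD('n) - 2"
    using n by (auto simp: \<alpha>_def)
  let ?C = "gegenbauer \<alpha> j"
  let ?\<mu> = "measure (sphere_measure :: (real ^ 'n) measure) (sphere 0 1)"
  let ?N = "real (dim (harmonic_forms j :: (real ^ 'n \<Rightarrow> real) set))"
  obtain \<kappa> where \<kappa>: "\<And>i f x. f \<in> harmonic_forms i \<Longrightarrow> x \<in> sphere 0 1 \<Longrightarrow>
    sphere_int (\<lambda>y :: real ^ 'n. poly ?C (x \<bullet> y) * f y) = (if i = j then \<kappa> * f x else 0)"
    using gegenbauer_kernel_scalar[OF n, where j = j] unfolding \<alpha>_def by blast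
  obtain B where B: "finite B" "B \<subseteq> (harmonic_forms j :: (real ^ 'n \<Rightarrow> real) set)"
    "card B = dim (harmonic_forms j :: (real ^ 'n \<Rightarrow> real) set)"
    "\<And>e. e \<in> B \<Longrightarrow> sphere_ip e e = 1"
    "\<And>f. f \<in> harmonic_forms j \<Longrightarrow> f = (\<Sum>e\<in>B. sphere_ip f e *\<^sub>R e)"
  proof (rule orthonormal_basis[OF subspace_harmonic harmonic_subset_forms[of j]])
  qed (rule that)
  \<comment> \<open>The zonal function with pole x is expanded in the orthonormal basis; the kernel
    identity supplies the coefficients, and evaluation at x itself produces the sum of
    squares.\<close>
  have diag: "poly ?C 1 = \<kappa> * (\<Sum>e\<in>B. e x * e x)" if x: "x \<in> sphere 0 1" for x
  proof -
    have z: "zonal \<alpha> x j \<in> harmonic_forms j"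
      using x by (intro zonal_harmonic \<alpha>) simp
    have "sphere_ip (zonal \<alpha> x j) e = \<kappa> * e x" if "e \<in> B" for e
    proof -
      have "sphere_ip (zonal \<alpha> x j) e = sphere_int (\<lambda>y. poly ?C (x \<bullet> y) * e y)"
        unfolding sphere_ip_def using x by (intro sphere_int_cong) (simp add: zonal_sphere inner_commute)
      then show ?thesis
        using \<kappa>[of e j x] B(2) that x by auto
    qed
    then have "zonal \<alpha> x j x = (\<Sum>e\<in>B. (\<kappa> *\<^sub>R e x *\<^sub>R e) x)"
      using arg_cong[OF B(5)[OF z], of "\<lambda>f. f x"] by (simp add: fun_apply)
    then show ?thesis
      using x by (simp add: zonal_sphere fun_apply sum_distrib_left norm_eq_1 mult.assoc)
  qed
  have "poly ?C 1 * ?\<mu> = sphere_int (\<lambda>x :: real ^ 'n. poly ?C 1)"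
    by (rule sphere_int_const[symmetric])
  also have "\<dots> = sphere_int (\<lambda>x. \<kappa> * (\<Sum>e\<in>B. e x * e x))"
    by (rule sphere_int_cong) (rule diag)
  also have "\<dots> = \<kappa> * (\<Sum>e\<in>B. sphere_ip e e)"
  proof -
    have "e \<in> forms j" if "e \<in> B" for e
      using that B(2) harmonic_subset_forms by blast
    then have "integrable sphere_measure (\<lambda>x. e x * e x)" if "e \<in> B" for e
      using that by (intro sphere_ip_integrable)
    then show ?thesis
      by (subst sphere_int_scale, subst Bochner_Integration.integral_sum) (simp_all add: sphere_ip_def)
  qed
  also have "\<dots> = \<kappa> * ?N"
    using B(3,4) by simp
  finally have trace: "poly ?C 1 * ?\<mu> = \<kappa> * ?N" .
  have pos: "poly ?C 1 > 0" "?\<mu> > 0"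
    using gegenbauer_at_1_pos[OF \<alpha>(1)] measure_sphere_pos by auto
  \<comment> \<open>The trace identity also shows that \<open>harmonic_forms j\<close> is not zero,
    so the normalizing constant does not vanish.\<close>
  then have "\<kappa> * ?N > 0"
    unfolding trace[symmetric] by simp
  then have N: "?N \<noteq> 0" by (metis mult_zero_right less_irrefl)
  define c where "c = ?N / (?\<mu> * poly ?C 1)"
  have g: "normalized_gegenbauer TYPE('n) j = smult c ?C"
    by (simp add: normalized_gegenbauer_def \<alpha>_def Let_def c_def)
  have "c \<noteq> 0" using pos N by (simp add: c_def)
  have unit: "c * \<kappa> = 1"
  proof -
    have "c * \<kappa> = (\<kappa> * ?N) / (poly ?C 1 * ?\<mu>)"
      by (simp only: c_def times_divide_eq_left times_divide_eq_right mult.commute)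
    also have "\<dots> = 1"
      unfolding trace[symmetric] using pos by simp
    finally show ?thesis .
  qed
  show "sphere_int (\<lambda>y. poly (normalized_gegenbauer TYPE('n) j) (x \<bullet> y) * f y) =
      (if i = j then f x else 0)"
    if "f \<in> harmonic_forms i" "x \<in> sphere 0 1"
  proof -
    have "sphere_int (\<lambda>y. poly (normalized_gegenbauer TYPE('n) j) (x \<bullet> y) * f y) =
        c * sphere_int (\<lambda>y. poly ?C (x \<bullet> y) * f y)"
      unfolding g poly_smult mult.assoc by (rule sphere_int_scale)
    also have "\<dots> = c * (if i = j then \<kappa> * f x else 0)"
      by (simp only: \<kappa>[OF that])
    also have "\<dots> = (if i = j then (c * \<kappa>) * f x else 0)"
      by simp
    finally show ?thesis by (simp only: unit mult_1_left)
  qed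
  show "poly (normalized_gegenbauer TYPE('n) j) 1 = ?N / ?\<mu>"
    using pos by (simp add: g c_def)
  show "degree (normalized_gegenbauer TYPE('n) j) = j"
    using \<open>c \<noteq> 0\<close> by (simp add: g degree_gegenbauer[OF \<alpha>(1)])
  show "normalized_gegenbauer TYPE('n) j \<noteq> 0"
    using \<open>c \<noteq> 0\<close> pos by (auto simp: g)
qed

lemma sphere_ip_cauchy_schwarz:
  assumes "f \<in> forms d" "g \<in> forms d"
  shows "(sphere_ip f g)\<^sup>2 \<le> sphere_ip f f * sphere_ip g g"
proof (cases "sphere_ip g g = 0")
  case True
  then have "g = 0" by (rule sphere_ip_self_eq_0[OF assms(2)])
  then show ?thesis by (simp add: sphere_ip_def fun_apply)
next
  case False
  then have pos: "sphere_ip g g > 0"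
    using sphere_ip_self_nonneg[of g] by linarith
  define t where "t = sphere_ip f g / sphere_ip g g"
  define e where "e = (- t) *\<^sub>R g + f"
  have e: "e \<in> forms d" unfolding e_def by (intro forms_add forms_scale assms)
  have "sphere_ip e h = sphere_ip f h - t * sphere_ip g h" if "h \<in> forms d" for h
    using sphere_ip_lin[OF assms(2,1) that, of "- t"] by (simp add: e_def)
  then have "sphere_ip e e = sphere_ip f f - t * sphere_ip g f - t * (sphere_ip f g - t * sphere_ip g g)"
    using e assms sphere_ip_commute[of _ e] by metis
  then have "0 \<le> sphere_ip f f - t * sphere_ip f g - t * (sphere_ip f g - t * sphere_ip g g)"
    using sphere_ip_self_nonneg[of e] by (simp add: sphere_ip_commute)
  also have "t * sphere_ip g g = sphere_ip f g"
    using pos by (simp add: t_def)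
  finally have "t * sphere_ip f g \<le> sphere_ip f f" by simp
  then show ?thesis
    using pos by (simp add: t_def field_simps power2_eq_square)
qed

text \<open>\<open>\<zeta>\<close> represents evaluation at x on \<open>harmonic_forms j\<close>.
  Its squared norm is therefore its own value at x, the normalized Gegenbauer polynomial at
  1.\<close>

lemma harmonic_evaluation_bound:
  fixes f :: "real ^ 'n::finite \<Rightarrow> real"
  assumes n: "3 \<le> CARD('n)" and f: "f \<in> harmonic_forms j" and x: "x \<in> sphere 0 1"
  shows "(f x)\<^sup>2 \<le> real (dim (harmonic_forms j :: (real ^ 'n \<Rightarrow> real) set)) /
    measure (sphere_measure :: (real ^ 'n) measure) (sphere 0 1) * sphere_ip f f"
proof -
  define \<alpha> where "\<alpha> = (real CARD('n) - 2) / 2"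
  let ?g = "normalized_gegenbauer TYPE('n) j"
  obtain c where c: "?g = smult c (gegenbauer \<alpha> j)"
    by (simp add: normalized_gegenbauer_def Let_def \<alpha>_def)
  define \<zeta> where "\<zeta> = c *\<^sub>R zonal \<alpha> x j"
  have \<zeta>: "\<zeta> \<in> harmonic_forms j"
    unfolding \<zeta>_def using x
    by (intro subspace_scale[OF subspace_harmonic] zonal_harmonic) (simp_all add: \<alpha>_def)
  have \<zeta>_sphere: "\<zeta> y = poly ?g (x \<bullet> y)" if "y \<in> sphere 0 1" for y
    using that by (simp add: \<zeta>_def c fun_apply zonal_sphere inner_commute)
  have repr: "sphere_ip \<zeta> h = h x" if "h \<in> harmonic_forms j" for h
  proof -
    have "sphere_ip \<zeta> h = sphere_int (\<lambda>y. poly ?g (x \<bullet> y) * h y)"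
      unfolding sphere_ip_def by (rule sphere_int_cong) (simp only: \<zeta>_sphere)
    then show ?thesis
      by (simp add: normalized_gegenbauer_reproducing[OF n that x])
  qed
  have "sphere_ip \<zeta> \<zeta> = poly ?g 1"
    using repr[OF \<zeta>] \<zeta>_sphere[OF x] x by (simp add: norm_eq_1)
  moreover have "(sphere_ip \<zeta> f)\<^sup>2 \<le> sphere_ip \<zeta> \<zeta> * sphere_ip f f"
    using \<zeta> f by (intro sphere_ip_cauchy_schwarz[of _ j]) (simp_all add: harmonic_forms_iff)
  ultimately show ?thesis
    by (simp add: repr[OF f] normalized_gegenbauer_at_1[OF n])
qed

text \<open>The map taking q to the Laplacian of the squared norm times q is an endomorphism of
  \<open>forms d\<close>, so it suffices that it is injective. If v is in its kernel, the squared
  norm times v is harmonic of degree d + 2, hence orthogonal to v; on the sphere this says that v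
  has L2 norm 0.\<close>

lemma harmonic_decomposition_step:
  fixes f :: "real ^ 'n::finite \<Rightarrow> real"
  assumes n: "2 \<le> CARD('n)" and f: "f \<in> forms (Suc (Suc d))"
  obtains q where "q \<in> forms d" "f - (\<lambda>x. (norm x)\<^sup>2) * q \<in> harmonic_forms (Suc (Suc d))"
proof -
  let ?r = "\<lambda>x :: real ^ 'n. (norm x)\<^sup>2"
  obtain S :: "(real ^ 'n \<Rightarrow> real) set" where S: "finite S" "forms d = span S" "S \<subseteq> forms d"
    by (rule finite_span_forms)
  obtain q where q: "q \<in> forms d" "laplacian (?r * q) = laplacian f"
  proof (rule injective_endo_surjective[of "forms d" S "\<lambda>q. laplacian (?r * q)" "laplacian f"])
    fix c and u v :: "real ^ 'n \<Rightarrow> real" assume uv: "u \<in> forms d" "v \<in> forms d"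
    have "?r * (c *\<^sub>R u + v) = c *\<^sub>R (?r * u) + ?r * v"
      by (auto simp: fun_apply algebra_simps)
    then show "laplacian (?r * (c *\<^sub>R u + v)) = c *\<^sub>R laplacian (?r * u) + laplacian (?r * v)"
      using laplacian_lin[OF forms_norm2_mult[OF uv(1)] forms_norm2_mult[OF uv(2)]] by simp
  next
    fix v :: "real ^ 'n \<Rightarrow> real" assume v: "v \<in> forms d"
    show "laplacian (?r * v) \<in> forms d"
      using laplacian_forms[OF forms_norm2_mult[OF v]] by simp
    assume "laplacian (?r * v) = 0"
    then have "?r * v \<in> harmonic_forms (Suc (Suc d))"
      using forms_norm2_mult[OF v] by (simp add: harmonic_forms_iff)
    from harmonic_orthogonal_lower[OF n this v]
    have "sphere_int (\<lambda>x. v x * (?r * v) x) = 0" by simp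
    moreover have "sphere_int (\<lambda>x. v x * (?r * v) x) = sphere_ip v v"
      unfolding sphere_ip_def by (rule sphere_int_cong) (simp add: fun_apply)
    ultimately show "v = 0"
      using sphere_ip_self_eq_0[OF v] by simp
  qed (use S laplacian_forms[OF f] subspace_forms in auto)
  have "f - ?r * q = (- 1) *\<^sub>R (?r * q) + f" by simp
  then have "laplacian (f - ?r * q) = 0"
    using laplacian_lin[OF forms_norm2_mult[OF q(1)] f, of "-1"] q(2) by simp
  then show ?thesis
    using that[OF q(1)] forms_diff[OF f forms_norm2_mult[OF q(1)]] by (simp add: harmonic_forms_iff)
qed

lemma harmonic_decomposition:
  fixes f :: "real ^ 'n::finite \<Rightarrow> real"
  assumes n: "2 \<le> CARD('n)" and f: "f \<in> forms (2 * k)"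
  obtains F where "\<And>i. i \<le> k \<Longrightarrow> F i \<in> harmonic_forms (2 * i)"
    "f = (\<Sum>i\<le>k. (\<lambda>x. norm x ^ (2 * (k - i))) * F i)"
proof -
  have "\<exists>F. (\<forall>i\<le>k. F i \<in> harmonic_forms (2 * i)) \<and> f = (\<Sum>i\<le>k. (\<lambda>x. norm x ^ (2 * (k - i))) * F i)"
    using f
  proof (induction k arbitrary: f)
    case 0
    then have "f \<in> harmonic_forms 0"
      by (simp add: harmonic_forms_iff laplacian_eq dir_deriv_forms_0 dir_deriv_0)
    then show ?case
      by (intro exI[of _ "\<lambda>_. f"]) (auto simp: fun_apply)
  next
    case (Suc k)
    then obtain q where q: "q \<in> forms (2 * k)"
        and h: "f - (\<lambda>x. (norm x)\<^sup>2) * q \<in> harmonic_forms (Suc (Suc (2 * k)))"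
      using harmonic_decomposition_step[OF n, of f "2 * k"] by auto
    from Suc.IH[OF q] obtain F where F: "\<And>i. i \<le> k \<Longrightarrow> F i \<in> harmonic_forms (2 * i)"
        "q = (\<Sum>i\<le>k. (\<lambda>x. norm x ^ (2 * (k - i))) * F i)" by auto
    define F' where "F' = F(Suc k := f - (\<lambda>x. (norm x)\<^sup>2) * q)"
    have "f x = (\<Sum>i\<le>Suc k. (\<lambda>x. norm x ^ (2 * (Suc k - i))) * F' i) x" for x
    proof -
      have "(\<Sum>i\<le>k. norm x ^ (2 * (Suc k - i)) * F' i x) =
          (\<Sum>i\<le>k. (norm x)\<^sup>2 * (norm x ^ (2 * (k - i)) * F i x))"
      proof (rule sum.cong)
        fix i assume "i \<in> {..k}"
        then have "2 * (Suc k - i) = 2 + 2 * (k - i)" "F' i = F i" by (auto simp: F'_def)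
        then show "norm x ^ (2 * (Suc k - i)) * F' i x = (norm x)\<^sup>2 * (norm x ^ (2 * (k - i)) * F i x)"
          by (simp only: power_add mult.assoc)
      qed simp
      also have "\<dots> = (norm x)\<^sup>2 * q x"
        by (simp add: F(2) fun_apply sum_distrib_left)
      finally show ?thesis
        by (simp add: fun_apply F'_def)
    qed
    moreover have "\<forall>i\<le>Suc k. F' i \<in> harmonic_forms (2 * i)"
      using F(1) h by (auto simp: F'_def le_Suc_eq)
    ultimately show ?case by blast
  qed
  then show ?thesis using that by blast
qed

section \<open>Averaging operators\<close>

lemma poly_basis_expansion:
  fixes g :: "nat \<Rightarrow> 'a::field poly"
  assumes deg: "\<And>j. degree (g j) = j" and nz: "\<And>j. g j \<noteq> 0" and h: "degree h \<le> n"
  obtains l where "h = (\<Sum>j\<le>n. smult (l j) (g j))"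
proof -
  have "\<exists>l. h = (\<Sum>j\<le>n. smult (l j) (g j))"
    using h
  proof (induction n arbitrary: h)
    case 0
    have c: "h = [:coeff h 0:]" "g 0 = [:coeff (g 0) 0:]"
      using 0 deg[of 0] by (metis degree_0_id le_zero_eq)+
    then have "coeff (g 0) 0 \<noteq> 0" using nz[of 0] by auto
    then have "h = smult (coeff h 0 / coeff (g 0) 0) (g 0)"
      by (subst c(1), subst (2) c(2)) simp
    then show ?case by (intro exI[of _ "\<lambda>_. coeff h 0 / coeff (g 0) 0"]) simp
  next
    case (Suc n)
    define c where "c = coeff h (Suc n) / coeff (g (Suc n)) (Suc n)"
    have lc: "coeff (g (Suc n)) (Suc n) \<noteq> 0"
      using nz[of "Suc n"] deg[of "Suc n"] by (metis leading_coeff_neq_0)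
    have "degree (h - smult c (g (Suc n))) \<le> n"
    proof (rule degree_le, intro allI impI)
      fix i assume "n < i"
      then consider "i = Suc n" | "Suc n < i" by linarith
      then show "coeff (h - smult c (g (Suc n))) i = 0"
      proof cases
        case 2
        then show ?thesis using Suc.prems deg[of "Suc n"] by (simp add: coeff_eq_0)
      qed (simp add: c_def lc)
    qed
    then obtain l where l: "h - smult c (g (Suc n)) = (\<Sum>j\<le>n. smult (l j) (g j))"
      using Suc.IH by blast
    have "h = (\<Sum>j\<le>Suc n. smult ((l(Suc n := c)) j) (g j))"
      using l by (simp add: algebra_simps)
    then show ?case by blast
  qed
  then show ?thesis using that by blast
qed

lemma poly_basis_independent:
  fixes g :: "nat \<Rightarrow> 'a::field poly"
  assumes deg: "\<And>j. degree (g j) = j" and nz: "\<And>j. g j \<noteq> 0"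
    and 0: "(\<Sum>j\<le>n. smult (l j) (g j)) = 0" and "j \<le> n"
  shows "l j = 0"
  using 0 \<open>j \<le> n\<close>
proof (induction n)
  case 0
  then show ?case using nz[of 0] by simp
next
  case (Suc n)
  have "coeff (\<Sum>j\<le>n. smult (l j) (g j)) (Suc n) = 0"
    using deg by (auto simp: coeff_sum coeff_eq_0 intro!: sum.neutral)
  then have "l (Suc n) * coeff (g (Suc n)) (Suc n) = 0"
    using arg_cong[OF Suc.prems(1), of "\<lambda>p. coeff p (Suc n)"] by simp
  moreover have "coeff (g (Suc n)) (Suc n) \<noteq> 0"
    using nz[of "Suc n"] deg[of "Suc n"] by (metis leading_coeff_neq_0)
  ultimately have "l (Suc n) = 0" by simp
  then show ?case
    using Suc by (cases "j = Suc n") auto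
qed

lemma gegenbauer_coeff_expansion:
  assumes n: "3 \<le> CARD('n::finite)"
  shows "h = (\<Sum>j\<le>degree h. smult (gegenbauer_coeff TYPE('n) h j) (normalized_gegenbauer TYPE('n) j))"
    and "\<And>j. degree h < j \<Longrightarrow> gegenbauer_coeff TYPE('n) h j = 0"
proof -
  let ?g = "normalized_gegenbauer TYPE('n)"
  let ?P = "\<lambda>l. h = (\<Sum>j\<le>degree h. smult (l j) (?g j)) \<and> (\<forall>j>degree h. l j = 0)"
  note g = degree_normalized_gegenbauer[OF n] normalized_gegenbauer_nonzero[OF n]
  obtain l where l: "h = (\<Sum>j\<le>degree h. smult (l j) (?g j))"
    using poly_basis_expansion[of ?g h "degree h"] g by blast
  \<comment> \<open>The sum constrains only the coefficients up to the degree; beyond it they are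
    set to 0 to meet the second condition in \<open>gegenbauer_coeff\<close>.\<close>
  have "(\<Sum>j\<le>degree h. smult (if j \<le> degree h then l j else 0) (?g j)) = (\<Sum>j\<le>degree h. smult (l j) (?g j))"
    by (rule sum.cong) auto
  then have ex: "?P (\<lambda>j. if j \<le> degree h then l j else 0)"
    using l by simp
  have "l1 = l2" if "?P l1" "?P l2" for l1 l2
  proof
    fix j
    have "(\<Sum>j\<le>degree h. smult (l1 j) (?g j)) = (\<Sum>j\<le>degree h. smult (l2 j) (?g j))"
      using that by metis
    then have "(\<Sum>j\<le>degree h. smult (l1 j - l2 j) (?g j)) = 0"
      by (simp add: smult_diff_left sum_subtractf)
    from poly_basis_independent[OF g this] show "l1 j = l2 j"
      using that by (cases "j \<le> degree h") auto
  qed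
  note uniq = this
  have "\<exists>!l. ?P l"
    by (rule ex1I[of ?P, OF ex]) (rule uniq[OF _ ex])
  then have "?P (gegenbauer_coeff TYPE('n) h)"
    unfolding gegenbauer_coeff_def by (rule theI')
  then show "h = (\<Sum>j\<le>degree h. smult (gegenbauer_coeff TYPE('n) h j) (?g j))"
    "\<And>j. degree h < j \<Longrightarrow> gegenbauer_coeff TYPE('n) h j = 0" by blast+
qed

text \<open>The Funk-Hecke formula: the reproducing property is applied to each term of the
  Gegenbauer expansion, and at most one term survives.\<close>

lemma poly_kernel_eigen:
  fixes x :: "real ^ 'n::finite"
  assumes n: "3 \<le> CARD('n)" and f: "f \<in> harmonic_forms i" and x: "x \<in> sphere 0 1"
  shows "sphere_int (\<lambda>y. poly h (x \<bullet> y) * f y) = gegenbauer_coeff TYPE('n) h i * f x"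
proof -
  let ?g = "normalized_gegenbauer TYPE('n)" and ?l = "gegenbauer_coeff TYPE('n) h"
  have ff: "f \<in> forms i" using f by (simp add: harmonic_forms_iff)
  have int: "integrable sphere_measure (\<lambda>y. poly p (x \<bullet> y) * f y)" for p
    by (intro continuous_integrable_sphere continuous_intros forms_continuous[OF ff])
  have "sphere_int (\<lambda>y. poly h (x \<bullet> y) * f y) =
     sphere_int (\<lambda>y. poly (\<Sum>j\<le>degree h. smult (?l j) (?g j)) (x \<bullet> y) * f y)"
    using gegenbauer_coeff_expansion(1)[OF n] by metis
  also have "\<dots> = (\<Sum>j\<le>degree h. ?l j * sphere_int (\<lambda>y. poly (?g j) (x \<bullet> y) * f y))"
    using int by (simp add: poly_sum sum_distrib_right mult.assoc)
  also have "\<dots> = (\<Sum>j\<le>degree h. if i = j then ?l i * f x else 0)"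
    by (rule sum.cong) (auto simp: normalized_gegenbauer_reproducing[OF n f x])
  also have "\<dots> = ?l i * f x"
    using gegenbauer_coeff_expansion(2)[OF n, of h i] by (cases "i \<le> degree h") auto
  finally show ?thesis .
qed

text \<open>Only even coefficients enter the averaging operator. Written as a mean of two values of
  h, the even part visibly inherits nonnegativity on [-1,1].\<close>

lemma even_part_poly:
  "(\<Sum>j\<le>degree h. coeff h (2 * j) * u ^ (2 * j)) = (poly h u + poly h (- u)) / 2" for u :: real
proof -
  have split: "(\<Sum>i<2 * m. a i) = (\<Sum>j<m. a (2 * j) + a (Suc (2 * j)))" for a :: "nat \<Rightarrow> real" and m
    by (induction m) auto
  \<comment> \<open>Padding with zero coefficients to an even number of terms lets even and odd
    exponents be paired.\<close>
  have p: "poly h v = (\<Sum>i<2 * Suc (degree h). coeff h i * v ^ i)" for v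
    unfolding poly_altdef by (rule sum.mono_neutral_left) (auto simp: coeff_eq_0)
  have "poly h u + poly h (- u) = (\<Sum>j<Suc (degree h). 2 * (coeff h (2 * j) * u ^ (2 * j)))"
    unfolding p split sum.distrib[symmetric] by (rule sum.cong) auto
  then show ?thesis
    by (simp add: sum_distrib_left[symmetric] lessThan_Suc_atMost)
qed

section \<open>Spectrum and positivity of the averaging operators\<close>

lemma averaging_op_sphere:
  fixes f :: "real ^ 'n::finite \<Rightarrow> real"
  assumes f: "f \<in> forms d" and x: "x \<in> sphere 0 1"
  shows "averaging_op k h f x = sphere_int (\<lambda>y. (poly h (x \<bullet> y) + poly h (- (x \<bullet> y))) / 2 * f y)"
proof -
  have "averaging_op k h f x = (\<Sum>j\<le>degree h. coeff h (2 * j) * sphere_int (\<lambda>y. (x \<bullet> y) ^ (2 * j) * f y))"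
    using x by (simp add: averaging_op_def)
  also have "\<dots> = sphere_int (\<lambda>y. (\<Sum>j\<le>degree h. coeff h (2 * j) * (x \<bullet> y) ^ (2 * j)) * f y)"
    using sphere_ip_integrable[OF forms_inner_power f]
    by (simp add: sum_distrib_right mult.assoc)
  finally show ?thesis by (simp only: even_part_poly)
qed

text \<open>The power of the norm compensates the 2j factors of x inside the integral. At the origin
  the summand j = 0 vanishes because k is positive, the others because the inner product is
  0.\<close>

lemma averaging_op_homogeneous:
  fixes x :: "real ^ 'n::finite"
  assumes k: "1 \<le> k"
  shows "averaging_op k h f x = norm x ^ (2 * k) * averaging_op k h f (sgn x)"
proof (cases "x = 0")
  case True
  have "coeff h (2 * j) * norm (0 :: real ^ 'n) powi (2 * (int k - int j)) *
      sphere_int (\<lambda>y. ((0 :: real ^ 'n) \<bullet> y) ^ (2 * j) * f y) = 0" for j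
  proof (cases j)
    case 0
    have "(0::real) powi (2 * int k) = 0" using k by simp
    then show ?thesis by (simp add: 0)
  qed simp
  then have "averaging_op k h f (0 :: real ^ 'n) = 0"
    unfolding averaging_op_def by (intro sum.neutral) blast
  then show ?thesis using True k by simp
next
  case False
  have "norm x powi (2 * (int k - int j)) * sphere_int (\<lambda>y. (x \<bullet> y) ^ (2 * j) * f y) =
      norm x ^ (2 * k) * sphere_int (\<lambda>y. (sgn x \<bullet> y) ^ (2 * j) * f y)" for j
  proof -
    have "x = norm x *\<^sub>R sgn x" using False by (simp add: sgn_div_norm)
    then have "(x \<bullet> y) ^ (2 * j) = norm x ^ (2 * j) * (sgn x \<bullet> y) ^ (2 * j)" for y
      by (metis inner_scaleR_left power_mult_distrib)
    then have "sphere_int (\<lambda>y. (x \<bullet> y) ^ (2 * j) * f y) =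
        norm x ^ (2 * j) * sphere_int (\<lambda>y. (sgn x \<bullet> y) ^ (2 * j) * f y)"
      by (simp only: mult.assoc sphere_int_scale)
    moreover have "norm x powi (2 * (int k - int j)) * norm x ^ (2 * j) = norm x ^ (2 * k)"
    proof -
      have "norm x powi (2 * (int k - int j)) * norm x powi (int (2 * j)) =
          norm x powi (2 * (int k - int j) + int (2 * j))"
        using False by (intro power_int_add[symmetric]) simp
      also have "2 * (int k - int j) + int (2 * j) = int (2 * k)" by simp
      finally show ?thesis by (simp only: power_int_of_nat)
    qed
    ultimately show ?thesis by (simp only: mult.assoc[symmetric])
  qed
  then show ?thesis
    using False by (simp add: averaging_op_def norm_sgn sum_distrib_left mult.assoc mult.left_commute)
qed

lemma forms_norm_mult:
  assumes "i \<le> k" "g \<in> forms (2 * i)"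
  shows "(\<lambda>x. norm x ^ (2 * (k - i))) * g \<in> forms (2 * k)"
  using forms_mult[OF forms_norm_power assms(2), of "k - i"] assms(1)
  by (simp add: distrib_left[symmetric] del: distrib_left_numeral)

text \<open>On the sphere the operator averages the kernels of h at x and at -x, and the Funk-Hecke
  formula applies to each. Both sides are homogeneous of degree 2k, so equality on the sphere is
  enough.\<close>

lemma averaging_op_eigen:
  fixes F :: "nat \<Rightarrow> real ^ 'n::finite \<Rightarrow> real"
  assumes n: "3 \<le> CARD('n)" and k: "1 \<le> k" and F: "\<And>i. i \<le> k \<Longrightarrow> F i \<in> harmonic_forms (2 * i)"
  shows "averaging_op k h (\<Sum>i\<le>k. (\<lambda>x. norm x ^ (2 * (k - i))) * F i) =
    (\<Sum>i\<le>k. gegenbauer_coeff TYPE('n) h (2 * i) *\<^sub>R ((\<lambda>x. norm x ^ (2 * (k - i))) * F i))"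
    (is "averaging_op k h ?f = ?g")
proof
  let ?l = "gegenbauer_coeff TYPE('n) h"
  have Ff: "F i \<in> forms (2 * i)" if "i \<le> k" for i
    using F[OF that] by (simp add: harmonic_forms_iff)
  have f: "?f \<in> forms (2 * k)"
    by (intro forms_sum forms_norm_mult Ff) auto
  have g: "?g \<in> forms (2 * k)"
    by (intro forms_sum forms_scale forms_norm_mult Ff) auto
  have f_sphere: "?f y = (\<Sum>i\<le>k. F i y)" if "y \<in> sphere 0 1" for y
    using that by (simp add: fun_apply)
  have kernel: "sphere_int (\<lambda>y. poly h (x \<bullet> y) * ?f y) = (\<Sum>i\<le>k. ?l (2 * i) * F i x)"
    if x: "x \<in> sphere 0 1" for x
  proof -
    have int: "integrable sphere_measure (\<lambda>y. poly h (x \<bullet> y) * F i y)" if "i \<le> k" for i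
      by (intro continuous_integrable_sphere continuous_intros forms_continuous[OF Ff[OF that]])
    have "sphere_int (\<lambda>y. poly h (x \<bullet> y) * ?f y) = sphere_int (\<lambda>y. \<Sum>i\<le>k. poly h (x \<bullet> y) * F i y)"
      by (rule sphere_int_cong) (simp only: f_sphere sum_distrib_left)
    also have "\<dots> = (\<Sum>i\<le>k. sphere_int (\<lambda>y. poly h (x \<bullet> y) * F i y))"
      using int by (intro Bochner_Integration.integral_sum) auto
    also have "\<dots> = (\<Sum>i\<le>k. ?l (2 * i) * F i x)"
      by (intro sum.cong refl poly_kernel_eigen[OF n F x]) simp
    finally show ?thesis .
  qed
  have sph: "averaging_op k h ?f x = ?g x" if x: "x \<in> sphere 0 1" for x
  proof -
    have int: "integrable sphere_measure (\<lambda>y. poly h (x \<bullet> y) * ?f y)" for x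
      by (intro continuous_integrable_sphere continuous_intros forms_continuous[OF f])
    have "averaging_op k h ?f x =
        sphere_int (\<lambda>y. (poly h (x \<bullet> y) * ?f y + poly h ((- x) \<bullet> y) * ?f y) / 2)"
      unfolding averaging_op_sphere[OF f x]
      by (intro sphere_int_cong) (simp only: inner_minus_left, simp add: field_simps)
    also have "\<dots> = (sphere_int (\<lambda>y. poly h (x \<bullet> y) * ?f y) + sphere_int (\<lambda>y. poly h ((- x) \<bullet> y) * ?f y)) / 2"
      using int[of x] int[of "- x"] by (simp only: integral_divide_zero Bochner_Integration.integral_add)
    also have "\<dots> = ((\<Sum>i\<le>k. ?l (2 * i) * F i x) + (\<Sum>i\<le>k. ?l (2 * i) * F i (- x))) / 2"
      using x kernel[of x] kernel[of "- x"] by simp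
    \<comment> \<open>The components have even degree and do not distinguish x from -x.\<close>
    also have "(\<Sum>i\<le>k. ?l (2 * i) * F i (- x)) = (\<Sum>i\<le>k. ?l (2 * i) * F i x)"
    proof (intro sum.cong refl)
      fix i assume "i \<in> {..k}"
      then have "F i ((-1) *\<^sub>R x) = (-1) ^ (2 * i) * F i x"
        by (intro forms_homogeneous Ff) simp
      then show "?l (2 * i) * F i (- x) = ?l (2 * i) * F i x" by simp
    qed
    also have "\<dots> = ?g x"
      using x by (simp add: fun_apply)
    finally have "averaging_op k h ?f x = (?g x + ?g x) / 2" .
    moreover have "(a + a) / 2 = a" for a :: real by simp
    ultimately show ?thesis by (simp only:)
  qed
  fix x :: "real ^ 'n"
  show "averaging_op k h ?f x = ?g x"
  proof (cases "x = 0")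
    case True
    have "averaging_op k h ?f 0 = 0"
    proof -
      have z: "norm (0 :: real ^ 'n) ^ (2 * k) = 0" using k by (simp add: power_0_left)
      show ?thesis
        by (subst averaging_op_homogeneous[OF k]) (simp only: z mult_zero_left)
    qed
    moreover have "?g 0 = 0"
      using forms_homogeneous[OF g, of 0 0] k by (simp add: power_0_left)
    ultimately show ?thesis by (simp only: True)
  next
    case False
    then have "averaging_op k h ?f x = norm x ^ (2 * k) * ?g (sgn x)"
      using averaging_op_homogeneous[OF k, of h ?f x] sph[of "sgn x"] by (simp only: mem_sphere_0 norm_sgn if_False)
    also have "\<dots> = ?g (norm x *\<^sub>R sgn x)"
      by (rule forms_homogeneous[OF g, symmetric])
    also have "norm x *\<^sub>R sgn x = x"
      using False by (simp add: sgn_div_norm)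
    finally show ?thesis .
  qed
qed

text \<open>The summands with j > k divide by powers of the norm; that the total is a polynomial is
  read off from the eigenvector expansion.\<close>

lemma averaging_op_forms:
  fixes f :: "real ^ 'n::finite \<Rightarrow> real"
  assumes n: "3 \<le> CARD('n)" and k: "1 \<le> k" and f: "f \<in> forms (2 * k)"
  shows "averaging_op k h f \<in> forms (2 * k)"
proof -
  obtain F where F: "\<And>i. i \<le> k \<Longrightarrow> F i \<in> harmonic_forms (2 * i)"
      "f = (\<Sum>i\<le>k. (\<lambda>x. norm x ^ (2 * (k - i))) * F i)"
  proof (rule harmonic_decomposition[OF _ f])
    show "2 \<le> CARD('n)" using n by simp
  qed (rule that)
  then have "F i \<in> forms (2 * i)" if "i \<le> k" for i
    using that by (simp add: harmonic_forms_iff)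
  then have "(\<Sum>i\<le>k. gegenbauer_coeff TYPE('n) h (2 * i) *\<^sub>R ((\<lambda>x. norm x ^ (2 * (k - i))) * F i)) \<in> forms (2 * k)"
    by (intro forms_sum forms_scale forms_norm_mult) auto
  also have "(\<Sum>i\<le>k. gegenbauer_coeff TYPE('n) h (2 * i) *\<^sub>R ((\<lambda>x. norm x ^ (2 * (k - i))) * F i)) =
      averaging_op k h f"
    unfolding F(2) by (rule averaging_op_eigen[OF n k F(1), symmetric])
  finally show ?thesis .
qed

lemma averaging_op_lin:
  fixes f g :: "real ^ 'n::finite \<Rightarrow> real"
  assumes "f \<in> forms d" "g \<in> forms d"
  shows "averaging_op k h (c *\<^sub>R f + g) = c *\<^sub>R averaging_op k h f + averaging_op k h g"
proof
  fix x :: "real ^ 'n"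
  have "sphere_int (\<lambda>y. (x \<bullet> y) ^ m * (c *\<^sub>R f + g) y) =
      c * sphere_int (\<lambda>y. (x \<bullet> y) ^ m * f y) + sphere_int (\<lambda>y. (x \<bullet> y) ^ m * g y)" for m
    using sphere_ip_lin[OF assms forms_inner_power[of x m], of c]
    by (simp add: sphere_ip_def mult.commute)
  then show "averaging_op k h (c *\<^sub>R f + g) x = (c *\<^sub>R averaging_op k h f + averaging_op k h g) x"
    by (simp add: averaging_op_def fun_apply sum.distrib sum_distrib_left algebra_simps)
qed

text \<open>For fixed x, powers of the norm of y make the even kernel homogeneous of degree
  \<open>2 * degree h\<close> without changing it on the sphere. Times f it is a form of exactly the
  degree for which the cubature rule is exact.\<close>

lemma averaging_op_nonneg:
  fixes f :: "real ^ 'n::finite \<Rightarrow> real"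
  assumes cub: "cubature_rule (2 * (k + degree h)) X W"
    and h: "\<And>u. u \<in> {-1..1} \<Longrightarrow> 0 \<le> poly h u"
    and f: "f \<in> forms (2 * k)" "\<And>x. x \<in> X \<Longrightarrow> 0 \<le> f x" and x: "x \<in> sphere 0 1"
  shows "0 \<le> averaging_op k h f x"
proof -
  define p where "p y = (poly h (x \<bullet> y) + poly h (- (x \<bullet> y))) / 2" for y
  define P where "P = (\<Sum>j\<le>degree h. coeff h (2 * j) *\<^sub>R
      ((\<lambda>y. norm y ^ (2 * (degree h - j))) * (\<lambda>y. (x \<bullet> y) ^ (2 * j)))) * f"
  have P: "P \<in> forms (2 * (k + degree h))"
  proof -
    have "P \<in> forms (2 * degree h + 2 * k)"
      unfolding P_def
      by (intro forms_mult f(1) forms_sum forms_scale forms_norm_mult forms_inner_power) simp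
    then show ?thesis by (simp add: add.commute)
  qed
  have P_sphere: "P y = p y * f y" if "y \<in> sphere 0 1" for y
    using that by (simp add: P_def p_def even_part_poly[symmetric] fun_apply)
  have X: "X \<subseteq> sphere 0 1" "\<And>y. y \<in> X \<Longrightarrow> 0 < W y" "sphere_int P = (\<Sum>y\<in>X. W y * P y)"
    using cub P by (auto simp: cubature_rule_def)
  have "averaging_op k h f x = sphere_int P"
    unfolding averaging_op_sphere[OF f(1) x]
    by (intro sphere_int_cong) (simp add: P_sphere p_def)
  also have "\<dots> = (\<Sum>y\<in>X. W y * P y)" by (rule X)
  also have "\<dots> \<ge> 0"
  proof (rule sum_nonneg)
    fix y assume y: "y \<in> X"
    then have "norm y = 1" using X(1) by auto
    then have "\<bar>x \<bullet> y\<bar> \<le> 1"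
      using Cauchy_Schwarz_ineq2[of x y] x by simp
    then have "0 \<le> p y"
      using h[of "x \<bullet> y"] h[of "- (x \<bullet> y)"] by (simp add: p_def abs_le_iff)
    then show "0 \<le> W y * P y"
      using \<open>norm y = 1\<close> X(2)[OF y] f(2)[OF y] P_sphere[of y] by simp
  qed
  finally show ?thesis .
qed

text \<open>The preimage divides each harmonic component by its eigenvalue, so on the sphere the
  error has the components \<open>(1 / ?l i - 1) * F i x\<close>.\<close>

lemma averaging_op_approx:
  fixes f :: "real ^ 'n::finite \<Rightarrow> real"
  assumes n: "3 \<le> CARD('n)" and k: "1 \<le> k" and f: "f \<in> forms (2 * k)"
    and nz: "\<And>j. j \<le> k \<Longrightarrow> gegenbauer_coeff TYPE('n) h (2 * j) \<noteq> 0"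
  obtains u where "u \<in> forms (2 * k)" "averaging_op k h u = f"
    "\<And>x. x \<in> sphere 0 1 \<Longrightarrow> \<bar>u x - f x\<bar> \<le>
      sqrt (\<Sum>j\<le>k. real (dim (harmonic_forms (2 * j) :: (real ^ 'n \<Rightarrow> real) set)) *
         (1 / gegenbauer_coeff TYPE('n) h (2 * j) - 1)\<^sup>2) /
      sqrt (measure (sphere_measure :: (real ^ 'n) measure) (sphere 0 1)) * sphere_L2_norm f"
proof -
  let ?l = "\<lambda>i. gegenbauer_coeff TYPE('n) h (2 * i)"
  let ?N = "\<lambda>i. real (dim (harmonic_forms (2 * i) :: (real ^ 'n \<Rightarrow> real) set))"
  let ?\<mu> = "measure (sphere_measure :: (real ^ 'n) measure) (sphere 0 1)"
  let ?T = "\<lambda>F. (\<Sum>i\<le>k. (\<lambda>x. norm x ^ (2 * (k - i))) * F i)"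
  have n2: "2 \<le> CARD('n)" using n by simp
  obtain F where F: "\<And>i. i \<le> k \<Longrightarrow> F i \<in> harmonic_forms (2 * i)" "f = ?T F"
  proof (rule harmonic_decomposition[OF n2 f])
  qed (rule that)
  have Ff: "F i \<in> forms (2 * i)" if "i \<le> k" for i
    using F(1)[OF that] by (simp add: harmonic_forms_iff)
  define G where "G i = (1 / ?l i) *\<^sub>R F i" for i
  have G: "G i \<in> harmonic_forms (2 * i)" if "i \<le> k" for i
    unfolding G_def by (intro subspace_scale subspace_harmonic F(1) that)
  define u where "u = ?T G"
  have u: "u \<in> forms (2 * k)"
    unfolding u_def using G harmonic_subset_forms by (intro forms_sum forms_norm_mult) auto
  have "averaging_op k h u = (\<Sum>i\<le>k. ?l i *\<^sub>R ((\<lambda>x. norm x ^ (2 * (k - i))) * G i))"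
    unfolding u_def by (rule averaging_op_eigen[OF n k G])
  also have "\<dots> = f"
    unfolding F(2)
  proof (rule sum.cong)
    fix i assume "i \<in> {..k}"
    then have "?l i \<noteq> 0" using nz by simp
    then show "?l i *\<^sub>R ((\<lambda>x. norm x ^ (2 * (k - i))) * G i) = (\<lambda>x. norm x ^ (2 * (k - i))) * F i"
      by (auto simp: G_def fun_apply)
  qed simp
  finally have avg: "averaging_op k h u = f" .
  have f_sphere: "f y = (\<Sum>i\<le>k. F i y)" if "y \<in> sphere 0 1" for y
    using that by (simp add: F(2) fun_apply)
  have orth: "sphere_ip (F i) (F j) = 0" if "i \<le> k" "j \<le> k" "i \<noteq> j" for i j
  proof (cases "i < j")
    case True
    then show ?thesis
      unfolding sphere_ip_def using that by (intro harmonic_orthogonal_lower[OF n2 F(1) Ff]) auto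
  next
    case False
    then show ?thesis
      using that harmonic_orthogonal_lower[OF n2 F(1)[OF that(1)] Ff[OF that(2)]]
      by (simp add: sphere_ip_def mult.commute)
  qed
  have pythagoras: "(sphere_L2_norm f)\<^sup>2 = (\<Sum>i\<le>k. sphere_ip (F i) (F i))"
  proof -
    have "(sphere_L2_norm f)\<^sup>2 = sphere_int (\<lambda>y. (f y)\<^sup>2)"
      by (simp add: sphere_L2_norm_def)
    also have "\<dots> = sphere_int (\<lambda>y. \<Sum>i\<le>k. \<Sum>j\<le>k. F i y * F j y)"
      by (rule sphere_int_cong) (simp add: f_sphere power2_eq_square sum_product)
    also have "\<dots> = (\<Sum>i\<le>k. \<Sum>j\<le>k. sphere_ip (F i) (F j))"
      using sphere_ip_integrable[OF Ff Ff]
      by (subst Bochner_Integration.integral_sum)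
        (auto intro!: Bochner_Integration.integrable_sum simp: sphere_ip_def)
    also have "\<dots> = (\<Sum>i\<le>k. \<Sum>j\<le>k. if i = j then sphere_ip (F i) (F i) else 0)"
      using orth by (intro sum.cong refl) auto
    finally show ?thesis by simp
  qed
  show ?thesis
  proof (rule that[OF u avg])
    fix x :: "real ^ 'n" assume x: "x \<in> sphere 0 1"
    have \<mu>: "?\<mu> > 0" by (rule measure_sphere_pos)
    have "u x - f x = (\<Sum>i\<le>k. (1 / ?l i - 1) * F i x)"
      using x by (simp add: f_sphere u_def G_def fun_apply left_diff_distrib sum_subtractf)
    \<comment> \<open>The grouping lets Cauchy-Schwarz over i separate the threshold, which receives
      the dimensions, from the norms of the components, whose squares add up to that of f by
      orthogonality.\<close>
    also have "\<bar>\<dots>\<bar> \<le> (\<Sum>i\<le>k. \<bar>(1 / ?l i - 1) * sqrt (?N i)\<bar> * \<bar>sqrt (sphere_ip (F i) (F i))\<bar> / sqrt ?\<mu>)"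
    proof (rule order_trans[OF sum_abs], rule sum_mono)
      fix i assume "i \<in> {..k}"
      then have "\<bar>F i x\<bar> \<le> sqrt (?N i / ?\<mu> * sphere_ip (F i) (F i))"
        using harmonic_evaluation_bound[OF n F(1) x] by (intro real_le_rsqrt) simp
      also have "\<dots> = sqrt (?N i) * \<bar>sqrt (sphere_ip (F i) (F i))\<bar> / sqrt ?\<mu>"
        using sphere_ip_self_nonneg[of "F i"] by (simp add: real_sqrt_mult real_sqrt_divide)
      finally have "\<bar>1 / ?l i - 1\<bar> * \<bar>F i x\<bar> \<le>
          \<bar>1 / ?l i - 1\<bar> * (sqrt (?N i) * \<bar>sqrt (sphere_ip (F i) (F i))\<bar> / sqrt ?\<mu>)"
        by (rule mult_left_mono) simp
      then show "\<bar>(1 / ?l i - 1) * F i x\<bar> \<le>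
          \<bar>(1 / ?l i - 1) * sqrt (?N i)\<bar> * \<bar>sqrt (sphere_ip (F i) (F i))\<bar> / sqrt ?\<mu>"
        by (simp add: abs_mult mult.assoc)
    qed
    also have "\<dots> \<le> L2_set (\<lambda>i. (1 / ?l i - 1) * sqrt (?N i)) {..k} *
        L2_set (\<lambda>i. sqrt (sphere_ip (F i) (F i))) {..k} / sqrt ?\<mu>"
      unfolding sum_divide_distrib[symmetric]
      using \<mu> by (intro divide_right_mono L2_set_mult_ineq) simp
    also have "L2_set (\<lambda>i. sqrt (sphere_ip (F i) (F i))) {..k} = sphere_L2_norm f"
    proof -
      have "L2_set (\<lambda>i. sqrt (sphere_ip (F i) (F i))) {..k} = sqrt ((sphere_L2_norm f)\<^sup>2)"
        unfolding pythagoras L2_set_def by (simp add: sphere_ip_self_nonneg)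
      then show ?thesis by (simp add: sphere_L2_norm_def)
    qed
    also have "L2_set (\<lambda>i. (1 / ?l i - 1) * sqrt (?N i)) {..k} = sqrt (\<Sum>i\<le>k. ?N i * (1 / ?l i - 1)\<^sup>2)"
      by (simp add: L2_set_def power_mult_distrib mult.commute)
    finally show "\<bar>u x - f x\<bar> \<le> sqrt (\<Sum>i\<le>k. ?N i * (1 / ?l i - 1)\<^sup>2) / sqrt ?\<mu> * sphere_L2_norm f"
      by simp
  qed
qed

section \<open>Linear images of polyhedral cones\<close>

text \<open>Chooses the eliminated variable between its lower and upper bounds. Either set may be
  empty, where \<open>Max\<close> or \<open>Min\<close> gives no information.\<close>

lemma separating_real:
  fixes N P :: "real set"
  assumes "finite N" "finite P" "\<And>a b. a \<in> N \<Longrightarrow> b \<in> P \<Longrightarrow> a \<le> b"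
  obtains t where "\<And>a. a \<in> N \<Longrightarrow> a \<le> t" "\<And>b. b \<in> P \<Longrightarrow> t \<le> b"
proof (cases "N = {}")
  case True
  show ?thesis
  proof (cases "P = {}")
    case False
    then show ?thesis using that[of "Min P"] True assms(2) by simp
  qed (use that True in auto)
next
  case False
  then show ?thesis using that[of "Max N"] assms by simp
qed

lemma polyhedral_cone_inE:
  fixes V :: "'a::real_vector set"
  assumes "polyhedral_cone_in V A"
  obtains L :: "('a \<Rightarrow> real) set" where "finite L" "\<forall>l\<in>L. linear l"
    "A = {v \<in> V. \<forall>l\<in>L. 0 \<le> l v}"
  using assms unfolding polyhedral_cone_in_def by (elim exE conjE)

text \<open>One step of Fourier-Motzkin elimination.\<close>

lemma polyhedral_cone_add_line:
  assumes V: "subspace V" and A: "polyhedral_cone_in V A" and u: "u \<in> V"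
  shows "polyhedral_cone_in V {v + t *\<^sub>R u |v t. v \<in> A}"
proof -
  obtain L :: "('a \<Rightarrow> real) set" where L: "finite L" "\<forall>l\<in>L. linear l"
      "A = {v \<in> V. \<forall>l\<in>L. 0 \<le> l v}"
    by (rule polyhedral_cone_inE[OF A])
  define Z where "Z = {l \<in> L. l u = 0}"
  define P where "P = {l \<in> L. 0 < l u}"
  define N where "N = {l \<in> L. l u < 0}"
  \<comment> \<open>For l positive and m negative at u, the positive weights \<open>- m u\<close>
    and \<open>l u\<close> make the combination vanish at u, so it is constant along the added
    line.\<close>
  define comb where "comb = (\<lambda>(l, m) v. (- m u) * l v + l u * m v :: real)"
  define L' where "L' = Z \<union> comb ` (P \<times> N)"
  have fin: "finite Z" "finite P" "finite N" using L(1) by (simp_all add: Z_def P_def N_def)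
  have lin: "linear l" if "l \<in> L'" for l
  proof -
    have "linear (comb (l, m))" if "l \<in> L" "m \<in> L" for l m
      using bspec[OF L(2) that(1)] bspec[OF L(2) that(2)]
      by (intro linearI) (simp_all add: comb_def linear_add linear_scale algebra_simps)
    then show ?thesis
      using that L(2) by (auto simp: L'_def Z_def P_def N_def)
  qed
  have "{v + t *\<^sub>R u |v t. v \<in> A} = {v \<in> V. \<forall>l\<in>L'. 0 \<le> l v}"
  proof (intro equalityI subsetI)
    fix w assume "w \<in> {v + t *\<^sub>R u |v t. v \<in> A}"
    then obtain v t where w: "w = v + t *\<^sub>R u" "v \<in> A" by blast
    have v: "v \<in> V" "\<And>l. l \<in> L \<Longrightarrow> 0 \<le> l v" using w(2) L(3) by auto
    have wV: "w \<in> V" using w v V u by (simp add: subspace_add subspace_scale)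
    have lw: "l w = l v + t * l u" if "l \<in> L" for l
      using bspec[OF L(2) that] by (simp add: w linear_add linear_scale)
    have "0 \<le> l w" if "l \<in> Z" for l
      using that v(2)[of l] lw[of l] by (simp add: Z_def)
    moreover have "0 \<le> comb (l, m) w" if "l \<in> P" "m \<in> N" for l m
    proof -
      have "comb (l, m) w = (- m u) * l v + l u * m v"
        using that lw[of l] lw[of m] by (simp add: comb_def P_def N_def algebra_simps)
      also have "\<dots> \<ge> 0"
        using that v(2) by (intro add_nonneg_nonneg mult_nonneg_nonneg) (auto simp: P_def N_def)
      finally show ?thesis .
    qed
    ultimately show "w \<in> {v \<in> V. \<forall>l\<in>L'. 0 \<le> l v}"
      using wV by (auto simp: L'_def)
  next
    fix w assume "w \<in> {v \<in> V. \<forall>l\<in>L'. 0 \<le> l v}"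
    then have wV: "w \<in> V" and wL: "\<And>l. l \<in> L' \<Longrightarrow> 0 \<le> l w" by auto
    \<comment> \<open>Membership of \<open>w - t *\<^sub>R u\<close> in the cone bounds t from above
      by the quotients over P and from below by those over N; each \<open>comb\<close> inequality
      compares one such pair.\<close>
    have le: "m w / m u \<le> l w / l u" if "l \<in> P" "m \<in> N" for l m
    proof -
      have "0 \<le> comb (l, m) w" using that by (intro wL) (auto simp: L'_def)
      then have "m u * l w \<le> l u * m w" by (simp add: comb_def)
      then show ?thesis
        using that by (simp add: P_def N_def field_simps)
    qed
    let ?N = "(\<lambda>m. m w / m u) ` N" and ?P = "(\<lambda>l. l w / l u) ` P"
    obtain t where "\<And>a. a \<in> ?N \<Longrightarrow> a \<le> t" "\<And>b. b \<in> ?P \<Longrightarrow> t \<le> b"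
    proof (rule separating_real[of ?N ?P])
      show "finite ?N" "finite ?P" using fin by simp_all
      show "a \<le> b" if "a \<in> ?N" "b \<in> ?P" for a b
        using that le by auto
    qed (rule that)
    then have t: "\<And>m. m \<in> N \<Longrightarrow> m w / m u \<le> t" "\<And>l. l \<in> P \<Longrightarrow> t \<le> l w / l u"
      by simp_all
    have "0 \<le> l (w - t *\<^sub>R u)" if l: "l \<in> L" for l
    proof -
      have eq: "l (w - t *\<^sub>R u) = l w - t * l u"
        using bspec[OF L(2) l] by (simp add: linear_diff linear_scale)
      consider "l u = 0" | "0 < l u" | "l u < 0" by linarith
      then show ?thesis
      proof cases
        case 1
        then show ?thesis unfolding eq using wL[of l] l by (simp add: L'_def Z_def)
      next
        case 2
        then show ?thesis unfolding eq using t(2)[of l] l by (simp add: P_def field_simps)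
      next
        case 3
        then show ?thesis unfolding eq using t(1)[of l] l by (simp add: N_def field_simps)
      qed
    qed
    moreover have "w - t *\<^sub>R u \<in> V"
      using wV u V by (simp add: subspace_diff subspace_scale)
    ultimately have "w - t *\<^sub>R u \<in> A" using L(3) by simp
    then show "w \<in> {v + t *\<^sub>R u |v t. v \<in> A}"
      by (intro CollectI exI[of _ "w - t *\<^sub>R u"] exI[of _ t]) simp
  qed
  moreover have "finite L'" using fin by (simp add: L'_def)
  ultimately show ?thesis
    unfolding polyhedral_cone_in_def using lin by (intro exI[of _ L']) simp
qed

lemma polyhedral_cone_add_span:
  assumes V: "subspace V" and A: "polyhedral_cone_in V A" and C: "finite C" "C \<subseteq> V"
  shows "polyhedral_cone_in V {v + w |v w. v \<in> A \<and> w \<in> span C}"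
  using C
proof (induction C rule: finite_induct)
  case empty
  then show ?case using A by simp
next
  case (insert u C)
  have "{v + w |v w. v \<in> A \<and> w \<in> span (insert u C)} =
      {v + t *\<^sub>R u |v t. v \<in> {v + w |v w. v \<in> A \<and> w \<in> span C}}" (is "?l = ?r")
  proof (intro equalityI subsetI)
    fix x assume "x \<in> ?l"
    then obtain v w t where x: "x = v + w" "v \<in> A" "w - t *\<^sub>R u \<in> span C"
      unfolding span_insert by blast
    then have "x = (v + (w - t *\<^sub>R u)) + t *\<^sub>R u" by simp
    then show "x \<in> ?r" using x(2,3) by blast
  next
    fix x assume "x \<in> ?r"
    then obtain v w t where x: "x = v + w + t *\<^sub>R u" "v \<in> A" "w \<in> span C" by blast
    then have "x = v + (w + t *\<^sub>R u)" "(w + t *\<^sub>R u) - t *\<^sub>R u \<in> span C" by simp_all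
    then show "x \<in> ?l" unfolding span_insert using x(2) by blast
  qed
  then show ?case
    using polyhedral_cone_add_line[OF V insert.IH] insert.prems by simp
qed

lemma finite_basis_of_subspace:
  assumes "finite B" "V \<subseteq> span B" "W \<subseteq> V"
  obtains C where "finite C" "C \<subseteq> W" "independent C" "W \<subseteq> span C"
proof -
  obtain C where C: "C \<subseteq> W" "independent C" "W \<subseteq> span C"
    by (rule maximal_independent_subset)
  moreover from this have "finite C"
    using independent_span_bound[OF assms(1)] assms(2,3) by blast
  ultimately show ?thesis using that by blast
qed

text \<open>Extend a basis of W to one of V: the dual functionals of the added vectors vanish on W
  and, within V, nowhere else.\<close>

lemma subspace_cut_out:
  fixes V W :: "'a::real_vector set"
  assumes B: "finite B" "V \<subseteq> span B" and W: "subspace W" "W \<subseteq> V"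
  obtains \<Phi> :: "('a \<Rightarrow> real) set" where "finite \<Phi>" "\<forall>\<phi>\<in>\<Phi>. linear \<phi>"
    "W = {v \<in> V. \<forall>\<phi>\<in>\<Phi>. \<phi> v = 0}"
proof -
  obtain C where C: "finite C" "C \<subseteq> W" "independent C" "W \<subseteq> span C"
    by (rule finite_basis_of_subspace[OF B W(2)])
  have "C \<subseteq> V" using C(2) W(2) by blast
  then obtain D where D: "C \<subseteq> D" "D \<subseteq> V" "independent D" "V \<subseteq> span D"
    using maximal_independent_subset_extend[OF _ C(3)] by metis
  have finD: "finite D"
    using independent_span_bound[OF B(1) D(3)] D(2) B(2) by blast
  have "\<exists>\<phi> :: 'a \<Rightarrow> real. linear \<phi> \<and> (\<forall>d\<in>D. \<phi> d = (if d = b then 1 else 0))" for b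
    using linear_independent_extend[OF D(3), of "\<lambda>d. if d = b then 1 else 0"] .
  then obtain \<phi> :: "'a \<Rightarrow> 'a \<Rightarrow> real" where \<phi>: "\<And>b. linear (\<phi> b)"
      "\<And>b d. d \<in> D \<Longrightarrow> \<phi> b d = (if d = b then 1 else 0)"
    by metis
  have "W = {v \<in> V. \<forall>\<psi>\<in>\<phi> ` (D - C). \<psi> v = 0}"
  proof (intro equalityI subsetI)
    fix v assume v: "v \<in> W"
    have "\<phi> b v = 0" if b: "b \<in> D - C" for b
    proof (rule linear_eq_0_on_span[OF \<phi>(1)])
      show "\<phi> b x = 0" if "x \<in> C" for x
        using that b D(1) \<phi>(2)[of x b] by auto
      show "v \<in> span C" using v C(4) by blast
    qed
    then show "v \<in> {v \<in> V. \<forall>\<psi>\<in>\<phi> ` (D - C). \<psi> v = 0}"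
      using v W(2) by auto
  next
    fix v assume v: "v \<in> {v \<in> V. \<forall>\<psi>\<in>\<phi> ` (D - C). \<psi> v = 0}"
    then obtain c where c: "v = (\<Sum>d\<in>D. c d *\<^sub>R d)"
      using D(4) span_finite[OF finD] by blast
    have "\<phi> b v = c b" if "b \<in> D" for b
    proof -
      have "\<phi> b v = (\<Sum>d\<in>D. c d * \<phi> b d)"
        by (simp add: c linear_sum[OF \<phi>(1)] linear_scale[OF \<phi>(1)])
      also have "\<dots> = (\<Sum>d\<in>D. if d = b then c b else 0)"
        by (rule sum.cong) (simp_all add: \<phi>(2))
      finally show ?thesis using that finD by simp
    qed
    then have "c b = 0" if "b \<in> D - C" for b
      using v that by fastforce
    then have "v = (\<Sum>d\<in>C. c d *\<^sub>R d)"
      unfolding c using finD D(1) by (intro sum.mono_neutral_right) auto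
    also have "\<dots> \<in> W"
      using C(2) W(1) by (intro subspace_sum subspace_scale) auto
    finally show "v \<in> W" .
  qed
  then show ?thesis
    using that[of "\<phi> ` (D - C)"] finD \<phi>(1) by blast
qed

text \<open>A preimage is determined only up to the kernel K of T on V, so the inequalities are
  taken from A + K, which is polyhedral by elimination. A vector in the image of V lies in the image
  of A exactly if its preimage under the linear section G lies in A + K.\<close>

lemma polyhedral_cone_linear_image:
  fixes V :: "'a::real_vector set" and T :: "'a \<Rightarrow> 'a"
  assumes V: "subspace V" and B: "finite B" "V \<subseteq> span B"
    and T: "linear T" "\<And>v. v \<in> V \<Longrightarrow> T v \<in> V"
    and A: "polyhedral_cone_in V A"
  shows "polyhedral_cone_in V (T ` A)"
proof -
  have AV: "A \<subseteq> V" using A by (auto simp: polyhedral_cone_in_def)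
  define K where "K = {v \<in> V. T v = 0}"
  have K: "subspace K"
    using V unfolding K_def subspace_def by (auto simp: linear_0[OF T(1)] linear_add[OF T(1)] linear_scale[OF T(1)])
  obtain C where C: "finite C" "C \<subseteq> K" "independent C" "K \<subseteq> span C"
    by (rule finite_basis_of_subspace[OF B, of K]) (auto simp: K_def)
  have spanC: "span C = K"
    using C K by (simp add: span_minimal subset_antisym)
  have "C \<subseteq> V" using C(2) by (auto simp: K_def)
  obtain L :: "('a \<Rightarrow> real) set" where L: "finite L" "\<forall>l\<in>L. linear l"
      "{v + w |v w. v \<in> A \<and> w \<in> K} = {v \<in> V. \<forall>l\<in>L. 0 \<le> l v}"
    by (rule polyhedral_cone_inE[OF polyhedral_cone_add_span[OF V A C(1) \<open>C \<subseteq> V\<close>, unfolded spanC]])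
  have "subspace (T ` V)" "T ` V \<subseteq> V"
    using linear_subspace_image[OF T(1) V] T(2) by auto
  then obtain \<Phi> :: "('a \<Rightarrow> real) set" where \<Phi>: "finite \<Phi>" "\<forall>\<phi>\<in>\<Phi>. linear \<phi>"
    "T ` V = {v \<in> V. \<forall>\<phi>\<in>\<Phi>. \<phi> v = 0}"
    by (rule subspace_cut_out[OF B])
  obtain G where G: "range G \<subseteq> V" "linear G" "\<And>v. v \<in> T ` V \<Longrightarrow> T (G v) = v"
    using linear_exists_right_inverse_on[OF T(1) V] by metis
  have mem: "v \<in> T ` A \<longleftrightarrow> v \<in> T ` V \<and> (\<forall>l\<in>L. 0 \<le> l (G v))" for v
  proof
    assume "v \<in> T ` A"
    then obtain a where a: "v = T a" "a \<in> A" by blast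
    then have vT: "v \<in> T ` V" using AV by blast
    have "G v \<in> V" "a \<in> V" using G(1) a(2) AV by auto
    then have "G v - a \<in> K"
      using V G(3)[OF vT] a(1) by (simp add: K_def linear_diff[OF T(1)] subspace_diff)
    then have "a + (G v - a) \<in> {v + w |v w. v \<in> A \<and> w \<in> K}"
      using a(2) by blast
    then show "v \<in> T ` V \<and> (\<forall>l\<in>L. 0 \<le> l (G v))"
      using vT unfolding L(3) by simp
  next
    assume v: "v \<in> T ` V \<and> (\<forall>l\<in>L. 0 \<le> l (G v))"
    then have "G v \<in> {v \<in> V. \<forall>l\<in>L. 0 \<le> l v}" using G(1) by auto
    then obtain a w where aw: "G v = a + w" "a \<in> A" "w \<in> K"
      unfolding L(3)[symmetric] by blast
    have "v = T (a + w)" using G(3) v aw(1) by metis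
    also have "\<dots> = T a" using aw(3) by (simp add: linear_add[OF T(1)] K_def)
    finally show "v \<in> T ` A" using aw(2) by blast
  qed
  \<comment> \<open>The equations that cut out the image of V enter as pairs of opposite
    inequalities.\<close>
  define M where "M = \<Phi> \<union> (\<lambda>\<phi> v. - \<phi> v) ` \<Phi> \<union> (\<lambda>l v. l (G v)) ` L"
  have "finite M" using \<Phi>(1) L(1) by (simp add: M_def)
  moreover have "linear m" if m: "m \<in> M" for m
  proof -
    have "linear (\<lambda>v. l (G v))" if "l \<in> L" for l
      using linear_compose[OF G(2) bspec[OF L(2) that]] by (simp add: o_def)
    moreover have "linear (\<lambda>v. - \<phi> v)" if "\<phi> \<in> \<Phi>" for \<phi>
      using bspec[OF \<Phi>(2) that] by (rule linear_compose_neg)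
    ultimately show ?thesis
      using m \<Phi>(2) by (auto simp: M_def)
  qed
  moreover have "T ` A = {v \<in> V. \<forall>m\<in>M. 0 \<le> m v}"
  proof -
    have "(\<forall>m\<in>M. 0 \<le> m v) \<longleftrightarrow> (\<forall>\<phi>\<in>\<Phi>. \<phi> v = 0) \<and> (\<forall>l\<in>L. 0 \<le> l (G v))" for v
    proof -
      have "(\<forall>m\<in>M. 0 \<le> m v) \<longleftrightarrow>
          (\<forall>\<phi>\<in>\<Phi>. 0 \<le> \<phi> v) \<and> (\<forall>\<phi>\<in>\<Phi>. \<phi> v \<le> 0) \<and> (\<forall>l\<in>L. 0 \<le> l (G v))"
        by (simp add: M_def ball_Un conj_assoc)
      also have "\<dots> \<longleftrightarrow> (\<forall>\<phi>\<in>\<Phi>. \<phi> v = 0) \<and> (\<forall>l\<in>L. 0 \<le> l (G v))"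
        by (auto intro: antisym)
      finally show ?thesis .
    qed
    then show ?thesis
      by (intro set_eqI) (simp only: mem \<Phi>(3) mem_Collect_eq conj_assoc)
  qed
  ultimately show ?thesis
    unfolding polyhedral_cone_in_def by (intro exI[of _ M]) simp
qed

section \<open>Approximation of nonnegative forms\<close>

lemma polyhedral_cone_averaging_image:
  fixes X :: "(real ^ 'n::finite) set"
  assumes n: "3 \<le> CARD('n)" and k: "1 \<le> k" and X: "finite X"
  shows "polyhedral_cone_in (forms (2 * k)) (averaging_op k h ` {F \<in> forms (2 * k). \<forall>x\<in>X. 0 \<le> F x})"
proof -
  let ?V = "forms (2 * k) :: (real ^ 'n \<Rightarrow> real) set"
  let ?Q = "{F \<in> ?V. \<forall>x\<in>X. 0 \<le> F x}"
  have Q: "polyhedral_cone_in ?V ?Q"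
    unfolding polyhedral_cone_in_def
  proof (intro exI conjI)
    show "finite ((\<lambda>x f. f x) ` X :: ((real ^ 'n \<Rightarrow> real) \<Rightarrow> real) set)"
      using X by simp
    show "\<forall>l\<in>(\<lambda>x f. f x) ` X :: ((real ^ 'n \<Rightarrow> real) \<Rightarrow> real) set. linear l"
      by (auto intro!: linearI simp: fun_apply)
  qed auto
  obtain B :: "(real ^ 'n \<Rightarrow> real) set" where B: "finite B" "?V = span B" "B \<subseteq> ?V"
    by (rule finite_span_forms)
  obtain T :: "(real ^ 'n \<Rightarrow> real) \<Rightarrow> real ^ 'n \<Rightarrow> real"
    where T: "linear T" "\<And>f. f \<in> ?V \<Longrightarrow> T f = averaging_op k h f"
  proof (rule linear_extension_on[OF subspace_forms])
    show "averaging_op k h (c *\<^sub>R f + g) = c *\<^sub>R averaging_op k h f + averaging_op k h g"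
      if "f \<in> ?V" "g \<in> ?V" for c f g
      using that by (rule averaging_op_lin)
  qed (rule that)
  have "polyhedral_cone_in ?V (T ` ?Q)"
    using B(2) T(2) averaging_op_forms[OF n k]
    by (intro polyhedral_cone_linear_image[OF subspace_forms B(1) _ T(1) _ Q]) auto
  moreover have "T ` ?Q = averaging_op k h ` ?Q"
    by (rule image_cong) (simp_all add: T(2))
  ultimately show ?thesis by simp
qed

text \<open>An even power of the norm is a form equal to 1 on the sphere, so its integral is
  positive, whereas an empty rule would give 0. It ensures that \<open>Min\<close> over the nodes is
  a genuine minimum.\<close>

lemma cubature_nodes_nonempty:
  fixes X :: "(real ^ 'n::finite) set"
  assumes "cubature_rule (2 * t) X W"
  shows "X \<noteq> {}"
proof
  assume "X = {}"
  then have "sphere_int (\<lambda>x :: real ^ 'n. norm x ^ (2 * t)) = 0"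
    using assms forms_norm_power[of t] by (auto simp: cubature_rule_def)
  moreover have "sphere_int (\<lambda>x :: real ^ 'n. norm x ^ (2 * t)) = sphere_int (\<lambda>x :: real ^ 'n. 1)"
    by (rule sphere_int_cong) simp
  ultimately show False
    using sphere_int_const[of 1, where 'n = 'n] measure_sphere_pos[where 'n = 'n] by simp
qed

lemma frobenius_threshold_cases:
  obtains "frobenius_threshold n k h = \<infinity>"
  | "\<And>j. j \<le> k \<Longrightarrow> gegenbauer_coeff (n :: 'n::finite itself) h (2 * j) \<noteq> 0"
    "frobenius_threshold n k h = ereal (sqrt (\<Sum>j\<le>k.
       real (dim (harmonic_forms (2 * j) :: (real ^ 'n \<Rightarrow> real) set)) *
         (1 / gegenbauer_coeff n h (2 * j) - 1)\<^sup>2))"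
  unfolding frobenius_threshold_def by (cases "\<exists>j\<le>k. gegenbauer_coeff n h (2 * j) = 0") auto

lemma frobenius_threshold_nonneg: "0 \<le> frobenius_threshold n k h"
  by (auto simp: frobenius_threshold_def intro!: sum_nonneg)

text \<open>The weak inequality lets this serve both the bound by the minimum over the nodes and the
  limit argument. The preimage deviates from f by at most the left side, so it stays nonnegative at
  the nodes.\<close>

lemma averaging_image_mem:
  fixes f :: "real ^ 'n::finite \<Rightarrow> real"
  assumes n: "3 \<le> CARD('n)" and k: "1 \<le> k" and X: "X \<subseteq> sphere 0 1" and f: "f \<in> forms (2 * k)"
    and \<tau>: "frobenius_threshold TYPE('n) k h = ereal \<tau>"
    and le: "\<And>x. x \<in> X \<Longrightarrow>
      \<tau> / sqrt (measure (sphere_measure :: (real ^ 'n) measure) (sphere 0 1)) * sphere_L2_norm f \<le> f x"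
  shows "f \<in> averaging_op k h ` {F \<in> forms (2 * k). \<forall>x\<in>X. 0 \<le> F x}"
proof (cases rule: frobenius_threshold_cases[of "TYPE('n)" k h])
  case 1
  then show ?thesis using \<tau> by simp
next
  case 2
  obtain u where u: "u \<in> forms (2 * k)" "averaging_op k h u = f"
    "\<And>x. x \<in> sphere 0 1 \<Longrightarrow> \<bar>u x - f x\<bar> \<le>
      \<tau> / sqrt (measure (sphere_measure :: (real ^ 'n) measure) (sphere 0 1)) * sphere_L2_norm f"
  proof (rule averaging_op_approx[OF n k f 2(1)])
  qed (use that 2(2) \<tau> in auto)
  have "0 \<le> u x" if "x \<in> X" for x
  proof -
    have "x \<in> sphere 0 1" using that X by blast
    then show ?thesis using u(3)[of x] le[OF that] by linarith
  qed
  then show ?thesis using u(1,2) by blast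
qed

lemma sphere_L2_norm_eq_0:
  assumes "f \<in> forms d" "sphere_L2_norm f = 0"
  shows "f = 0"
proof (rule sphere_ip_self_eq_0[OF assms(1)])
  show "sphere_ip f f = 0"
    using assms(2) by (simp add: sphere_L2_norm_def sphere_ip_def power2_eq_square)
qed

text \<open>Evaluations are continuous for pointwise convergence, so nonnegativity survives limits.
  Conversely, adding a positive multiple of the 2k-th power of the norm makes a nonnegative form
  strictly positive on the sphere, and the multiple may tend to 0.\<close>

lemma nonneg_forms_closure:
  fixes S :: "(real ^ 'n::finite \<Rightarrow> real) set"
  assumes S: "S \<subseteq> nonneg_forms (2 * k)"
    and pos: "\<And>f. f \<in> forms (2 * k) \<Longrightarrow> \<forall>x \<in> sphere 0 1. 0 < f x \<Longrightarrow> f \<in> S"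
  shows "nonneg_forms (2 * k) = top_of_set (forms (2 * k)) closure_of S"
proof -
  let ?V = "forms (2 * k) :: (real ^ 'n \<Rightarrow> real) set"
  have SV: "S \<subseteq> ?V" using S by (auto simp: nonneg_forms_def)
  have eq: "top_of_set ?V closure_of S = ?V \<inter> closure S"
    using SV by (simp add: closure_of_subtopology Int_absorb1)
  have "closed {f :: real ^ 'n \<Rightarrow> real. \<forall>x\<in>sphere 0 1. 0 \<le> f x}"
  proof -
    have "{f :: real ^ 'n \<Rightarrow> real. \<forall>x\<in>sphere 0 1. 0 \<le> f x} = (\<Inter>x\<in>sphere 0 1. {f. 0 \<le> f x})"
      by auto
    moreover have "closed {f :: real ^ 'n \<Rightarrow> real. 0 \<le> f x}" for x
      by (intro closed_Collect_le continuous_intros continuous_on_product_coordinates)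
    ultimately show ?thesis by (auto intro!: closed_INT)
  qed
  moreover have "S \<subseteq> {f. \<forall>x\<in>sphere 0 1. 0 \<le> f x}"
    using S by (auto simp: nonneg_forms_def)
  ultimately have "closure S \<subseteq> {f. \<forall>x\<in>sphere 0 1. 0 \<le> f x}"
    by (rule closure_minimal[rotated])
  then have "?V \<inter> closure S \<subseteq> nonneg_forms (2 * k)"
    by (auto simp: nonneg_forms_def)
  moreover have "nonneg_forms (2 * k) \<subseteq> ?V \<inter> closure S"
  proof
    fix f :: "real ^ 'n \<Rightarrow> real" assume "f \<in> nonneg_forms (2 * k)"
    then have f: "f \<in> ?V" "\<And>x. x \<in> sphere 0 1 \<Longrightarrow> 0 \<le> f x"
      by (auto simp: nonneg_forms_def)
    define \<phi> where "\<phi> t = f + t *\<^sub>R (\<lambda>x. norm x ^ (2 * k))" for t :: real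
    have "continuous_on UNIV \<phi>"
      unfolding \<phi>_def
      by (rule continuous_on_coordinatewise_then_product) (auto simp: fun_apply intro!: continuous_intros)
    moreover have "\<phi> ` {0<..} \<subseteq> closure S"
    proof
      fix g assume "g \<in> \<phi> ` {0<..}"
      then obtain t where t: "0 < t" "g = \<phi> t" by auto
      have "\<phi> t \<in> S"
      proof (rule pos)
        show "\<phi> t \<in> ?V" unfolding \<phi>_def by (intro forms_add forms_scale f(1) forms_norm_power)
        show "\<forall>x\<in>sphere 0 1. 0 < \<phi> t x"
          using f(2) t(1) by (auto simp: \<phi>_def fun_apply intro!: add_nonneg_pos)
      qed
      then show "g \<in> closure S" using closure_subset t(2) by blast
    qed
    ultimately have "\<phi> ` closure {0<..} \<subseteq> closure S"
      by (intro image_closure_subset) (auto intro: continuous_on_subset)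
    then have "\<phi> 0 \<in> closure S" by auto
    then show "f \<in> ?V \<inter> closure S"
      using f(1) by (simp add: \<phi>_def)
  qed
  ultimately show ?thesis unfolding eq by blast
qed

theorem theorem1p4:
  fixes k :: nat
    and X :: "nat \<Rightarrow> (real ^ 'n::finite) set"
    and W :: "nat \<Rightarrow> real ^ 'n \<Rightarrow> real"
    and h :: "nat \<Rightarrow> real poly"
    and Q A :: "nat \<Rightarrow> (real ^ 'n \<Rightarrow> real) set"
  assumes "CARD('n) \<ge> 3" and "k \<ge> 1"
    and "\<And>t. cubature_rule (2 * t) (X (2 * t)) (W (2 * t))"
    and "\<And>s u. u \<in> {-1..1} \<Longrightarrow> 0 \<le> poly (h s) u"
    and "\<And>s. Q s = {F \<in> forms (2 * k). \<forall>x \<in> X (2 * (k + degree (h s))). 0 \<le> F x}"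
    and "\<And>s. A s = averaging_op k (h s) ` Q s"
  shows
    "(\<forall>s. polyhedral_cone_in (forms (2 * k)) (A s) \<and>
        A s \<subseteq> nonneg_forms (2 * k) \<and>
        (nonneg_forms (2 * k) :: (real ^ 'n \<Rightarrow> real) set) \<subseteq> forms (2 * k)) \<and>
     (\<forall>s. bij_betw (averaging_op k (h s))
          (forms (2 * k) :: (real ^ 'n \<Rightarrow> real) set) (forms (2 * k)) \<longrightarrow>
        (\<forall>f \<in> forms (2 * k).
          ereal (Min (f ` X (2 * (k + degree (h s))))) >
            frobenius_threshold TYPE('n) k (h s) /
              ereal (sqrt (measure (sphere_measure :: (real ^ 'n) measure) (sphere 0 1))) *
              ereal (sphere_L2_norm f) \<longrightarrow>
          f \<in> A s)) \<and>
     ((\<lambda>s. frobenius_threshold TYPE('n) k (h s)) \<longlonglongrightarrow> 0 \<longrightarrow>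
        (\<forall>f \<in> forms (2 * k). (\<forall>x \<in> sphere 0 1. 0 < f x) \<longrightarrow> (\<exists>s. f \<in> A s)) \<and>
        nonneg_forms (2 * k) = top_of_set (forms (2 * k)) closure_of (\<Union>s. A s))"
proof -
  note n = assms(1) and k = assms(2)
  let ?Y = "\<lambda>s. X (2 * (k + degree (h s)))"
  let ?\<mu> = "measure (sphere_measure :: (real ^ 'n) measure) (sphere 0 1)"
  let ?\<tau> = "\<lambda>s. frobenius_threshold TYPE('n) k (h s)"
  have \<mu>: "0 < ?\<mu>" by (rule measure_sphere_pos)
  have A: "A s = averaging_op k (h s) ` {F \<in> forms (2 * k). \<forall>x \<in> ?Y s. 0 \<le> F x}" for s
    by (simp only: assms(5,6))
  have Y: "finite (?Y s)" "?Y s \<subseteq> sphere 0 1" "?Y s \<noteq> {}" for s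
    using assms(3)[of "k + degree (h s)"] cubature_nodes_nonempty[OF assms(3), of "k + degree (h s)"]
    by (simp_all add: cubature_rule_def)
  have sub: "A s \<subseteq> nonneg_forms (2 * k)" for s
    unfolding A nonneg_forms_def
    using averaging_op_forms[OF n k] averaging_op_nonneg[OF assms(3) assms(4)] by blast
  have part1: "polyhedral_cone_in (forms (2 * k)) (A s)" for s
    unfolding A by (rule polyhedral_cone_averaging_image[OF n k Y(1)])
  have part2: "f \<in> A s"
    if f: "f \<in> forms (2 * k)" and
      less: "?\<tau> s / ereal (sqrt ?\<mu>) * ereal (sphere_L2_norm f) < ereal (Min (f ` ?Y s))" for f s
  proof (cases "?\<tau> s")
    case (real t)
    have "t / sqrt ?\<mu> * sphere_L2_norm f < Min (f ` ?Y s)"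
      using less \<mu> by (simp add: real)
    then have "t / sqrt ?\<mu> * sphere_L2_norm f \<le> f x" if "x \<in> ?Y s" for x
      using Min_le[OF finite_imageI[OF Y(1)] imageI[OF that], of f] by linarith
    then show ?thesis
      unfolding A by (rule averaging_image_mem[OF n k Y(2) f real])
  next
    case PInf
    \<comment> \<open>In \<open>ereal\<close>, \<infinity> * 0 is 0, so for the zero form the
      hypothesis reads 0 < 0; for any other form its left side is \<infinity>. Either way it
      fails.\<close>
    show ?thesis
    proof (cases "sphere_L2_norm f = 0")
      case True
      then have "f = 0" by (rule sphere_L2_norm_eq_0[OF f])
      then have "f ` ?Y s = {0}" using Y(3)[of s] by (auto simp: fun_apply)
      then show ?thesis using less True by (simp flip: zero_ereal_def)
    next
      case False
      moreover have "0 \<le> sphere_L2_norm f" by (simp add: sphere_L2_norm_def)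
      ultimately have "0 < sphere_L2_norm f" by simp
      then show ?thesis using less PInf \<mu> by simp
    qed
  next
    case MInf
    then show ?thesis using frobenius_threshold_nonneg[of "TYPE('n)" k "h s"] by simp
  qed
  have part3: "\<exists>s. f \<in> A s"
    if lim: "?\<tau> \<longlonglongrightarrow> 0" and f: "f \<in> forms (2 * k)" and pos: "\<forall>x \<in> sphere 0 1. 0 < f x" for f
  proof -
    obtain e :: "real ^ 'n" where "e \<in> sphere 0 1" by (rule sphere_nonempty)
    then obtain x0 where x0: "x0 \<in> sphere 0 1" "\<And>x. x \<in> sphere 0 1 \<Longrightarrow> f x0 \<le> f x"
      using continuous_attains_inf[OF compact_sphere _ forms_continuous[OF f], of 0 1] by blast
    define c where "c = sphere_L2_norm f / sqrt ?\<mu>"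
    have c: "0 \<le> c" by (simp add: c_def sphere_L2_norm_def)
    have m: "0 < f x0" using pos x0(1) by blast
    \<comment> \<open>The + 1 makes the quotient usable from \<open>0 \<le> c\<close> alone. A
      threshold t below it is finite and satisfies \<open>t * c \<le> f x0\<close>, which is the
      estimate required at the nodes.\<close>
    then have "0 < ereal (f x0 / (c + 1))" using c by simp
    then have "eventually (\<lambda>s. ?\<tau> s < ereal (f x0 / (c + 1))) sequentially"
      using order_tendstoD(2)[OF lim] by blast
    then obtain s where s: "?\<tau> s < ereal (f x0 / (c + 1))"
      by (meson eventually_happens trivial_limit_sequentially)
    then obtain t where t: "?\<tau> s = ereal t"
      using frobenius_threshold_nonneg[of "TYPE('n)" k "h s"] by (cases "?\<tau> s") auto
    have "0 \<le> t" using frobenius_threshold_nonneg[of "TYPE('n)" k "h s"] by (simp add: t)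
    have "t < f x0 / (c + 1)" using s by (simp add: t)
    then have "t * (c + 1) < f x0" using c by (simp add: pos_less_divide_eq)
    then have "t * c \<le> f x0" using \<open>0 \<le> t\<close> by (simp add: distrib_left)
    then have "t / sqrt ?\<mu> * sphere_L2_norm f \<le> f x" if "x \<in> ?Y s" for x
      using x0(2)[of x] that Y(2)[of s] by (auto simp: c_def)
    then have "f \<in> A s"
      unfolding A by (rule averaging_image_mem[OF n k Y(2) f t])
    then show ?thesis by blast
  qed
  have closure: "nonneg_forms (2 * k) = top_of_set (forms (2 * k)) closure_of (\<Union>s. A s)"
    if "?\<tau> \<longlonglongrightarrow> 0"
  proof (rule nonneg_forms_closure)
    show "(\<Union>s. A s) \<subseteq> nonneg_forms (2 * k)" using sub by (rule UN_least)
    show "f \<in> (\<Union>s. A s)" if "f \<in> forms (2 * k)" "\<forall>x \<in> sphere 0 1. 0 < f x" for f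
      using part3[OF \<open>?\<tau> \<longlonglongrightarrow> 0\<close> that] by simp
  qed
  have "(nonneg_forms (2 * k) :: (real ^ 'n \<Rightarrow> real) set) \<subseteq> forms (2 * k)"
    by (auto simp: nonneg_forms_def)
  then show ?thesis
    by (intro conjI allI impI ballI part1 sub part2 part3 closure) blast+
qed

end
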